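(* For every integer $t\geq 1$ and every integer $q\geq 3t$, there exists a spherical $t$-design on $\mathbb S^2$ with exactly $6q^2$ points. In particular, taking $q=3t$, for every integer $t\ge 1$ there exists a spherical $t$-design on $\mathbb S^2$ with exactly $54t^2$ points.
   Context: $\mathbb S^2=\{x\in\mathbb R^3:\|x\|_{\ell_2}=1\}$ carries the normalized surface measure $\sigma$, with $\sigma(\mathbb S^2)=1$. A set of (pairwise distinct) points $x_1,\dots,x_N\in\mathbb S^2$ is a spherical $t$-design if $\frac1N\sum_{i=1}^N P(x_i)=\int_{\mathbb S^2}P\,d\sigma$ for every real polynomial $P$ in three variables of total degree at most $t$. *)

theory Defs
  imports "HOL-Analysis.Analysis"
begin

(* The normalized surface measure is taken as the cone measure: sigma(A), for A a Borel subset of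
   the sphere, is the fraction of the unit ball filled by the cone over A with apex 0
   (sphere_measure_cone below).  Technically it is a Borel measure on the whole space that is
   concentrated on the unit sphere.  The value of x /\<^sub>R norm x at x = 0 is irrelevant, {0} being
   a null set. *)
definition sphere_measure :: "(real ^ 3) measure" where
  "sphere_measure = distr (uniform_measure lborel (ball 0 1)) borel (\<lambda>x. x /\<^sub>R norm x)"

(* The polynomial function sum c i j k x1^i x2^j x3^k over i + j + k <= t; the coefficients c i j k
   with i + j + k > t are ignored.  As c varies, these are exactly the real polynomials in three
   variables of total degree at most t. *)
definition poly3 :: "nat \<Rightarrow> (nat \<Rightarrow> nat \<Rightarrow> nat \<Rightarrow> real) \<Rightarrow> real ^ 3 \<Rightarrow> real" where
  "poly3 t c x = (\<Sum>(i, j, k) \<in> {(i, j, k). i + j + k \<le> t}. c i j k * (x $ 1) ^ i * (x $ 2) ^ j * (x $ 3) ^ k)"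

definition spherical_design :: "nat \<Rightarrow> (real ^ 3) set \<Rightarrow> bool" where
  "spherical_design t X \<longleftrightarrow>
     finite X \<and> X \<subseteq> sphere 0 1 \<and>
     (\<forall>c. (1 / real (card X)) * (\<Sum>x\<in>X. poly3 t c x) = (\<integral>x. poly3 t c x \<partial>sphere_measure))"


lemma finite_poly3_exponents: "finite {(i, j, k). i + j + k \<le> (t::nat)}"
  by (rule finite_subset[of _ "{..t} \<times> {..t} \<times> {..t}"]) auto

lemma normalize_measurable [measurable]:
  "(\<lambda>x::real ^ 3. x /\<^sub>R norm x) \<in> borel_measurable borel"
  by measurable

lemma sets_sphere_measure [simp, measurable_cong]: "sets sphere_measure = sets borel"
  and space_sphere_measure [simp]: "space sphere_measure = UNIV"
  by (simp_all add: sphere_measure_def)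

lemma emeasure_unit_ball:
  "emeasure lborel (ball 0 1 :: (real ^ 3) set) = ennreal (4 / 3 * pi)"
  by (simp add: emeasure_ball unit_ball_vol_3)

lemma emeasure_sphere_measure:
  assumes "A \<in> sets borel"
  shows "emeasure sphere_measure A =
         emeasure lborel {y \<in> ball 0 1. y /\<^sub>R norm y \<in> A} / ennreal (4 / 3 * pi)"
proof -
  have B: "(\<lambda>x. x /\<^sub>R norm x) -` A \<in> sets (borel :: (real ^ 3) measure)"
    using measurable_sets[OF normalize_measurable assms] by simp
  have "emeasure sphere_measure A =
        emeasure (uniform_measure lborel (ball 0 1)) ((\<lambda>x. x /\<^sub>R norm x) -` A)"
    unfolding sphere_measure_def using assms by (subst emeasure_distr) auto
  also have "\<dots> = emeasure lborel (ball 0 1 \<inter> (\<lambda>x. x /\<^sub>R norm x) -` A) / ennreal (4 / 3 * pi)"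
    using B by (subst emeasure_uniform_measure) (auto simp: emeasure_unit_ball)
  also have "ball 0 1 \<inter> (\<lambda>x. x /\<^sub>R norm x) -` A = {y \<in> ball 0 1. y /\<^sub>R norm y \<in> A}"
    by auto
  finally show ?thesis .
qed

lemma sphere_measure_cone:
  assumes "A \<in> sets borel" and "A \<subseteq> sphere 0 1"
  shows "emeasure sphere_measure A =
         emeasure lborel {r *\<^sub>R x | r x. 0 < r \<and> r < 1 \<and> x \<in> A} / emeasure lborel (ball 0 1 :: (real ^ 3) set)"
proof -
  have "{y \<in> ball 0 1. y /\<^sub>R norm y \<in> A} = {r *\<^sub>R x | r x. 0 < r \<and> r < 1 \<and> x \<in> A}" (is "?L = ?R")
  proof (intro equalityI subsetI)
    fix y assume y: "y \<in> ?L"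
    have "y \<noteq> 0" using y assms(2) by auto
    then have "y = norm y *\<^sub>R (y /\<^sub>R norm y)" "0 < norm y" by simp_all
    then show "y \<in> ?R" using y by fastforce
  next
    fix y assume "y \<in> ?R"
    then obtain r x where rx: "y = r *\<^sub>R x" "0 < r" "r < 1" "x \<in> A" by auto
    then have "norm x = 1" using assms(2) by auto
    with rx show "y \<in> ?L" by simp
  qed
  then show ?thesis
    using emeasure_sphere_measure[OF assms(1)] by (simp add: emeasure_unit_ball)
qed

lemma emeasure_sphere_measure_UNIV: "emeasure sphere_measure UNIV = 1"
proof -
  have "{y :: real ^ 3. y \<in> ball 0 1 \<and> y /\<^sub>R norm y \<in> UNIV} = ball 0 1"
    by auto
  then have "emeasure sphere_measure UNIV = ennreal (4 / 3 * pi) / ennreal (4 / 3 * pi)"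
    using emeasure_sphere_measure[of UNIV] emeasure_unit_ball by simp
  also have "\<dots> = 1"
    by (rule ennreal_divide_self) auto
  finally show ?thesis .
qed

lemma finite_measure_sphere_measure: "finite_measure sphere_measure"
  by (rule finite_measureI) (simp add: emeasure_sphere_measure_UNIV)

lemma AE_sphere_measure: "AE x in sphere_measure. x \<in> sphere 0 1"
proof -
  have "AE x in lborel. x \<noteq> (0 :: real ^ 3)"
    by (rule AE_lborel_singleton)
  then have "AE x :: real ^ 3 in lborel. x \<in> ball 0 1 \<longrightarrow> norm (x /\<^sub>R norm x) = 1"
    by (rule eventually_mono) simp
  then have "AE x :: real ^ 3 in uniform_measure lborel (ball 0 1). norm (x /\<^sub>R norm x) = 1"
    by (intro AE_uniform_measureI) auto
  then show ?thesis
    unfolding sphere_measure_def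
    by (subst AE_distr_iff) auto
qed

lemma emeasure_sphere_measure_sphere: "emeasure sphere_measure (sphere 0 1) = 1"
proof -
  have "emeasure sphere_measure (sphere 0 1) = emeasure sphere_measure UNIV"
    by (rule emeasure_eq_AE) (use AE_sphere_measure in auto)
  then show ?thesis by (simp add: emeasure_sphere_measure_UNIV)
qed

lemma sphere_measure_orthogonal:
  fixes f :: "real ^ 3 \<Rightarrow> real ^ 3"
  assumes f: "orthogonal_transformation f"
  shows "distr sphere_measure borel f = sphere_measure"
proof (rule measure_eqI)
  have f_meas [measurable]: "f \<in> borel_measurable borel"
    using orthogonal_transformation_linear[OF f]
    by (intro borel_measurable_continuous_onI linear_continuous_on linear_conv_bounded_linear[THEN iffD1])
  have lin: "linear f" and nrm: "norm (f x) = norm x" for x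
    using f by (auto simp: orthogonal_transformation)
  fix A assume "A \<in> sets (distr sphere_measure borel f)"
  then have A [measurable]: "A \<in> sets borel" by simp
  have fA: "f -` A \<in> sets borel"
    using measurable_sets[OF f_meas A] by simp
  define S where "S = {y \<in> ball 0 1. y /\<^sub>R norm y \<in> f -` A}"
  define T where "T = {y \<in> ball 0 1. y /\<^sub>R norm y \<in> A}"
  have bor: "{y \<in> ball 0 1. y /\<^sub>R norm y \<in> B} \<in> sets borel" if "B \<in> sets borel" for B :: "(real ^ 3) set"
  proof -
    have "ball 0 1 \<inter> (\<lambda>y. y /\<^sub>R norm y) -` B \<in> sets (borel :: (real ^ 3) measure)"
      using measurable_sets[OF normalize_measurable that] by auto
    then show ?thesis by (simp add: Int_def vimage_def)
  qed
  have fS: "f ` S = T"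
  proof (intro equalityI subsetI)
    fix z assume "z \<in> f ` S"
    then show "z \<in> T" by (auto simp: S_def T_def nrm linear_cmul[OF lin])
  next
    fix z assume z: "z \<in> T"
    obtain y where y: "z = f y"
      using orthogonal_transformation_surj[OF f] by (metis surjD)
    with z show "z \<in> f ` S" by (auto simp: S_def T_def nrm linear_cmul[OF lin])
  qed
  have "bounded S" "bounded T"
    by (rule bounded_subset[OF bounded_ball[of 0 1]], force simp: S_def T_def)+
  moreover have "S \<in> sets lebesgue" "T \<in> sets lebesgue"
    using bor[OF fA] bor[OF A] by (auto simp: S_def T_def)
  ultimately have fin: "S \<in> lmeasurable" "T \<in> lmeasurable"
    by (simp_all add: bounded_set_imp_lmeasurable)
  have "measure lebesgue T = measure lebesgue S"
    using measure_orthogonal_image[OF f fin(1)] fS by simp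
  then have "emeasure lebesgue S = emeasure lebesgue T"
    using fin by (simp add: emeasure_eq_measure2)
  then have "emeasure lborel S = emeasure lborel T"
    using bor[OF fA] bor[OF A] by (simp add: S_def T_def)
  then show "emeasure (distr sphere_measure borel f) A = emeasure sphere_measure A"
    using emeasure_sphere_measure[OF A] emeasure_sphere_measure[OF fA]
    by (subst emeasure_distr) (auto simp: S_def T_def)
qed simp

lemma integrable_poly3: "integrable sphere_measure (poly3 t c)"
proof -
  have cont: "continuous_on UNIV (poly3 t c)"
    unfolding poly3_def[abs_def] case_prod_beta by (intro continuous_intros)
  then have m: "poly3 t c \<in> borel_measurable sphere_measure"
    by (simp add: borel_measurable_continuous_onI cong: measurable_cong_sets)
  have "bounded (poly3 t c ` sphere 0 1)"
    by (intro compact_imp_bounded compact_continuous_image continuous_on_subset[OF cont]) auto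
  then obtain B where "\<And>x. x \<in> sphere 0 1 \<Longrightarrow> norm (poly3 t c x) \<le> B"
    unfolding bounded_iff by blast
  then have "AE x in sphere_measure. norm (poly3 t c x) \<le> B"
    using AE_sphere_measure by (auto elim!: eventually_mono)
  then show ?thesis
    using finite_measure.integrable_const_bound[OF finite_measure_sphere_measure _ m] by blast
qed

end

theory Submission
  imports Defs "HOL-Computational_Algebra.Polynomial"
begin

text \<open>
  All points are placed on one injective curve, the snake, which runs through \<open>O(t)\<close> parallels of the
  sphere. The decisive inequality is that a polynomial \<open>f\<close> of degree at most \<open>t\<close> with mean zero has
  variation less than \<open>108 t\<^sup>2 max f\<close> along the snake. To prove it, write \<open>m = max f\<close> and
  \<open>h = m - f \<ge> 0\<close> on the snake. A zonal kernel \<open>K\<close> reproduces \<open>h\<close>, and a product quadrature rule with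
  positive weights and nodes on the snake turns this into \<open>h(x) = \<Sum> c\<^sub>y h(y) K(x \<bullet> y)\<close> with
  \<open>\<Sum> c\<^sub>y h(y) = m\<close>, so the variation of \<open>f\<close> is at most \<open>m\<close> times that of one \<open>K(\<cdot> \<bullet> y)\<close>. Along a
  parallel or a meridian the inner product \<open>x \<bullet> y\<close> attains each value at most twice, so the variation of
  the kernel is bounded by integrals of \<open>\<bar>K'\<bar>\<close>, which \<open>L\<^sup>2\<close> identities for Jacobi polynomials control.

  Distribute mass on the snake with density proportional to \<open>exp(\<beta> f)\<close>, \<open>\<beta>\<close> large, and take \<open>N\<close>
  equidistributed quantiles \<open>x\<^sub>l(f)\<close>. The mean of \<open>f\<close> with respect to this mass is close to \<open>max f\<close>, and
  replacing it by the quantiles costs at most half the variation divided by \<open>N\<close>, so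
  \<open>\<Sum> f(x\<^sub>l(f)) > 0\<close> for all \<open>f \<noteq> 0\<close> on the boundary of a cube of coefficients once \<open>N \<ge> 54 t\<^sup>2\<close>.
  By a Brouwer argument some \<open>f\<close> then satisfies \<open>\<Sum> g(x\<^sub>l(f)) = 0\<close> for all \<open>g\<close> at once.
\<close>

section \<open>A variational inequality on cubes\<close>

text \<open>Two demands compete: the points must depend continuously on the coefficients of
  \<open>f\<close>, and they must stay pairwise distinct. Quantiles of a positive density on an
  injective curve meet both, which is why everything takes place on a single curve. The size is then
  decided by a comparison. The quantiles gain \<open>N\<close> times the maximum, up to an error
  controlled by \<beta>, and lose half the variation, so it suffices that the variation is below
  \<open>2 N\<close> times the maximum; this is the origin of 108 = 2 * 54. Every size from
  \<open>54 t\<^sup>2\<close> on is reached, in particular \<open>6 q\<^sup>2\<close> for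
  \<open>q \<ge> 3 t\<close>. The evaluation kernel of degree \<open>t\<close> alone is too spread
  out: the estimates used here would only give order \<open>t\<^sup>3\<close>. A second factor of
  degree \<open>s\<close> repairs this. With \<open>S = s + 1\<close>, the dominant term of the
  resulting bound is a multiple of \<open>(t + S)\<^sup>3 / S\<close>, which is smallest at
  \<open>S = t / 2\<close>; hence the choice of \<open>s\<close>. The bound then behaves like
  \<open>77 t\<^sup>2\<close> for large \<open>t\<close>, and 108 is dictated by
  \<open>t = 1\<close>.\<close>

lemma compact_unit_cube_nat:
  "compact {a :: nat \<Rightarrow> real. \<forall>i. \<bar>a i\<bar> \<le> (if i < n then 1 else 0)}"
proof -
  have "{a :: nat \<Rightarrow> real. \<forall>i. \<bar>a i\<bar> \<le> (if i < n then 1 else 0)}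
      = PiE UNIV (\<lambda>i. if i < n then {-1..1} else {0})"
  proof (intro set_eqI iffI)
    fix a :: "nat \<Rightarrow> real"
    assume "a \<in> PiE UNIV (\<lambda>i. if i < n then {-1..1} else {0})"
    then have a: "a i \<in> (if i < n then {-1..1} else {0})" for i by (rule PiE_mem) simp
    have "\<bar>a i\<bar> \<le> (if i < n then 1 else 0)" for i
      using a[of i] by (cases "i < n") auto
    then show "a \<in> {a. \<forall>i. \<bar>a i\<bar> \<le> (if i < n then 1 else 0)}" by simp
  next
    fix a :: "nat \<Rightarrow> real"
    assume "a \<in> {a. \<forall>i. \<bar>a i\<bar> \<le> (if i < n then 1 else 0)}"
    then have a: "\<bar>a i\<bar> \<le> (if i < n then 1 else 0)" for i by simp
    have "a i \<in> (if i < n then {-1..1} else {0})" for i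
      using a[of i] by (cases "i < n") auto
    then show "a \<in> PiE UNIV (\<lambda>i. if i < n then {-1..1} else {0})" by auto
  qed
  moreover have "compactin (product_topology (\<lambda>i. euclidean) UNIV)
      (PiE UNIV (\<lambda>i. if i < n then {-1..1::real} else {0}))"
    by (subst compactin_PiE) auto
  ultimately show ?thesis
    by (simp add: euclidean_product_topology)
qed

text \<open>The points sought are the fixed points of \<open>a - G a\<close> projected back to the
  cube, so this is Brouwer's theorem in another form. It is derived directly from Kuhn's
  combinatorial lemma: every grid has a cell carrying both labels in each coordinate, and as the
  mesh shrinks these cells accumulate at a solution. The dimension \<open>n\<close> is a variable,
  so vectors are functions on \<open>nat\<close> that vanish from \<open>n\<close> on.\<close>

lemma cube_variational_inequality:
  fixes G :: "(nat \<Rightarrow> real) \<Rightarrow> nat \<Rightarrow> real"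
  assumes cont: "\<And>i. i < n \<Longrightarrow> continuous_on UNIV (\<lambda>a. G a i)"
  shows "\<exists>a. (\<forall>i. \<bar>a i\<bar> \<le> (if i < n then 1 else 0)) \<and>
           (\<forall>i<n. G a i = 0 \<or> (a i = 1 \<and> G a i < 0) \<or> (a i = -1 \<and> G a i > 0))"
proof -
  define pt :: "nat \<Rightarrow> (nat \<Rightarrow> nat) \<Rightarrow> nat \<Rightarrow> real"
    where "pt p x = (\<lambda>i. if i < n then 2 * real (x i) / real p - 1 else 0)" for p x
  \<comment> \<open>Kuhn's lemma forces label 0 on the lower face and label 1 on the upper one.
    Elsewhere 0 means \<open>G < 0\<close> and 1 means \<open>G \<ge> 0\<close>, so a limit with
    \<open>G > 0\<close> can be approached by vertices of label 0 only along the lower face, and one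
    with \<open>G < 0\<close> by vertices of label 1 only along the upper face.\<close>
  define lab :: "nat \<Rightarrow> (nat \<Rightarrow> nat) \<Rightarrow> nat \<Rightarrow> nat"
    where "lab p x i = (if x i = 0 then 0 else if x i = p then 1 else if G (pt p x) i < 0 then 0 else 1)"
    for p x i
  have "\<exists>q. (\<forall>i<n. q i < Suc p) \<and> (\<forall>i<n. \<exists>r s.
      (\<forall>j<n. q j \<le> r j \<and> r j \<le> q j + 1) \<and> (\<forall>j<n. q j \<le> s j \<and> s j \<le> q j + 1) \<and>
      lab (Suc p) r i = 0 \<and> lab (Suc p) s i = 1)" for p
  proof -
    obtain q where qlt: "\<forall>i<n. q i < Suc p" and
      q: "\<forall>i<n. \<exists>r s. (\<forall>j<n. q j \<le> r j \<and> r j \<le> q j + 1) \<and>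
         (\<forall>j<n. q j \<le> s j \<and> s j \<le> q j + 1) \<and> lab (Suc p) r i \<noteq> lab (Suc p) s i"
      by (rule kuhn_lemma[of "Suc p" n "lab (Suc p)"]) (auto simp: lab_def)
    have lab01: "lab (Suc p) r i = 0 \<or> lab (Suc p) r i = 1" for r i
      by (auto simp: lab_def)
    have "\<exists>r s. (\<forall>j<n. q j \<le> r j \<and> r j \<le> q j + 1) \<and> (\<forall>j<n. q j \<le> s j \<and> s j \<le> q j + 1) \<and>
        lab (Suc p) r i = 0 \<and> lab (Suc p) s i = 1" if ilt: "i < n" for i
    proof -
      obtain r s where rs: "\<forall>j<n. q j \<le> r j \<and> r j \<le> q j + 1" "\<forall>j<n. q j \<le> s j \<and> s j \<le> q j + 1"
        "lab (Suc p) r i \<noteq> lab (Suc p) s i"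
        using q[rule_format, OF ilt] by (elim exE conjE) (rule that)
      show ?thesis
      proof (cases "lab (Suc p) r i = 0")
        case True
        then have "lab (Suc p) s i = 1" using rs(3) lab01[of s i] by simp
        with True rs(1,2) show ?thesis by (intro exI[of _ r] exI[of _ s] conjI)
      next
        case False
        then have "lab (Suc p) r i = 1" "lab (Suc p) s i = 0" using rs(3) lab01[of s i] lab01[of r i] by auto
        with rs(1,2) show ?thesis by (intro exI[of _ s] exI[of _ r] conjI)
      qed
    qed
    then show ?thesis using qlt by blast
  qed
  then obtain q where q: "\<And>p i. i < n \<Longrightarrow> q p i < Suc p"
    and ex: "\<And>p i. i < n \<Longrightarrow> \<exists>r s.
      (\<forall>j<n. q p j \<le> r j \<and> r j \<le> q p j + 1) \<and> (\<forall>j<n. q p j \<le> s j \<and> s j \<le> q p j + 1) \<and>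
      lab (Suc p) r i = 0 \<and> lab (Suc p) s i = 1"
    by metis
  define P where "P p i rs \<longleftrightarrow>
      (\<forall>j<n. q p j \<le> fst rs j \<and> fst rs j \<le> q p j + 1) \<and> (\<forall>j<n. q p j \<le> snd rs j \<and> snd rs j \<le> q p j + 1) \<and>
      lab (Suc p) (fst rs) i = 0 \<and> lab (Suc p) (snd rs) i = 1" for p i and rs :: "(nat \<Rightarrow> nat) \<times> (nat \<Rightarrow> nat)"
  have "\<exists>rs. P p i rs" if "i < n" for p i
    using ex[OF that, of p] unfolding P_def by simp
  then have P: "P p i (SOME rs. P p i rs)" if "i < n" for p i
    using that by (simp add: someI_ex)
  define r s where "r p i = fst (SOME rs. P p i rs)" and "s p i = snd (SOME rs. P p i rs)" for p i
  have r: "\<And>p i j. i < n \<Longrightarrow> j < n \<Longrightarrow> q p j \<le> r p i j \<and> r p i j \<le> q p j + 1"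
    and s: "\<And>p i j. i < n \<Longrightarrow> j < n \<Longrightarrow> q p j \<le> s p i j \<and> s p i j \<le> q p j + 1"
    and lr: "\<And>p i. i < n \<Longrightarrow> lab (Suc p) (r p i) i = 0"
    and ls: "\<And>p i. i < n \<Longrightarrow> lab (Suc p) (s p i) i = 1"
    using P unfolding P_def r_def s_def by blast+
  define K where "K = {a :: nat \<Rightarrow> real. \<forall>i. \<bar>a i\<bar> \<le> (if i < n then 1 else 0)}"
  have "seq_compact K"
    using compact_unit_cube_nat[of n] unfolding K_def by (simp add: compact_eq_seq_compact_metric)
  moreover have "\<forall>p. pt (Suc p) (q p) \<in> K"
  proof
    fix p
    have "2 * real (q p i) \<le> 2 + real p * 2" if "i < n" for i
      using q[OF that, of p] by simp
    then show "pt (Suc p) (q p) \<in> K"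
      unfolding K_def pt_def by (auto simp: field_simps abs_le_iff)
  qed
  ultimately obtain a k where "a \<in> K" and k: "strict_mono (k :: nat \<Rightarrow> nat)"
    and lim: "((\<lambda>p. pt (Suc p) (q p)) \<circ> k) \<longlonglongrightarrow> a"
    unfolding seq_compact_def by metis
  have ptl: "(\<lambda>p. pt (Suc (k p)) (q (k p)) i) \<longlonglongrightarrow> a i" for i
  proof -
    have "continuous_on UNIV (\<lambda>x :: nat \<Rightarrow> real. x i)" by simp
    from continuous_on_tendsto_compose[OF this lim] show ?thesis by (simp add: o_def)
  qed
  have zero: "(\<lambda>p. 2 / real (Suc (k p))) \<longlonglongrightarrow> 0"
  proof -
    have "(\<lambda>p. 2 / real (Suc p)) \<longlonglongrightarrow> 0" by (rule LIMSEQ_Suc[OF lim_const_over_n])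
    from LIMSEQ_subseq_LIMSEQ[OF this k] show ?thesis by (simp add: o_def)
  qed
  \<comment> \<open>The mesh tends to 0, so every choice of vertices from the selected cells has the
    same limit as their corners \<open>q\<close>.\<close>
  have near: "(\<lambda>p. pt (Suc (k p)) (v p)) \<longlonglongrightarrow> a"
    if v: "\<And>p j. j < n \<Longrightarrow> q (k p) j \<le> v p j \<and> v p j \<le> q (k p) j + 1" for v :: "nat \<Rightarrow> nat \<Rightarrow> nat"
  proof -
    have c: "(\<lambda>p. pt (Suc (k p)) (v p) i) \<longlonglongrightarrow> a i" for i
    proof (rule tendsto_sandwich)
      have lo: "pt (Suc (k p)) (q (k p)) i \<le> pt (Suc (k p)) (v p) i" for p
        using v[of i p] by (auto simp: pt_def divide_right_mono)
      have hi: "pt (Suc (k p)) (v p) i \<le> pt (Suc (k p)) (q (k p)) i + 2 / real (Suc (k p))" for p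
      proof (cases "i < n")
        case True
        have "real (v p i) \<le> real (q (k p) i) + 1" using v[OF True, of p] by linarith
        then show ?thesis using True
          by (simp add: pt_def add_divide_distrib[symmetric] divide_right_mono)
      qed (simp add: pt_def)
      show "\<forall>\<^sub>F p in sequentially. pt (Suc (k p)) (q (k p)) i \<le> pt (Suc (k p)) (v p) i" using lo by simp
      show "\<forall>\<^sub>F p in sequentially. pt (Suc (k p)) (v p) i \<le> pt (Suc (k p)) (q (k p)) i + 2 / real (Suc (k p))"
        using hi by simp
      show "(\<lambda>p. pt (Suc (k p)) (q (k p)) i) \<longlonglongrightarrow> a i" by (rule ptl)
      show "(\<lambda>p. pt (Suc (k p)) (q (k p)) i + 2 / real (Suc (k p))) \<longlonglongrightarrow> a i"
        using tendsto_add[OF ptl zero] by simp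
    qed
    have "limitin (product_topology (\<lambda>i. euclidean) UNIV) (\<lambda>p. pt (Suc (k p)) (v p)) a sequentially"
      by (subst limitin_componentwise) (use c in auto)
    then show ?thesis by (simp add: euclidean_product_topology)
  qed
  have "G a i = 0 \<or> (a i = 1 \<and> G a i < 0) \<or> (a i = -1 \<and> G a i > 0)" if i: "i < n" for i
  proof -
    have nr: "(\<lambda>p. pt (Suc (k p)) (r (k p) i)) \<longlonglongrightarrow> a"
      by (rule near) (use r i in blast)
    have ns: "(\<lambda>p. pt (Suc (k p)) (s (k p) i)) \<longlonglongrightarrow> a"
      by (rule near) (use s i in blast)
    have coord: "continuous_on UNIV (\<lambda>x :: nat \<Rightarrow> real. x i)" by simp
    have Gr: "(\<lambda>p. G (pt (Suc (k p)) (r (k p) i)) i) \<longlonglongrightarrow> G a i"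
      using continuous_on_tendsto_compose[OF cont[OF i] nr] by simp
    have Gs: "(\<lambda>p. G (pt (Suc (k p)) (s (k p) i)) i) \<longlonglongrightarrow> G a i"
      using continuous_on_tendsto_compose[OF cont[OF i] ns] by simp
    have cr: "(\<lambda>p. pt (Suc (k p)) (r (k p) i) i) \<longlonglongrightarrow> a i"
      using continuous_on_tendsto_compose[OF coord nr] by simp
    have cs: "(\<lambda>p. pt (Suc (k p)) (s (k p) i) i) \<longlonglongrightarrow> a i"
      using continuous_on_tendsto_compose[OF coord ns] by simp
    have 1: "a i = -1" if "G a i > 0"
    proof -
      have "\<forall>\<^sub>F p in sequentially. 0 < G (pt (Suc (k p)) (r (k p) i)) i"
        using order_tendstoD(1)[OF Gr that] .
      then have "\<forall>\<^sub>F p in sequentially. pt (Suc (k p)) (r (k p) i) i = -1"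
      proof eventually_elim
        case (elim p)
        then have "r (k p) i i = 0"
          using lr[OF i, of "k p"] by (auto simp: lab_def split: if_splits)
        then show ?case using i by (simp add: pt_def)
      qed
      then have "(\<lambda>p. pt (Suc (k p)) (r (k p) i) i) \<longlonglongrightarrow> -1"
        by (rule tendsto_eventually)
      with cr show ?thesis using LIMSEQ_unique by blast
    qed
    have 2: "a i = 1" if "G a i < 0"
    proof -
      have "\<forall>\<^sub>F p in sequentially. 0 > G (pt (Suc (k p)) (s (k p) i)) i"
        using order_tendstoD(2)[OF Gs that] .
      then have "\<forall>\<^sub>F p in sequentially. pt (Suc (k p)) (s (k p) i) i = 1"
      proof eventually_elim
        case (elim p)
        then have "s (k p) i i = Suc (k p)"
          using ls[OF i, of "k p"] by (auto simp: lab_def split: if_splits)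
        then show ?case using i by (simp add: pt_def field_simps)
      qed
      then have "(\<lambda>p. pt (Suc (k p)) (s (k p) i) i) \<longlonglongrightarrow> 1"
        by (rule tendsto_eventually)
      with cs show ?thesis using LIMSEQ_unique by blast
    qed
    show ?thesis using 1 2 by linarith
  qed
  moreover have "\<forall>i. \<bar>a i\<bar> \<le> (if i < n then 1 else 0)"
    using \<open>a \<in> K\<close> unfolding K_def by blast
  ultimately show ?thesis by blast
qed

section \<open>Fejer quadrature\<close>

lemma integral_power_symmetric:
  "integral {-1..1} (\<lambda>z :: real. z ^ k) = 1 ^ Suc k / real (Suc k) - (-1) ^ Suc k / real (Suc k)"
proof (rule integral_unique, rule fundamental_theorem_of_calculus)
  have "((\<lambda>z. z ^ Suc k / real (Suc k)) has_real_derivative z ^ k) (at z within {-1..1})" for z :: real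
    by (rule derivative_eq_intros refl | simp del: power_Suc of_nat_Suc)+
  then show "((\<lambda>z. z ^ Suc k / real (Suc k)) has_vector_derivative z ^ k) (at z within {-1..1})" for z :: real
    by (simp only: has_real_derivative_iff_has_vector_derivative)
qed simp

text \<open>The cosines of these angles are the zeros of the Chebyshev polynomial of the first kind
  of degree \<open>M\<close>.\<close>

definition fejer_node :: "nat \<Rightarrow> nat \<Rightarrow> real" where
  "fejer_node M j = (2 * real j + 1) * pi / (2 * real M)"

lemma fejer_node_bounds: "j < M \<Longrightarrow> 0 < fejer_node M j \<and> fejer_node M j < pi"
proof -
  assume j: "j < M"
  then have "2 * real j + 1 < 2 * real M" by linarith
  then have "(2 * real j + 1) * pi < 2 * real M * pi" by (intro mult_strict_right_mono) auto
  then have "fejer_node M j < pi" using j by (simp add: fejer_node_def field_simps)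
  moreover have "0 < (2 * real j + 1) * pi" by (intro mult_pos_pos) (auto intro: add_nonneg_pos)
  ultimately show ?thesis using j by (simp add: fejer_node_def)
qed

text \<open>Fejer's first rule with \<open>2 n + 1\<close> nodes, scaled to total weight 1 so that
  it yields averages over \<open>[-1, 1]\<close>. The denominators come from the integral of
  \<open>cos (2 k x) * sin x\<close> over \<open>[0, pi]\<close>, which is
  \<open>2 / (1 - 4 k\<^sup>2)\<close>.\<close>

definition fejer_weight :: "nat \<Rightarrow> nat \<Rightarrow> real" where
  "fejer_weight n j = (1 - 2 * (\<Sum>k=1..n. cos (2 * real k * fejer_node (2 * n + 1) j) / (4 * (real k)\<^sup>2 - 1))) / real (2 * n + 1)"

text \<open>Multiplication by \<open>2 * sin \<beta>\<close> telescopes the sum to a sine at a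
  multiple of \<open>pi\<close>. The range of \<open>l\<close> is sharp: for \<open>l = 2 M\<close>
  every term equals -1.\<close>

lemma sum_cos_fejer_node:
  fixes l :: int
  assumes M: "0 < M" and l: "\<bar>l\<bar> < 2 * int M"
  shows "(\<Sum>j<M. cos (of_int l * fejer_node M j)) = (if l = 0 then real M else 0)"
proof (cases "l = 0")
  case False
  define \<beta> where "\<beta> = of_int l * pi / (2 * real M)"
  have "sin \<beta> \<noteq> 0"
  proof
    assume "sin \<beta> = 0"
    then obtain i :: int where "\<beta> = of_int i * pi" by (auto simp: sin_zero_iff_int2)
    then have "real_of_int l = of_int (i * (2 * int M))" using M by (simp add: \<beta>_def field_simps)
    then have li: "l = i * (2 * int M)" by (simp only: of_int_eq_iff)
    then have "1 \<le> \<bar>i\<bar>" using False by auto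
    then have "2 * int M \<le> \<bar>i\<bar> * (2 * int M)" using M by (simp add: mult_le_cancel_right1)
    then show False using l li by (simp add: abs_mult)
  qed
  have "2 * sin \<beta> * (\<Sum>j<m. cos (of_int l * fejer_node M j)) = sin (2 * real m * \<beta>)" for m
  proof (induction m)
    case (Suc m)
    have "of_int l * fejer_node M m = (2 * real m + 1) * \<beta>"
      by (simp add: fejer_node_def \<beta>_def)
    moreover have "2 * sin \<beta> * cos ((2 * real m + 1) * \<beta>) = sin (2 * real (Suc m) * \<beta>) - sin (2 * real m * \<beta>)"
      using sin_add[of "(2 * real m + 1) * \<beta>" \<beta>] sin_diff[of "(2 * real m + 1) * \<beta>" \<beta>]
      by (simp add: algebra_simps)
    ultimately show ?case using Suc by (simp add: distrib_left)
  qed simp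
  from this[of M] have "2 * sin \<beta> * (\<Sum>j<M. cos (of_int l * fejer_node M j)) = sin (of_int l * pi)"
    using M by (simp add: \<beta>_def)
  moreover have "sin (of_int l * pi) = 0" using sin_npi_int[of l] by (simp add: mult.commute)
  ultimately show ?thesis using \<open>sin \<beta> \<noteq> 0\<close> False by simp
qed simp

text \<open>In the worst case all cosines are 1; then
  \<open>2 / (4 k\<^sup>2 - 1) = 1 / (2 k - 1) - 1 / (2 k + 1)\<close> telescopes to a value below
  1. Positivity is what allows the rule to turn a nonnegative function into nonnegative
  coefficients.\<close>

lemma fejer_weight_pos: "0 < fejer_weight n j"
proof -
  have tele: "2 * (\<Sum>k=1..m. 1 / (4 * (real k)\<^sup>2 - 1)) = 1 - 1 / (2 * real m + 1)" for m :: nat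
  proof (induction m)
    case (Suc m)
    have "4 * (real (Suc m))\<^sup>2 - 1 = (2 * real m + 1) * (2 * real m + 3)"
      by (simp add: power2_eq_square algebra_simps)
    then have "2 * (\<Sum>k=1..Suc m. 1 / (4 * (real k)\<^sup>2 - 1)) = 1 - 1 / (2 * real m + 1) + 2 / ((2 * real m + 1) * (2 * real m + 3))"
      using Suc by simp
    also have "\<dots> = 1 - 1 / (2 * real (Suc m) + 1)"
      by (simp add: divide_simps) (simp add: algebra_simps)
    finally show ?case .
  qed simp
  have "2 * (\<Sum>k=1..n. cos (2 * real k * fejer_node (2 * n + 1) j) / (4 * (real k)\<^sup>2 - 1))
      \<le> 2 * (\<Sum>k=1..n. 1 / (4 * (real k)\<^sup>2 - 1))"
  proof (intro mult_left_mono sum_mono divide_right_mono)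
    fix k assume "k \<in> {1..n}"
    then have "1 \<le> (real k)\<^sup>2" by simp
    then show "0 \<le> 4 * (real k)\<^sup>2 - 1" by linarith
  qed auto
  also have "\<dots> < 1" unfolding tele by simp
  finally show ?thesis by (simp add: fejer_weight_def)
qed

text \<open>Half the integral of \<open>cos (l x) * sin x\<close> over \<open>[0, pi]\<close>. It
  vanishes for odd \<open>l\<close>, which covers the singular values 1 and -1 of the
  fraction.\<close>

definition fejer_moment :: "int \<Rightarrow> real" where
  "fejer_moment l = (if even l then 1 / (1 - (of_int l)\<^sup>2) else 0)"

text \<open>Product-to-sum formulas move each term of the weight to the frequencies
  \<open>2 k + l\<close> and \<open>2 k - l\<close>. Discrete orthogonality leaves only the term
  with \<open>2 k = \<bar>l\<bar>\<close>, which exists exactly for even nonzero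
  \<open>l\<close>.\<close>

lemma fejer_weight_cos:
  fixes l :: int
  assumes l: "\<bar>l\<bar> \<le> 2 * int n"
  shows "(\<Sum>j<2 * n + 1. fejer_weight n j * cos (of_int l * fejer_node (2 * n + 1) j)) = fejer_moment l"
proof -
  define M where "M = 2 * n + 1"
  define C where "C i = (\<Sum>j<M. cos (of_int i * fejer_node M j))" for i :: int
  \<comment> \<open>\<open>4 n\<close> is below \<open>2 M = 4 n + 2\<close>, so none of the
    frequencies that occur is aliased.\<close>
  have C: "C i = (if i = 0 then real M else 0)" if "\<bar>i\<bar> \<le> 4 * int n" for i
    unfolding C_def by (rule sum_cos_fejer_node) (use that in \<open>auto simp: M_def\<close>)
  have M: "0 < real M" by (simp add: M_def)
  have prod: "2 * (cos (2 * real k * x) * cos (of_int l * x)) = cos (of_int (2 * int k + l) * x) + cos (of_int (2 * int k - l) * x)" for k x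
    using cos_add[of "2 * real k * x" "of_int l * x"] cos_diff[of "2 * real k * x" "of_int l * x"]
    by (simp add: algebra_simps)
  define D where "D j k = (cos (of_int (2 * int k + l) * fejer_node M j) + cos (of_int (2 * int k - l) * fejer_node M j)) / (4 * (real k)\<^sup>2 - 1)" for j k
  have w: "fejer_weight n j * cos (of_int l * fejer_node M j) = (cos (of_int l * fejer_node M j) - (\<Sum>k=1..n. D j k)) / real M" for j
  proof -
    have "2 * (\<Sum>k=1..n. cos (2 * real k * fejer_node M j) / (4 * (real k)\<^sup>2 - 1)) * cos (of_int l * fejer_node M j) = (\<Sum>k=1..n. D j k)"
      unfolding sum_distrib_left sum_distrib_right D_def prod[symmetric] by (rule sum.cong) simp_all
    then show ?thesis
      unfolding fejer_weight_def M_def[symmetric] by (simp add: left_diff_distrib)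
  qed
  have "(\<Sum>j<M. fejer_weight n j * cos (of_int l * fejer_node M j)) = (C l - (\<Sum>j<M. \<Sum>k=1..n. D j k)) / real M"
    unfolding w C_def sum_subtractf[symmetric] sum_divide_distrib[symmetric] ..
  also have "(\<Sum>j<M. \<Sum>k=1..n. D j k) = (\<Sum>k=1..n. \<Sum>j<M. D j k)"
    by (rule sum.swap)
  also have "\<dots> = (\<Sum>k=1..n. (C (2 * int k + l) + C (2 * int k - l)) / (4 * (real k)\<^sup>2 - 1))"
    unfolding D_def C_def sum_divide_distrib[symmetric] sum.distrib ..
  also have "\<dots> = (\<Sum>k=1..n. if 2 * int k = \<bar>l\<bar> then real M / ((of_int l)\<^sup>2 - 1) else 0)"
  proof (rule sum.cong[OF refl])
    fix k assume k: "k \<in> {1..n}"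
    have "C (2 * int k + l) + C (2 * int k - l) = (if 2 * int k = \<bar>l\<bar> then real M else 0)"
      using k l by (subst (1 2) C) auto
    moreover have "4 * (real k)\<^sup>2 = (of_int l)\<^sup>2" if "2 * int k = \<bar>l\<bar>"
    proof -
      have "2 * real k = \<bar>of_int l\<bar>" using that by linarith
      then have "(2 * real k)\<^sup>2 = (of_int l)\<^sup>2" by simp
      then show ?thesis by (simp add: power_mult_distrib)
    qed
    ultimately show "(C (2 * int k + l) + C (2 * int k - l)) / (4 * (real k)\<^sup>2 - 1)
        = (if 2 * int k = \<bar>l\<bar> then real M / ((of_int l)\<^sup>2 - 1) else 0)" by auto
  qed
  also have "(C l - \<dots>) / real M = fejer_moment l"
  proof (cases "l = 0")
    case True
    then have "(\<Sum>k=1..n. if 2 * int k = \<bar>l\<bar> then real M / ((of_int l)\<^sup>2 - 1) else 0) = 0"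
      by (intro sum.neutral) auto
    then show ?thesis using True M C[of 0] by (simp add: fejer_moment_def)
  next
    case False
    then have Cl: "C l = 0" using C[of l] l by simp
    show ?thesis
    proof (cases "even l")
      case True
      then obtain m where m: "l = 2 * m" by (elim evenE)
      define K where "K = nat \<bar>m\<bar>"
      have "(2 * int k = \<bar>l\<bar>) = (k = K)" for k by (auto simp: m K_def abs_mult)
      moreover have "K \<in> {1..n}" using m l False by (auto simp: K_def abs_mult)
      ultimately have "(\<Sum>k=1..n. if 2 * int k = \<bar>l\<bar> then real M / ((of_int l)\<^sup>2 - 1) else 0) = real M / ((of_int l)\<^sup>2 - 1)"
        by simp
      then have "(C l - (\<Sum>k=1..n. if 2 * int k = \<bar>l\<bar> then real M / ((of_int l)\<^sup>2 - 1) else 0)) / real M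
        = - (1 / ((of_int l)\<^sup>2 - 1))" using Cl M by simp
      also have "\<dots> = 1 / (1 - (of_int l)\<^sup>2)"
        by (metis minus_diff_eq minus_divide_right)
      finally show ?thesis using True by (simp add: fejer_moment_def)
    next
      case False
      then have "2 * int k \<noteq> \<bar>l\<bar>" for k by presburger
      then show ?thesis using Cl False by (simp add: fejer_moment_def)
    qed
  qed
  finally show ?thesis unfolding M_def .
qed

lemma integral_cos_sin:
  fixes l :: int
  shows "((\<lambda>x. cos (of_int l * x) * sin x) has_integral 2 * fejer_moment l) {0..pi}"
\<comment> \<open>The general antiderivative has the denominators \<open>l + 1\<close> and
  \<open>l - 1\<close>.\<close>
proof (cases "\<bar>l\<bar> = 1")
  case True
  then have "cos (of_int l * x) = cos x" for x :: real by (cases "l = 1") (auto simp: abs_if split: if_splits)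
  moreover have "((\<lambda>x. cos x * sin x) has_integral ((sin pi)\<^sup>2 / 2 - (sin 0)\<^sup>2 / 2)) {0..pi}"
    by (rule fundamental_theorem_of_calculus)
       (auto intro!: derivative_eq_intros simp: has_real_derivative_iff_has_vector_derivative[symmetric])
  moreover have "odd l" using True by presburger
  ultimately show ?thesis by (simp add: fejer_moment_def)
next
  case False
  define a b where "a = real_of_int l + 1" and "b = real_of_int l - 1"
  have ab: "a \<noteq> 0" "b \<noteq> 0" using False by (auto simp: a_def b_def)
  define F where "F x = cos (b * x) / (2 * b) - cos (a * x) / (2 * a)" for x
  have "((\<lambda>x. cos (of_int l * x) * sin x) has_integral (F pi - F 0)) {0..pi}"
  proof (rule fundamental_theorem_of_calculus)
    fix x :: real
    have "(F has_real_derivative (sin (a * x) / 2 - sin (b * x) / 2)) (at x within {0..pi})"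
      unfolding F_def using ab by (auto intro!: derivative_eq_intros)
    also have "sin (a * x) / 2 - sin (b * x) / 2 = cos (of_int l * x) * sin x"
      using sin_add[of "of_int l * x" x] sin_diff[of "of_int l * x" x] by (simp add: a_def b_def algebra_simps)
    finally show "(F has_vector_derivative cos (of_int l * x) * sin x) (at x within {0..pi})"
      by (simp add: has_real_derivative_iff_has_vector_derivative)
  qed simp
  moreover have "F pi - F 0 = 2 * fejer_moment l"
  proof -
    have c: "cos (a * pi) = (if even l then -1 else 1)" "cos (b * pi) = (if even l then -1 else 1)"
      using cos_npi_int[of "l + 1"] cos_npi_int[of "l - 1"] by (simp_all add: a_def b_def mult.commute)
    have "a * b = (of_int l)\<^sup>2 - 1" by (simp add: a_def b_def power2_eq_square algebra_simps)
    moreover have "1 / a - 1 / b = - 2 / (a * b)" using ab by (simp add: field_simps a_def b_def)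
    ultimately have "1 / a - 1 / b = 2 / (1 - (of_int l)\<^sup>2)"
      by (metis minus_diff_eq minus_divide_divide minus_minus)
    then show ?thesis unfolding F_def c fejer_moment_def by simp
  qed
  ultimately show ?thesis by simp
qed

text \<open>The additional factor \<open>cos (l x)\<close> makes an induction on \<open>k\<close>
  possible: one factor \<open>cos x\<close> is traded for the average of the shifts
  \<open>l + 1\<close> and \<open>l - 1\<close>, and \<open>k + \<bar>l\<bar>\<close> does not
  grow.\<close>

lemma fejer_weight_cos_power:
  fixes l :: int
  assumes "int k + \<bar>l\<bar> \<le> 2 * int n"
  shows "((\<lambda>x. cos x ^ k * cos (of_int l * x) * sin x) has_integral
    2 * (\<Sum>j<2 * n + 1. fejer_weight n j * (cos (fejer_node (2 * n + 1) j) ^ k * cos (of_int l * fejer_node (2 * n + 1) j)))) {0..pi}"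
  using assms
proof (induction k arbitrary: l)
  case 0
  then show ?case using integral_cos_sin[of l] fejer_weight_cos[of l n] by simp
next
  case (Suc k)
  let ?S = "\<lambda>i. (\<Sum>j<2 * n + 1. fejer_weight n j * (cos (fejer_node (2 * n + 1) j) ^ k * cos (of_int i * fejer_node (2 * n + 1) j)))"
  have eq: "cos x ^ Suc k * cos (of_int l * x) = (cos x ^ k * cos (of_int (l + 1) * x) + cos x ^ k * cos (of_int (l - 1) * x)) / 2" for x :: real
  proof -
    have "cos (of_int (l + 1) * x) + cos (of_int (l - 1) * x) = 2 * (cos x * cos (of_int l * x))"
      using cos_add[of "of_int l * x" x] cos_diff[of "of_int l * x" x] by (simp add: algebra_simps)
    then show ?thesis by (simp only: distrib_left[symmetric]) simp
  qed
  have "((\<lambda>x. (cos x ^ k * cos (of_int (l + 1) * x) * sin x + cos x ^ k * cos (of_int (l - 1) * x) * sin x) / 2) has_integral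
      (2 * ?S (l + 1) + 2 * ?S (l - 1)) / 2) {0..pi}"
    by (intro has_integral_divide has_integral_add Suc.IH) (use Suc.prems in auto)
  moreover have "(2 * ?S (l + 1) + 2 * ?S (l - 1)) / 2
    = 2 * (\<Sum>j<2 * n + 1. fejer_weight n j * (cos (fejer_node (2 * n + 1) j) ^ Suc k * cos (of_int l * fejer_node (2 * n + 1) j)))"
  proof -
    have "2 * (\<Sum>j<2 * n + 1. fejer_weight n j * (cos (fejer_node (2 * n + 1) j) ^ Suc k * cos (of_int l * fejer_node (2 * n + 1) j)))
      = ?S (l + 1) + ?S (l - 1)"
      unfolding eq sum_distrib_left sum.distrib[symmetric] by (rule sum.cong) (simp_all add: distrib_left)
    then show ?thesis by simp
  qed
  moreover have "(\<lambda>x :: real. (cos x ^ k * cos (of_int (l + 1) * x) * sin x + cos x ^ k * cos (of_int (l - 1) * x) * sin x) / 2)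
      = (\<lambda>x. cos x ^ Suc k * cos (of_int l * x) * sin x)"
    unfolding eq by (simp add: distrib_right)
  ultimately show ?case by (simp only:)
qed

text \<open>Under \<open>z = cos x\<close> the integral of \<open>z ^ k\<close> becomes that of
  \<open>cos x ^ k * sin x\<close>, which is the case \<open>l = 0\<close> of
  \<open>fejer_weight_cos_power\<close>.\<close>

theorem fejer_quadrature:
  fixes p :: "real poly"
  assumes "degree p \<le> 2 * n"
  shows "(\<Sum>j<2 * n + 1. fejer_weight n j * poly p (cos (fejer_node (2 * n + 1) j))) = integral {-1..1} (poly p) / 2"
proof -
  have mono: "(\<Sum>j<2 * n + 1. fejer_weight n j * cos (fejer_node (2 * n + 1) j) ^ k) = integral {-1..1} (\<lambda>z. z ^ k) / 2"
    if k: "k \<le> 2 * n" for k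
  proof -
    have "((\<lambda>x. cos x ^ k * sin x) has_integral (- (cos pi ^ Suc k / real (Suc k)) - - (cos 0 ^ Suc k / real (Suc k)))) {0..pi}"
    proof (rule fundamental_theorem_of_calculus)
      have "((\<lambda>x. - (cos x ^ Suc k / real (Suc k))) has_real_derivative cos x ^ k * sin x) (at x within {0..pi})" for x
        by (rule derivative_eq_intros refl | simp del: power_Suc of_nat_Suc)+
      then show "((\<lambda>x. - (cos x ^ Suc k / real (Suc k))) has_vector_derivative cos x ^ k * sin x) (at x within {0..pi})" for x
        by (simp only: has_real_derivative_iff_has_vector_derivative)
    qed simp
    note i1 = this
    have i3: "((\<lambda>x. cos x ^ k * sin x) has_integral
        2 * (\<Sum>j<2 * n + 1. fejer_weight n j * cos (fejer_node (2 * n + 1) j) ^ k)) {0..pi}"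
      using fejer_weight_cos_power[of k 0 n] k by simp
    show ?thesis
      using has_integral_unique[OF i1 i3] integral_power_symmetric[of k] by simp
  qed
  have "(\<Sum>j<2 * n + 1. fejer_weight n j * poly p (cos (fejer_node (2 * n + 1) j)))
      = (\<Sum>i\<le>degree p. coeff p i * (\<Sum>j<2 * n + 1. fejer_weight n j * cos (fejer_node (2 * n + 1) j) ^ i))"
    unfolding poly_altdef sum_distrib_left by (subst sum.swap) (simp add: mult_ac)
  also have "\<dots> = (\<Sum>i\<le>degree p. coeff p i * (integral {-1..1} (\<lambda>z. z ^ i) / 2))"
    using assms by (intro sum.cong refl arg_cong2[where f = "(*)"] mono) auto
  also have "\<dots> = integral {-1..1} (poly p) / 2"
    unfolding poly_altdef[of p, abs_def]
    by (subst integral_sum) (auto intro!: integrable_continuous_real continuous_intros simp: sum_divide_distrib)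
  finally show ?thesis .
qed

section \<open>Bounds for the variation\<close>

abbreviation variation_integral :: "real poly \<Rightarrow> real" where
  "variation_integral p \<equiv> integral {0..1} (\<lambda>x. \<bar>poly (pderiv p) x\<bar>)"

abbreviation weighted_variation_integral :: "real poly \<Rightarrow> real" where
  "weighted_variation_integral p \<equiv> integral {0..1} (\<lambda>x. sqrt (x * (1 - x)) * \<bar>poly (pderiv p) x\<bar>)"

text \<open>Total variation at most \<open>v\<close>, expressed by a majorant \<open>V\<close> of
  the increments instead of a supremum over partitions. Concatenation, monotone reparametrization
  and nonnegative combinations can then be carried out on \<open>V\<close> itself.\<close>

definition variation_le :: "(real \<Rightarrow> real) \<Rightarrow> real \<Rightarrow> real \<Rightarrow> real \<Rightarrow> bool" where
  "variation_le f a b v \<longleftrightarrow>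
     (\<exists>V. (\<forall>x y. a \<le> x \<longrightarrow> x \<le> y \<longrightarrow> y \<le> b \<longrightarrow> \<bar>f y - f x\<bar> \<le> V y - V x) \<and> V b - V a \<le> v)"

lemma variation_leI:
  assumes "\<And>x y. a \<le> x \<Longrightarrow> x \<le> y \<Longrightarrow> y \<le> b \<Longrightarrow> \<bar>f y - f x\<bar> \<le> V y - V x" "V b - V a \<le> v"
  shows "variation_le f a b v"
  using assms unfolding variation_le_def by blast

lemma variation_leE:
  assumes "variation_le f a b v"
  obtains V where "\<And>x y. a \<le> x \<Longrightarrow> x \<le> y \<Longrightarrow> y \<le> b \<Longrightarrow> \<bar>f y - f x\<bar> \<le> V y - V x" "V b - V a \<le> v"
  using assms unfolding variation_le_def by blast

lemma variation_le_mono: "variation_le f a b v \<Longrightarrow> v \<le> w \<Longrightarrow> variation_le f a b w"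
  unfolding variation_le_def by force

lemma variation_le_cong:
  assumes "variation_le f a b v" "\<And>x. a \<le> x \<Longrightarrow> x \<le> b \<Longrightarrow> f x = g x"
  shows "variation_le g a b v"
proof -
  obtain V where V: "\<And>x y. a \<le> x \<Longrightarrow> x \<le> y \<Longrightarrow> y \<le> b \<Longrightarrow> \<bar>f y - f x\<bar> \<le> V y - V x" "V b - V a \<le> v"
    using variation_leE[OF assms(1)] by blast
  show ?thesis
  proof (rule variation_leI[of _ _ _ V])
    fix x y assume "a \<le> x" "x \<le> y" "y \<le> b"
    then show "\<bar>g y - g x\<bar> \<le> V y - V x"
      using V(1)[of x y] assms(2)[of x] assms(2)[of y] by simp
  qed (rule V(2))
qed

lemma variation_le_concat:
  assumes "variation_le f a b v" "variation_le f b c w" and ab: "a \<le> b" "b \<le> c"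
  shows "variation_le f a c (v + w)"
proof -
  obtain V where V: "\<And>x y. a \<le> x \<Longrightarrow> x \<le> y \<Longrightarrow> y \<le> b \<Longrightarrow> \<bar>f y - f x\<bar> \<le> V y - V x" "V b - V a \<le> v"
    using variation_leE[OF assms(1)] by blast
  obtain W where W: "\<And>x y. b \<le> x \<Longrightarrow> x \<le> y \<Longrightarrow> y \<le> c \<Longrightarrow> \<bar>f y - f x\<bar> \<le> W y - W x" "W c - W b \<le> w"
    using variation_leE[OF assms(2)] by blast
  define U where "U x = (if x \<le> b then V x else V b + W x - W b)" for x
  show ?thesis
  proof (rule variation_leI[of _ _ _ U])
    fix x y assume xy: "a \<le> x" "x \<le> y" "y \<le> c"
    show "\<bar>f y - f x\<bar> \<le> U y - U x"
      using V(1)[of x y] W(1)[of x y] V(1)[of x b] W(1)[of b y] xy by (auto simp: U_def)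
  next
    show "U c - U a \<le> v + w"
      using V(2) W(2) ab by (cases "c = b") (auto simp: U_def)
  qed
qed

lemma variation_le_pieces:
  assumes "\<And>i :: nat. i < m \<Longrightarrow> variation_le f (real i) (real (Suc i)) (v i)"
  shows "variation_le f 0 (real m) (\<Sum>i<m. v i)"
  using assms
proof (induction m)
  case 0
  show ?case
  proof (rule variation_leI[of _ _ _ "\<lambda>_. 0"])
    fix x y :: real assume "0 \<le> x" "x \<le> y" "y \<le> real 0"
    then have "x = y" by simp
    then show "\<bar>f y - f x\<bar> \<le> 0 - 0" by simp
  qed simp
next
  case (Suc m)
  have "variation_le f 0 (real (Suc m)) ((\<Sum>i<m. v i) + v m)"
    by (rule variation_le_concat[of _ _ "real m"]) (use Suc in auto)
  then show ?case by simp
qed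

lemma variation_le_comp_mono:
  assumes "variation_le f c d v" and "a \<le> b"
    and \<phi>: "\<And>x y. a \<le> x \<Longrightarrow> x \<le> y \<Longrightarrow> y \<le> b \<Longrightarrow> \<phi> x \<le> \<phi> y" and "c \<le> \<phi> a" "\<phi> b \<le> d"
  shows "variation_le (\<lambda>x. f (\<phi> x)) a b v"
proof -
  obtain V where V: "\<And>x y. c \<le> x \<Longrightarrow> x \<le> y \<Longrightarrow> y \<le> d \<Longrightarrow> \<bar>f y - f x\<bar> \<le> V y - V x" "V d - V c \<le> v"
    using variation_leE[OF assms(1)] by blast
  show ?thesis
  proof (rule variation_leI[of _ _ _ "\<lambda>x. V (\<phi> x)"])
    fix x y assume "a \<le> x" "x \<le> y" "y \<le> b"
    then show "\<bar>f (\<phi> y) - f (\<phi> x)\<bar> \<le> V (\<phi> y) - V (\<phi> x)"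
      using V(1)[of "\<phi> x" "\<phi> y"] \<phi>[of a x] \<phi>[of x y] \<phi>[of y b] assms(4,5) by auto
  next
    have "\<phi> a \<le> \<phi> b" using \<phi>[of a b] \<open>a \<le> b\<close> by simp
    then have "0 \<le> V (\<phi> a) - V c" "0 \<le> V d - V (\<phi> b)"
      using order_trans[OF abs_ge_zero V(1)[of c "\<phi> a"]] order_trans[OF abs_ge_zero V(1)[of "\<phi> b" d]] assms(4,5)
      by simp_all
    then show "V (\<phi> b) - V (\<phi> a) \<le> v" using V(2) by simp
  qed
qed

lemma variation_le_reflect:
  assumes "variation_le f (- b) (- a) v"
  shows "variation_le (\<lambda>x. f (- x)) a b v"
proof -
  obtain V where V: "\<And>x y. - b \<le> x \<Longrightarrow> x \<le> y \<Longrightarrow> y \<le> - a \<Longrightarrow> \<bar>f y - f x\<bar> \<le> V y - V x" "V (- a) - V (- b) \<le> v"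
    using variation_leE[OF assms(1)] by blast
  show ?thesis
  proof (rule variation_leI[of _ _ _ "\<lambda>x. - V (- x)"])
    fix x y assume "a \<le> x" "x \<le> y" "y \<le> b"
    then show "\<bar>f (- y) - f (- x)\<bar> \<le> - V (- y) - - V (- x)"
      using V(1)[of "- y" "- x"] by (auto simp: abs_minus_commute)
  qed (use V in simp)
qed

lemma variation_le_comp_antimono:
  assumes "variation_le f c d v" and "a \<le> b"
    and \<phi>: "\<And>x y. a \<le> x \<Longrightarrow> x \<le> y \<Longrightarrow> y \<le> b \<Longrightarrow> \<phi> y \<le> \<phi> x" and "c \<le> \<phi> b" "\<phi> a \<le> d"
  shows "variation_le (\<lambda>x. f (\<phi> x)) a b v"
proof -
  have "variation_le (\<lambda>x. f (- x)) (- d) (- c) v"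
    by (rule variation_le_reflect) (use assms(1) in simp)
  then have "variation_le (\<lambda>x. (\<lambda>x. f (- x)) (- \<phi> x)) a b v"
    by (rule variation_le_comp_mono) (use assms in auto)
  then show ?thesis by simp
qed

lemma variation_le_minus:
  assumes "variation_le f a b v"
  shows "variation_le (\<lambda>x. c - f x) a b v"
proof -
  obtain V where V: "\<And>x y. a \<le> x \<Longrightarrow> x \<le> y \<Longrightarrow> y \<le> b \<Longrightarrow> \<bar>f y - f x\<bar> \<le> V y - V x" "V b - V a \<le> v"
    using variation_leE[OF assms(1)] by blast
  show ?thesis
    by (rule variation_leI[of _ _ _ V]) (use V in \<open>auto simp: abs_minus_commute\<close>)
qed

lemma variation_le_sum:
  assumes "finite A" "\<And>i. i \<in> A \<Longrightarrow> 0 \<le> c i" "\<And>i. i \<in> A \<Longrightarrow> variation_le (f i) a b (v i)"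
  shows "variation_le (\<lambda>x. \<Sum>i\<in>A. c i * f i x) a b (\<Sum>i\<in>A. c i * v i)"
proof -
  obtain V where V: "\<And>i x y. i \<in> A \<Longrightarrow> a \<le> x \<Longrightarrow> x \<le> y \<Longrightarrow> y \<le> b \<Longrightarrow> \<bar>f i y - f i x\<bar> \<le> V i y - V i x"
    "\<And>i. i \<in> A \<Longrightarrow> V i b - V i a \<le> v i"
    using assms(3) unfolding variation_le_def by metis
  show ?thesis
  proof (rule variation_leI[of _ _ _ "\<lambda>x. \<Sum>i\<in>A. c i * V i x"])
    fix x y assume "a \<le> x" "x \<le> y" "y \<le> b"
    have "\<bar>(\<Sum>i\<in>A. c i * f i y) - (\<Sum>i\<in>A. c i * f i x)\<bar> \<le> (\<Sum>i\<in>A. \<bar>c i * (f i y - f i x)\<bar>)"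
      unfolding sum_subtractf[symmetric] right_diff_distrib[symmetric] by (rule sum_abs)
    also have "\<dots> \<le> (\<Sum>i\<in>A. c i * (V i y - V i x))"
      using V(1) assms(2) \<open>a \<le> x\<close> \<open>x \<le> y\<close> \<open>y \<le> b\<close> by (intro sum_mono) (auto simp: abs_mult mult_left_mono)
    finally show "\<bar>(\<Sum>i\<in>A. c i * f i y) - (\<Sum>i\<in>A. c i * f i x)\<bar> \<le> (\<Sum>i\<in>A. c i * V i y) - (\<Sum>i\<in>A. c i * V i x)"
      by (simp only: sum_subtractf right_diff_distrib)
  next
    have "(\<Sum>i\<in>A. c i * (V i b - V i a)) \<le> (\<Sum>i\<in>A. c i * v i)"
      using V(2) assms(2) by (intro sum_mono mult_left_mono) auto
    then show "(\<Sum>i\<in>A. c i * V i b) - (\<Sum>i\<in>A. c i * V i a) \<le> (\<Sum>i\<in>A. c i * v i)"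
      by (simp only: sum_subtractf right_diff_distrib)
  qed
qed

section \<open>Variation of a zonal profile along circles and meridians\<close>

context
  fixes k G :: "real \<Rightarrow> real"
  assumes kG: "\<And>x y. 0 \<le> x \<Longrightarrow> x \<le> y \<Longrightarrow> y \<le> 1 \<Longrightarrow> \<bar>k y - k x\<bar> \<le> G y - G x"
begin

lemma variation_le_mono_arg:
  assumes "a \<le> b" "\<And>x y. a \<le> x \<Longrightarrow> x \<le> y \<Longrightarrow> y \<le> b \<Longrightarrow> u x \<le> u y" "0 \<le> u a" "u b \<le> 1"
  shows "variation_le (\<lambda>x. k (u x)) a b (G (u b) - G (u a))"
proof -
  have "variation_le k (u a) (u b) (G (u b) - G (u a))"
    by (rule variation_leI[of _ _ _ G]) (use kG assms in auto)
  then show ?thesis by (rule variation_le_comp_mono) (use assms in auto)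
qed

lemma variation_le_antimono_arg:
  assumes "a \<le> b" "\<And>x y. a \<le> x \<Longrightarrow> x \<le> y \<Longrightarrow> y \<le> b \<Longrightarrow> u y \<le> u x" "0 \<le> u b" "u a \<le> 1"
  shows "variation_le (\<lambda>x. k (u x)) a b (G (u a) - G (u b))"
proof -
  have "variation_le k (u b) (u a) (G (u a) - G (u b))"
    by (rule variation_leI[of _ _ _ G]) (use kG assms in auto)
  then show ?thesis by (rule variation_le_comp_antimono) (use assms in auto)
qed

lemma G_mono: "0 \<le> x \<Longrightarrow> x \<le> y \<Longrightarrow> y \<le> 1 \<Longrightarrow> G x \<le> G y"
  using kG[of x y] by auto

text \<open>The argument of \<open>k\<close> falls until \<open>\<phi>'\<close>, rises until
  \<open>\<phi>' + pi\<close> and falls again. After a full turn it is back at its initial value, so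
  the three pieces add up to twice the increment of \<open>G\<close> over
  \<open>[A - B, A + B]\<close>. The bound \<open>\<phi>' \<le> pi\<close> keeps the rising piece
  within the turn.\<close>

lemma variation_le_circle_aux:
  assumes B: "0 \<le> B" "0 \<le> A - B" "A + B \<le> 1" and \<phi>': "0 \<le> \<phi>'" "\<phi>' \<le> pi"
  shows "variation_le (\<lambda>\<phi>. k (A - B * cos (\<phi> - \<phi>'))) 0 (2 * pi) (2 * (G (A + B) - G (A - B)))"
proof -
  define u where "u \<phi> = A - B * cos (\<phi> - \<phi>')" for \<phi>
  have bd: "0 \<le> u \<phi>" "u \<phi> \<le> 1" for \<phi>
  proof -
    have "\<bar>B * cos (\<phi> - \<phi>')\<bar> \<le> B * 1"
      unfolding abs_mult using B by (intro mult_mono) auto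
    then show "0 \<le> u \<phi>" "u \<phi> \<le> 1" using B by (auto simp: u_def)
  qed
  have inc: "u x \<le> u y" if "\<phi>' \<le> x" "x \<le> y" "y \<le> \<phi>' + pi" for x y
    using cos_monotone_0_pi_le[of "x - \<phi>'" "y - \<phi>'"] that B by (simp add: u_def mult_left_mono)
  \<comment> \<open>The instances \<open>i = 0\<close> and \<open>i = 1\<close> are the two falling
    pieces.\<close>
  have dec: "u y \<le> u x" if "\<phi>' + 2 * pi * of_int i - pi \<le> x" "x \<le> y" "y \<le> \<phi>' + 2 * pi * of_int i" for x y and i :: int
  proof -
    have "cos (x - \<phi>' - 2 * pi * of_int i) \<le> cos (y - \<phi>' - 2 * pi * of_int i)"
      by (rule cos_monotone_minus_pi_0') (use that in auto)
    then have "cos (x - \<phi>') \<le> cos (y - \<phi>')"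
      by (simp add: cos_diff[of _ "2 * pi * of_int i"])
    then show ?thesis using B by (simp add: u_def mult_left_mono)
  qed
  have ends: "u (2 * pi) = u 0" "u \<phi>' = A - B" "u (\<phi>' + pi) = A + B"
    by (simp_all add: u_def cos_diff)
  have "variation_le (\<lambda>\<phi>. k (u \<phi>)) 0 (2 * pi) ((G (u 0) - G (u \<phi>')) + ((G (u (\<phi>' + pi)) - G (u \<phi>')) + (G (u (\<phi>' + pi)) - G (u (2 * pi)))))"
  proof (intro variation_le_concat)
    show "variation_le (\<lambda>\<phi>. k (u \<phi>)) 0 \<phi>' (G (u 0) - G (u \<phi>'))"
      by (rule variation_le_antimono_arg) (use dec[of 0] \<phi>' bd in auto)
    show "variation_le (\<lambda>\<phi>. k (u \<phi>)) \<phi>' (\<phi>' + pi) (G (u (\<phi>' + pi)) - G (u \<phi>'))"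
      by (rule variation_le_mono_arg) (use inc \<phi>' bd in auto)
    show "variation_le (\<lambda>\<phi>. k (u \<phi>)) (\<phi>' + pi) (2 * pi) (G (u (\<phi>' + pi)) - G (u (2 * pi)))"
      by (rule variation_le_antimono_arg) (use dec[of 1] \<phi>' bd in auto)
  qed (use \<phi>' in auto)
  then show ?thesis unfolding u_def[symmetric] ends by (simp add: ends)
qed

lemma variation_le_circle:
  assumes B: "0 \<le> B" "0 \<le> A - B" "A + B \<le> 1" and \<phi>': "0 \<le> \<phi>'" "\<phi>' \<le> 2 * pi"
  shows "variation_le (\<lambda>\<phi>. k (A - B * cos (\<phi> - \<phi>'))) 0 (2 * pi) (2 * (G (A + B) - G (A - B)))"
proof (cases "\<phi>' \<le> pi")
  case True
  then show ?thesis using variation_le_circle_aux[OF B] \<phi>' by blast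
next
  case False
  \<comment> \<open>Reflecting the circle replaces \<open>\<phi>'\<close> by
    \<open>2 * pi - \<phi>'\<close>, which is below \<open>pi\<close>.\<close>
  have "variation_le (\<lambda>\<phi>. k (A - B * cos (2 * pi - \<phi> - (2 * pi - \<phi>')))) 0 (2 * pi) (2 * (G (A + B) - G (A - B)))"
    by (rule variation_le_comp_antimono[OF variation_le_circle_aux[OF B]]) (use False \<phi>' in auto)
  moreover have "cos (2 * pi - \<phi> - (2 * pi - \<phi>')) = cos (\<phi> - \<phi>')" for \<phi>
    using cos_minus[of "\<phi> - \<phi>'"] by simp
  ultimately show ?thesis by simp
qed

text \<open>Along a great circle the inner product is a single cosine
  \<open>r * cos (\<theta> - a)\<close>, so the circle estimate applies with \<open>A = 1/2\<close>
  and \<open>B = r/2\<close>. The factor 2 is kept on the half turn, where a value can already occur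
  twice.\<close>

lemma variation_le_meridian:
  assumes bd: "\<And>\<theta>. \<bar>A * cos \<theta> + B * sin \<theta>\<bar> \<le> 1"
  shows "variation_le (\<lambda>\<theta>. k ((1 - (A * cos \<theta> + B * sin \<theta>)) / 2)) 0 pi (2 * (G 1 - G 0))"
proof -
  define r a where "r = cmod (Complex A B)" and "a = Arg2pi (Complex A B)"
  have a: "0 \<le> a" "a < 2 * pi" "Complex A B = of_real r * exp (\<i> * of_real a)"
    using Arg2pi[of "Complex A B"] by (auto simp: r_def a_def is_Arg_def)
  then have "A = r * cos a" "B = r * sin a"
    by (auto simp: complex_eq_iff Re_exp Im_exp)
  then have eq: "A * cos \<theta> + B * sin \<theta> = r * cos (\<theta> - a)" for \<theta>
    by (simp add: cos_diff algebra_simps)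
  have r: "0 \<le> r" "r \<le> 1" using bd[of a] unfolding eq by (auto simp: r_def)
  have "variation_le (\<lambda>\<theta>. k (1/2 - r/2 * cos (\<theta> - a))) 0 pi (2 * (G (1/2 + r/2) - G (1/2 - r/2)))"
    by (rule variation_le_comp_mono[OF variation_le_circle]) (use r a in auto)
  moreover have "2 * (G (1/2 + r/2) - G (1/2 - r/2)) \<le> 2 * (G 1 - G 0)"
    using G_mono[of "1/2 + r/2" 1] G_mono[of 0 "1/2 - r/2"] r by auto
  moreover have "(1 - (A * cos \<theta> + B * sin \<theta>)) / 2 = 1/2 - r/2 * cos (\<theta> - a)" for \<theta>
    by (simp add: eq diff_divide_distrib)
  ultimately show ?thesis by (simp only:) (rule variation_le_mono)
qed

end

section \<open>Number of parallels met by a circle around a point\<close>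

lemma card_nat_spread:
  fixes J :: "nat set"
  assumes "finite J" "\<And>i j. i \<in> J \<Longrightarrow> j \<in> J \<Longrightarrow> real j - real i \<le> d" "0 \<le> d"
  shows "real (card J) \<le> 1 + d"
proof (cases "J = {}")
  case False
  have "J \<subseteq> {Min J..Max J}" using assms(1) by auto
  then have "card J \<le> Suc (Max J) - Min J" using card_mono[of "{Min J..Max J}" J] by simp
  moreover have "real (Max J) - real (Min J) \<le> d" using assms False by auto
  moreover have "Min J \<le> Max J" using assms(1) False by simp
  ultimately show ?thesis by linarith
qed (use assms in simp)

text \<open>By concavity the sine lies above its chord over \<open>[0, pi / 2]\<close>.\<close>

lemma jordan_inequality:
  fixes x :: real
  assumes "0 \<le> x" "x \<le> pi / 2"
  shows "2 * x / pi \<le> sin x"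
proof -
  have "convex_on {0..pi/2} (\<lambda>x. - sin x)"
  proof (rule f''_ge0_imp_convex)
    show "((\<lambda>x. - sin x) has_real_derivative - cos x) (at x)" for x :: real
      by (auto intro!: derivative_eq_intros)
    show "((\<lambda>x. - cos x) has_real_derivative sin x) (at x)" for x :: real
      by (auto intro!: derivative_eq_intros)
    show "0 \<le> sin x" if "x \<in> {0..pi/2}" for x :: real
      using that by (intro sin_ge_zero) auto
  qed simp
  from convex_onD[OF this, of "2 * x / pi" 0 "pi / 2"] show ?thesis
    using assms by (simp add: field_simps)
qed

text \<open>With \<open>x = (1 - cos \<psi>) / 2\<close>, the parallels counted are those that meet
  the circle of angular radius \<psi> around a point of colatitude \<open>\<theta>'\<close>. Their
  colatitudes spread over at most \<open>2 * min \<psi> (pi - \<psi>)\<close>, while the nodes are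
  \<open>pi / M\<close> apart.\<close>

lemma count_nodes:
  assumes M: "0 < M" and \<theta>': "0 \<le> \<theta>'" "\<theta>' \<le> pi" and x: "0 \<le> x" "x \<le> 1"
  defines "\<theta> \<equiv> fejer_node M"
  shows "real (card {j. j < M \<and> (1 - cos (\<theta> j - \<theta>')) / 2 \<le> x \<and> x \<le> (1 - cos (\<theta> j + \<theta>')) / 2})
    \<le> 1 + 2 * real M * sqrt (x * (1 - x))"
proof -
  define \<psi> where "\<psi> = arccos (1 - 2 * x)"
  have \<psi>: "0 \<le> \<psi>" "\<psi> \<le> pi" "cos \<psi> = 1 - 2 * x"
    using x by (auto simp: \<psi>_def arccos_lbound arccos_ubound)
  have s: "sin \<psi> = 2 * sqrt (x * (1 - x))"
  proof -
    have "(sin \<psi>)\<^sup>2 = 2\<^sup>2 * (x * (1 - x))"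
      using sin_cos_squared_add[of \<psi>] \<psi>(3) by (simp add: power2_eq_square algebra_simps)
    moreover have "0 \<le> sin \<psi>" using \<psi> by (intro sin_ge_zero) auto
    ultimately have "sin \<psi> = sqrt (2\<^sup>2 * (x * (1 - x)))" by (metis real_sqrt_unique)
    then show ?thesis by (simp add: real_sqrt_mult)
  qed
  have \<theta>: "0 \<le> \<theta> j" "\<theta> j \<le> pi" if "j < M" for j
    using fejer_node_bounds[OF that] by (auto simp: \<theta>_def)
  define J where "J = {j. j < M \<and> (1 - cos (\<theta> j - \<theta>')) / 2 \<le> x \<and> x \<le> (1 - cos (\<theta> j + \<theta>')) / 2}"
  have J: "\<bar>\<theta> j - \<theta>'\<bar> \<le> \<psi>" "\<psi> \<le> \<theta> j + \<theta>'" "\<theta> j + \<theta>' \<le> 2 * pi - \<psi>" if "j \<in> J" for j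
  proof -
    have j: "j < M" "cos \<psi> \<le> cos (\<theta> j - \<theta>')" "cos (\<theta> j + \<theta>') \<le> cos \<psi>" using that \<psi>(3) by (auto simp: J_def)
    have "cos \<psi> \<le> cos \<bar>\<theta> j - \<theta>'\<bar>" using j by simp
    then show "\<bar>\<theta> j - \<theta>'\<bar> \<le> \<psi>"
      using \<psi> \<theta>[OF j(1)] \<theta>' by (subst (asm) cos_mono_le_eq) auto
    show "\<psi> \<le> \<theta> j + \<theta>'"
    proof (rule ccontr)
      assume "\<not> ?thesis"
      then have "cos \<psi> < cos (\<theta> j + \<theta>')"
        using \<psi> \<theta>[OF j(1)] \<theta>' by (intro cos_monotone_0_pi) auto
      then show False using j by simp
    qed
    show "\<theta> j + \<theta>' \<le> 2 * pi - \<psi>"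
    proof (rule ccontr)
      assume "\<not> ?thesis"
      then have "cos \<psi> < cos (2 * pi - (\<theta> j + \<theta>'))"
        using \<psi> \<theta>[OF j(1)] \<theta>' by (intro cos_monotone_0_pi) auto
      then show False using j by (simp add: cos_diff)
    qed
  qed
  have "real (card J) \<le> 1 + real M * sin \<psi>"
  proof (rule card_nat_spread)
    show "finite J" by (simp add: J_def)
    show "0 \<le> real M * sin \<psi>" using \<psi> by (intro mult_nonneg_nonneg sin_ge_zero) auto
    fix i j assume ij: "i \<in> J" "j \<in> J"
    \<comment> \<open>This angle lies in \<open>[0, pi / 2]\<close> and has the same sine as \<psi>,
      so Jordan's inequality converts the angular spread into
      \<open>sin \<psi> = 2 * sqrt (x * (1 - x))\<close>.\<close>
    define m where "m = min \<psi> (pi - \<psi>)"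
    have "\<theta> j - \<theta> i \<le> 2 * m" using J[OF ij(1)] J[OF ij(2)] by (auto simp: m_def min_def abs_le_iff)
    moreover have "\<theta> j - \<theta> i = (real j - real i) * pi / real M"
      using M by (simp add: \<theta>_def fejer_node_def field_simps)
    ultimately have "real j - real i \<le> real M * (2 * m / pi)"
      using M by (simp add: field_simps)
    also have "2 * m / pi \<le> sin m"
      by (rule jordan_inequality) (use \<psi> in \<open>auto simp: m_def min_def\<close>)
    also have "sin m = sin \<psi>" by (auto simp: m_def min_def)
    finally show "real j - real i \<le> real M * sin \<psi>" using M by simp
  qed
  then show ?thesis unfolding J_def s by simp
qed

text \<open>Interchanging sum and integral weights \<open>f x\<close> by the number of parallels
  whose range contains \<open>x\<close>. The square root in that count is the source of the weighted
  variation integral.\<close>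

lemma sum_circles_le:
  fixes f :: "real \<Rightarrow> real"
  assumes M: "0 < M" and \<theta>': "0 \<le> \<theta>'" "\<theta>' \<le> pi"
    and f: "continuous_on {0..1} f" "\<And>x. x \<in> {0..1} \<Longrightarrow> 0 \<le> f x"
  defines "\<theta> \<equiv> fejer_node M"
  shows "(\<Sum>j<M. integral {0..(1 - cos (\<theta> j + \<theta>')) / 2} f - integral {0..(1 - cos (\<theta> j - \<theta>')) / 2} f)
    \<le> integral {0..1} f + 2 * real M * integral {0..1} (\<lambda>x. sqrt (x * (1 - x)) * f x)"
proof -
  define a b where "a j = (1 - cos (\<theta> j - \<theta>')) / 2" and "b j = (1 - cos (\<theta> j + \<theta>')) / 2" for j
  have \<theta>: "0 \<le> \<theta> j" "\<theta> j \<le> pi" if "j < M" for j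
    using fejer_node_bounds[OF that] by (auto simp: \<theta>_def)
  have ab: "0 \<le> a j" "a j \<le> b j" "b j \<le> 1" if "j < M" for j
  proof -
    have "0 \<le> sin (\<theta> j) * sin \<theta>'"
      using \<theta>[OF that] \<theta>' by (intro mult_nonneg_nonneg sin_ge_zero) auto
    then show "a j \<le> b j" by (simp add: a_def b_def cos_add cos_diff)
    show "0 \<le> a j" by (simp add: a_def)
    show "b j \<le> 1" by (simp add: b_def)
  qed
  have int: "f integrable_on {x..y}" if "0 \<le> x" "y \<le> 1" for x y
    by (rule integrable_continuous_real, rule continuous_on_subset[OF f(1)]) (use that in auto)
  have ri: "(\<lambda>x. if x \<in> {a j..b j} then f x else 0) integrable_on {0..1}" if "j < M" for j
    by (subst integrable_restrict_Int) (use ab[OF that] int in \<open>auto simp: Int_absorb2\<close>)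
  have "(\<Sum>j<M. integral {0..b j} f - integral {0..a j} f)
      = (\<Sum>j<M. integral {0..1} (\<lambda>x. if x \<in> {a j..b j} then f x else 0))"
  proof (rule sum.cong[OF refl])
    fix j assume "j \<in> {..<M}"
    then have j: "j < M" by simp
    have "integral {0..a j} f + integral {a j..b j} f = integral {0..b j} f"
      by (rule Henstock_Kurzweil_Integration.integral_combine) (use ab[OF j] int in auto)
    moreover have "integral {0..1} (\<lambda>x. if x \<in> {a j..b j} then f x else 0) = integral {a j..b j} f"
      using ab[OF j] by (simp only: Henstock_Kurzweil_Integration.integral_restrict_Int) (auto intro!: arg_cong2[where f = integral])
    ultimately show "integral {0..b j} f - integral {0..a j} f = integral {0..1} (\<lambda>x. if x \<in> {a j..b j} then f x else 0)"
      by simp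
  qed
  also have "\<dots> = integral {0..1} (\<lambda>x. \<Sum>j<M. if x \<in> {a j..b j} then f x else 0)"
    by (rule integral_sum[symmetric]) (simp, rule ri, simp)
  also have "\<dots> \<le> integral {0..1} (\<lambda>x. f x + 2 * real M * (sqrt (x * (1 - x)) * f x))"
  proof (rule integral_le)
    show "(\<lambda>x. \<Sum>j<M. if x \<in> {a j..b j} then f x else 0) integrable_on {0..1}"
      by (rule integrable_sum) (simp, rule ri, simp)
    show "(\<lambda>x. f x + 2 * real M * (sqrt (x * (1 - x)) * f x)) integrable_on {0..1}"
      by (intro integrable_continuous_real continuous_intros f)
    fix x :: real assume x: "x \<in> {0..1}"
    have "(\<Sum>j<M. if x \<in> {a j..b j} then f x else 0) = real (card {j. j < M \<and> a j \<le> x \<and> x \<le> b j}) * f x"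
    proof -
      have "{j \<in> {..<M}. x \<in> {a j..b j}} = {j. j < M \<and> a j \<le> x \<and> x \<le> b j}" by auto
      then show ?thesis using sum.inter_filter[of "{..<M}" "\<lambda>_. f x" "\<lambda>j. x \<in> {a j..b j}"] by simp
    qed
    also have "\<dots> \<le> (1 + 2 * real M * sqrt (x * (1 - x))) * f x"
      using count_nodes[OF M \<theta>', of x] x f(2)[OF x] unfolding a_def b_def \<theta>_def by (intro mult_right_mono) auto
    finally show "(\<Sum>j<M. if x \<in> {a j..b j} then f x else 0) \<le> f x + 2 * real M * (sqrt (x * (1 - x)) * f x)"
      by (simp add: distrib_right mult.assoc)
  qed
  also have "\<dots> = integral {0..1} f + 2 * real M * integral {0..1} (\<lambda>x. sqrt (x * (1 - x)) * f x)"
    by (subst integral_add) (auto intro!: integrable_continuous_real continuous_intros f)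
  finally show ?thesis unfolding a_def b_def .
qed

section \<open>Equal weight points on a curve\<close>

lemma cdf_strict_mono:
  fixes \<rho> :: "real \<Rightarrow> real"
  assumes cont: "continuous_on {0..L} \<rho>" and pos: "\<And>s. s \<in> {0..L} \<Longrightarrow> 0 < \<rho> s"
    and s: "0 \<le> s" "s < s'" "s' \<le> L"
  shows "integral {0..s} \<rho> < integral {0..s'} \<rho>"
proof -
  have int: "\<rho> integrable_on {0..s'}"
    by (rule integrable_continuous_real, rule continuous_on_subset[OF cont]) (use s in auto)
  have cont': "continuous_on {s..s'} \<rho>"
    by (rule continuous_on_subset[OF cont]) (use s in auto)
  obtain x where x: "x \<in> {s..s'}" "\<And>y. y \<in> {s..s'} \<Longrightarrow> \<rho> x \<le> \<rho> y"
    using continuous_attains_inf[OF _ _ cont'] s by fastforce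
  have "0 < \<rho> x * (s' - s)" using pos[of x] x(1) s by simp
  also have "\<dots> = integral {s..s'} (\<lambda>_. \<rho> x)" using s by simp
  also have "\<dots> \<le> integral {s..s'} \<rho>"
    by (rule integral_le) (use x cont' in \<open>auto intro: integrable_continuous_real\<close>)
  finally show ?thesis
    using Henstock_Kurzweil_Integration.integral_combine[OF _ _ int, of s] s by linarith
qed

definition quantile :: "real \<Rightarrow> (real \<Rightarrow> real) \<Rightarrow> real \<Rightarrow> real" where
  "quantile L \<rho> c = (THE s. s \<in> {0..L} \<and> integral {0..s} \<rho> = c * integral {0..L} \<rho>)"

context
  fixes L :: real and \<rho> :: "real \<Rightarrow> real"
  assumes L: "0 < L" and cont: "continuous_on {0..L} \<rho>" and pos: "\<And>s. s \<in> {0..L} \<Longrightarrow> 0 < \<rho> s"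
begin

lemma cdf_total_pos: "0 < integral {0..L} \<rho>"
  using cdf_strict_mono[OF cont pos, of 0 L] L by simp

lemma quantile_ex1:
  assumes "0 \<le> c" "c \<le> 1"
  shows "\<exists>!s. s \<in> {0..L} \<and> integral {0..s} \<rho> = c * integral {0..L} \<rho>"
proof (rule ex_ex1I)
  have "continuous_on {0..L} (\<lambda>s. integral {0..s} \<rho>)"
    by (rule indefinite_integral_continuous_1, rule integrable_continuous_real[OF cont])
  moreover have "0 \<le> c * integral {0..L} \<rho>" "c * integral {0..L} \<rho> \<le> integral {0..L} \<rho>"
    using cdf_total_pos assms by (auto simp: mult_le_cancel_right1)
  ultimately show "\<exists>s. s \<in> {0..L} \<and> integral {0..s} \<rho> = c * integral {0..L} \<rho>"
    using IVT'[of "\<lambda>s. integral {0..s} \<rho>" 0 "c * integral {0..L} \<rho>" L] L by auto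
next
  fix s s' assume *: "s \<in> {0..L} \<and> integral {0..s} \<rho> = c * integral {0..L} \<rho>"
    "s' \<in> {0..L} \<and> integral {0..s'} \<rho> = c * integral {0..L} \<rho>"
  show "s = s'"
  proof (rule linorder_cases)
    assume "s < s'"
    with * show ?thesis using cdf_strict_mono[OF cont pos, of s s'] by auto
  next
    assume "s' < s"
    with * show ?thesis using cdf_strict_mono[OF cont pos, of s' s] by auto
  qed
qed

lemma
  assumes "0 \<le> c" "c \<le> 1"
  shows quantile_mem: "quantile L \<rho> c \<in> {0..L}"
    and integral_quantile: "integral {0..quantile L \<rho> c} \<rho> = c * integral {0..L} \<rho>"
  using theI'[OF quantile_ex1[OF assms]] unfolding quantile_def by blast+

lemma quantile_eqI:
  assumes "0 \<le> c" "c \<le> 1" "s \<in> {0..L}" "integral {0..s} \<rho> = c * integral {0..L} \<rho>"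
  shows "quantile L \<rho> c = s"
  unfolding quantile_def by (rule the1_equality[OF quantile_ex1]) (use assms in auto)

text \<open>Comparison with a quantile becomes a strict inequality between integrals of the density,
  hence an open condition when the density varies continuously.\<close>

lemma less_quantile_iff:
  assumes "0 \<le> c" "c \<le> 1" "s \<in> {0..L}"
  shows "s < quantile L \<rho> c \<longleftrightarrow> integral {0..s} \<rho> < c * integral {0..L} \<rho>"
  using cdf_strict_mono[OF cont pos, of s "quantile L \<rho> c"]
    cdf_strict_mono[OF cont pos, of "quantile L \<rho> c" s]
    quantile_mem[OF assms(1,2)] integral_quantile[OF assms(1,2)] assms(3)
  by (cases s "quantile L \<rho> c" rule: linorder_cases) auto

lemma quantile_less_iff:
  assumes "0 \<le> c" "c \<le> 1" "s \<in> {0..L}"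
  shows "quantile L \<rho> c < s \<longleftrightarrow> c * integral {0..L} \<rho> < integral {0..s} \<rho>"
  using cdf_strict_mono[OF cont pos, of s "quantile L \<rho> c"]
    cdf_strict_mono[OF cont pos, of "quantile L \<rho> c" s]
    quantile_mem[OF assms(1,2)] integral_quantile[OF assms(1,2)] assms(3)
  by (cases s "quantile L \<rho> c" rule: linorder_cases) auto

lemma quantile_strict_mono:
  assumes "0 \<le> c" "c < d" "d \<le> 1"
  shows "quantile L \<rho> c < quantile L \<rho> d"
proof -
  have "c * integral {0..L} \<rho> < d * integral {0..L} \<rho>"
    using cdf_total_pos assms by simp
  then show ?thesis
    using less_quantile_iff[of d "quantile L \<rho> c"] quantile_mem[of c] integral_quantile[of c] assms by simp
qed

text \<open>The \<open>N\<close> points are the odd quantiles of order \<open>2 N\<close>; on each of the \<open>2 N\<close> intervals of equal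
  mass, one of the two end points is such a point.\<close>

lemma sum_quantiles_ge:
  assumes g: "continuous_on {0..L} g" and N: "0 < N" and v: "variation_le g 0 L v"
  shows "real N * integral {0..L} (\<lambda>s. g s * \<rho> s) / integral {0..L} \<rho> - v / 2
      \<le> (\<Sum>l<N. g (quantile L \<rho> ((2 * real l + 1) / (2 * real N))))"
proof -
  obtain V where V: "\<And>s s'. 0 \<le> s \<Longrightarrow> s \<le> s' \<Longrightarrow> s' \<le> L \<Longrightarrow> \<bar>g s' - g s\<bar> \<le> V s' - V s" "V L - V 0 \<le> v"
    using variation_leE[OF v] by blast
  define Z where "Z = integral {0..L} \<rho>"
  define p where "p k = quantile L \<rho> (real k / (2 * real N))" for k :: nat
  have Z: "0 < Z" using cdf_total_pos by (simp add: Z_def)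
  have pm: "p k \<in> {0..L}" if "k \<le> 2 * N" for k
    unfolding p_def by (rule quantile_mem) (use that N in \<open>auto simp: divide_le_eq_1\<close>)
  have pI: "integral {0..p k} \<rho> = real k / (2 * real N) * Z" if "k \<le> 2 * N" for k
    unfolding p_def Z_def by (rule integral_quantile) (use that N in \<open>auto simp: divide_le_eq_1\<close>)
  have pl: "p k < p (Suc k)" if "k < 2 * N" for k
    unfolding p_def by (rule quantile_strict_mono) (use that N in \<open>auto simp: divide_strict_right_mono divide_le_eq_1\<close>)
  have p0: "p 0 = 0"
    unfolding p_def by (rule quantile_eqI) (use L in auto)
  have pN: "p (2 * N) = L"
    unfolding p_def by (rule quantile_eqI) (use L N in auto)
  have int: "(\<lambda>s. g s * \<rho> s) integrable_on {0..L}"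
    by (intro integrable_continuous_real continuous_intros g cont)
  define e where "e k = (if even k then Suc k else k)" for k :: nat
  have step: "integral {p k..p (Suc k)} (\<lambda>s. g s * \<rho> s)
      \<le> (g (p (e k)) + (V (p (Suc k)) - V (p k))) * (Z / (2 * real N))" if k: "k < 2 * N" for k
  proof -
    let ?I = "{p k..p (Suc k)}"
    have sub: "?I \<subseteq> {0..L}" using pm[of k] pm[of "Suc k"] k by auto
    have ek: "p (e k) = p k \<or> p (e k) = p (Suc k)" by (simp add: e_def)
    have le: "g s \<le> g (p (e k)) + (V (p (Suc k)) - V (p k))" if "s \<in> ?I" for s
      using V(1)[of s "p (Suc k)"] V(1)[of "p k" s] V(1)[of s s] ek that sub by fastforce
    have "integral ?I \<rho> = Z / (2 * real N)"
    proof -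
      have "integral {0..p k} \<rho> + integral ?I \<rho> = integral {0..p (Suc k)} \<rho>"
        by (rule Henstock_Kurzweil_Integration.integral_combine)
           (use pm[of k] pm[of "Suc k"] pl[OF k] k in
             \<open>auto intro!: integrable_continuous_real continuous_on_subset[OF cont]\<close>)
      then show ?thesis using pI[of k] pI[of "Suc k"] k by (simp add: add_divide_distrib distrib_right)
    qed
    moreover have "integral ?I (\<lambda>s. g s * \<rho> s)
        \<le> integral ?I (\<lambda>s. (g (p (e k)) + (V (p (Suc k)) - V (p k))) * \<rho> s)"
    proof (rule integral_le)
      show "(\<lambda>s. g s * \<rho> s) integrable_on ?I"
        by (rule integrable_subinterval_real[OF int sub])
      show "(\<lambda>s. (g (p (e k)) + (V (p (Suc k)) - V (p k))) * \<rho> s) integrable_on ?I"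
        by (intro integrable_continuous_real continuous_intros continuous_on_subset[OF cont sub])
      show "g s * \<rho> s \<le> (g (p (e k)) + (V (p (Suc k)) - V (p k))) * \<rho> s" if "s \<in> ?I" for s
        by (rule mult_right_mono[OF le[OF that]]) (use pos[of s] sub that in force)
    qed
    ultimately show ?thesis by simp
  qed
  have split: "integral {0..p k} (\<lambda>s. g s * \<rho> s) = (\<Sum>j<k. integral {p j..p (Suc j)} (\<lambda>s. g s * \<rho> s))"
    if "k \<le> 2 * N" for k
    using that
  proof (induction k)
    case (Suc k)
    have "integral {0..p k} (\<lambda>s. g s * \<rho> s) + integral {p k..p (Suc k)} (\<lambda>s. g s * \<rho> s)
        = integral {0..p (Suc k)} (\<lambda>s. g s * \<rho> s)"
      by (rule Henstock_Kurzweil_Integration.integral_combine)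
         (use pm[of k] pm[of "Suc k"] pl[of k] Suc.prems in
           \<open>auto intro!: integrable_subinterval_real[OF int]\<close>)
    then show ?case using Suc by simp
  qed (simp add: p0)
  have "integral {0..L} (\<lambda>s. g s * \<rho> s) = (\<Sum>k<2 * N. integral {p k..p (Suc k)} (\<lambda>s. g s * \<rho> s))"
    using split[of "2 * N"] pN by simp
  also have "\<dots> \<le> (\<Sum>k<2 * N. (g (p (e k)) + (V (p (Suc k)) - V (p k))) * (Z / (2 * real N)))"
    by (rule sum_mono) (use step in auto)
  also have "\<dots> = ((\<Sum>k<2 * N. g (p (e k))) + (V L - V 0)) * (Z / (2 * real N))"
    using sum_lessThan_telescope[of "\<lambda>k. V (p k)" "2 * N"]
    by (simp only: sum_distrib_right[symmetric] sum.distrib p0 pN)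
  also have "(\<Sum>k<2 * M. g (p (e k))) = 2 * (\<Sum>l<M. g (p (2 * l + 1)))" for M
    by (induction M) (auto simp: e_def)
  finally have "integral {0..L} (\<lambda>s. g s * \<rho> s)
      \<le> (2 * (\<Sum>l<N. g (p (2 * l + 1))) + (V L - V 0)) * (Z / (2 * real N))" .
  then have "real N * integral {0..L} (\<lambda>s. g s * \<rho> s) / Z - (V L - V 0) / 2 \<le> (\<Sum>l<N. g (p (2 * l + 1)))"
    using Z N by (simp add: field_simps)
  then have "real N * integral {0..L} (\<lambda>s. g s * \<rho> s) / Z - v / 2 \<le> (\<Sum>l<N. g (p (2 * l + 1)))"
    using V(2) by argo
  then show ?thesis by (simp add: p_def Z_def add.commute)
qed

end

text \<open>Continuity is tested by lower and upper thresholds \<open>x\<close>. For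
  \<open>x\<close> in \<open>[0, L]\<close> both comparisons are sign conditions on
  \<open>D x b\<close>, a parameter integral that is continuous in \<open>b\<close>.\<close>

lemma continuous_on_quantile:
  fixes E :: "'a :: topological_space \<Rightarrow> real \<Rightarrow> real"
  assumes L: "0 < L" and c: "0 \<le> c" "c \<le> 1"
    and cont: "continuous_on (UNIV \<times> {0..L}) (\<lambda>(a, s). E a s)"
    and pos: "\<And>a s. s \<in> {0..L} \<Longrightarrow> 0 < E a s"
  shows "continuous_on UNIV (\<lambda>a. quantile L (E a) c)"
proof -
  have cE: "continuous_on {0..L} (E a)" for a
  proof -
    have "continuous_on {0..L} (\<lambda>s. (a, s))" by (intro continuous_intros)
    from continuous_on_compose2[OF cont this] show ?thesis by auto
  qed
  define D where "D x b = integral {0..x} (E b) - c * integral {0..L} (E b)" for x b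
  have cI: "(D x \<longlongrightarrow> D x a) (at a)" if "x \<in> {0..L}" for x a
  proof -
    have "continuous_on UNIV (D x)"
      unfolding D_def box_real(2)[symmetric]
      by (intro continuous_intros integral_continuous_on_param continuous_on_subset[OF cont])
         (use that in auto)
    then show ?thesis by (simp add: continuous_on_def)
  qed
  note mem = quantile_mem[OF L cE pos c]
  show ?thesis
    unfolding continuous_on_def
  proof (intro ballI order_tendstoI)
    fix a x assume x: "x < quantile L (E a) c"
    show "\<forall>\<^sub>F b in at a. x < quantile L (E b) c"
    proof (cases "0 \<le> x")
      case True
      then have xm: "x \<in> {0..L}" using x mem[of a] by auto
      have iff: "x < quantile L (E b) c \<longleftrightarrow> D x b < 0" for b
        using less_quantile_iff[OF L cE pos c xm] by (simp add: D_def)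
      show ?thesis unfolding iff by (rule order_tendstoD(2)[OF cI[OF xm]]) (use x iff in blast)
    next
      case False
      then have "x < quantile L (E b) c" for b using mem[of b] by auto
      then show ?thesis by simp
    qed
  next
    fix a x assume x: "quantile L (E a) c < x"
    show "\<forall>\<^sub>F b in at a. quantile L (E b) c < x"
    proof (cases "x \<le> L")
      case True
      then have xm: "x \<in> {0..L}" using x mem[of a] by auto
      have iff: "quantile L (E b) c < x \<longleftrightarrow> 0 < D x b" for b
        using quantile_less_iff[OF L cE pos c xm] by (simp add: D_def)
      show ?thesis unfolding iff by (rule order_tendstoD(1)[OF cI[OF xm]]) (use x iff in blast)
    next
      case False
      then have "quantile L (E b) c < x" for b using mem[of b] by auto
      then show ?thesis by simp
    qed
  qed
qed

text \<open>Points where \<open>g\<close> is within \<open>2 * e\<close> of its maximum cost at most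
  \<open>2 * e\<close> in the mean. Elsewhere the density, relative to its peak, is at most
  \<open>exp (- 2 * \<beta> * e)\<close>, whereas the total relative mass is at least
  \<open>d * exp (- \<beta> * e)\<close> because of an interval of length \<open>d\<close> on which
  \<open>g\<close> is within \<open>e\<close> of the maximum. One factor
  \<open>exp (- \<beta> * e)\<close> remains in the quotient.\<close>

lemma softmax_concentration:
  fixes g :: "real \<Rightarrow> real"
  assumes g: "continuous_on {0..L} g" and x: "x \<in> {0..L}" "\<And>s. s \<in> {0..L} \<Longrightarrow> g s \<le> g x"
    and B: "\<And>s. s \<in> {0..L} \<Longrightarrow> g x - g s \<le> B"
    and d: "0 < d" "2 * d \<le> L" and \<beta>: "0 < \<beta>" and e: "0 < e"
    and osc: "\<And>s. s \<in> {0..L} \<Longrightarrow> \<bar>s - x\<bar> \<le> d \<Longrightarrow> g x - g s \<le> e"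
  shows "(g x - 2 * e - B * L * exp (- \<beta> * e) / d) * integral {0..L} (\<lambda>s. exp (\<beta> * g s))
      \<le> integral {0..L} (\<lambda>s. g s * exp (\<beta> * g s))"
proof -
  define M where "M = g x"
  define w where "w s = exp (- \<beta> * (M - g s))" for s
  have cw: "continuous_on {0..L} w"
    unfolding w_def by (intro continuous_intros g)
  have wE: "exp (\<beta> * g s) = exp (\<beta> * M) * w s" for s
    by (simp add: w_def exp_add[symmetric] algebra_simps)
  have B0: "0 \<le> B" using B[OF x(1)] by simp
  \<comment> \<open>An interval of length \<open>d\<close> on that side of \<open>x\<close> where it
    fits into \<open>[0, L]\<close>; \<open>2 * d \<le> L\<close> ensures that one side
    does.\<close>
  define a where "a = (if x + d \<le> L then x else x - d)"
  have a: "{a..a + d} \<subseteq> {0..L}" "\<And>s. s \<in> {a..a + d} \<Longrightarrow> \<bar>s - x\<bar> \<le> d"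
    using x(1) d by (auto simp: a_def split: if_splits)
  have "d * exp (- \<beta> * e) = integral {a..a + d} (\<lambda>_. exp (- \<beta> * e))"
    using d by simp
  also have "\<dots> \<le> integral {a..a + d} w"
  proof (rule integral_le)
    show "w integrable_on {a..a + d}"
      by (rule integrable_continuous_real, rule continuous_on_subset[OF cw a(1)])
    show "exp (- \<beta> * e) \<le> w s" if "s \<in> {a..a + d}" for s
      using osc[of s] a that \<beta> unfolding w_def M_def by auto
  qed (rule integrable_continuous_real, simp)
  also have "\<dots> \<le> integral {0..L} w"
    by (rule integral_subset_le[OF a(1)])
       (auto intro!: integrable_continuous_real continuous_on_subset[OF cw a(1)] cw simp: w_def)
  finally have Z: "d * exp (- \<beta> * e) \<le> integral {0..L} w" .
  have pw: "(M - g s) * w s \<le> 2 * e * w s + B * exp (- \<beta> * e) * exp (- \<beta> * e)" if s: "s \<in> {0..L}" for s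
  proof (cases "M - g s \<le> 2 * e")
    case True
    then have "(M - g s) * w s \<le> 2 * e * w s" by (intro mult_right_mono) (auto simp: w_def)
    then show ?thesis using B0 by (smt (verit) exp_gt_zero mult_nonneg_nonneg)
  next
    case False
    then have "\<beta> * (2 * e) \<le> \<beta> * (M - g s)"
      using \<beta> by (intro mult_left_mono) auto
    then have "w s \<le> exp (- \<beta> * e) * exp (- \<beta> * e)"
      by (simp add: w_def exp_add[symmetric])
    then have "(M - g s) * w s \<le> B * (exp (- \<beta> * e) * exp (- \<beta> * e))"
      using B[OF s] x(2)[OF s] by (intro mult_mono) (auto simp: M_def w_def)
    moreover have "0 \<le> 2 * e * w s" using e by (simp add: w_def)
    ultimately show ?thesis by (simp add: mult.assoc)
  qed
  have "integral {0..L} (\<lambda>s. (M - g s) * w s)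
      \<le> integral {0..L} (\<lambda>s. 2 * e * w s + B * exp (- \<beta> * e) * exp (- \<beta> * e))"
    by (rule integral_le) (use pw in \<open>auto intro!: integrable_continuous_real continuous_intros g cw\<close>)
  also have "\<dots> = 2 * e * integral {0..L} w + L * (B * exp (- \<beta> * e) * exp (- \<beta> * e))"
    using d by (subst integral_add) (auto intro!: integrable_continuous_real continuous_intros cw)
  also have "L * (B * exp (- \<beta> * e) * exp (- \<beta> * e)) = (B * L * exp (- \<beta> * e) / d) * (d * exp (- \<beta> * e))"
    using d by (simp add: field_simps)
  also have "\<dots> \<le> (B * L * exp (- \<beta> * e) / d) * integral {0..L} w"
    using Z B0 d by (intro mult_left_mono) auto
  finally have 1: "integral {0..L} (\<lambda>s. (M - g s) * w s)
      \<le> 2 * e * integral {0..L} w + (B * L * exp (- \<beta> * e) / d) * integral {0..L} w" by simp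
  have "integral {0..L} (\<lambda>s. (M - g s) * w s) = integral {0..L} (\<lambda>s. M * w s - g s * w s)"
    by (simp add: algebra_simps)
  also have "\<dots> = M * integral {0..L} w - integral {0..L} (\<lambda>s. g s * w s)"
    by (subst integral_diff) (auto intro!: integrable_continuous_real continuous_intros cw g)
  finally have "(M - 2 * e - B * L * exp (- \<beta> * e) / d) * integral {0..L} w \<le> integral {0..L} (\<lambda>s. g s * w s)"
    using 1 by (simp add: algebra_simps)
  then have "exp (\<beta> * M) * ((M - 2 * e - B * L * exp (- \<beta> * e) / d) * integral {0..L} w)
      \<le> exp (\<beta> * M) * integral {0..L} (\<lambda>s. g s * w s)"
    by (rule mult_left_mono) simp
  moreover have "integral {0..L} (\<lambda>s. exp (\<beta> * g s)) = exp (\<beta> * M) * integral {0..L} w"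
    unfolding wE by simp
  moreover have "integral {0..L} (\<lambda>s. g s * exp (\<beta> * g s)) = exp (\<beta> * M) * integral {0..L} (\<lambda>s. g s * w s)"
    unfolding wE by (simp only: mult.left_commute[of _ "exp (\<beta> * M)"] integral_mult_right)
  ultimately show ?thesis unfolding M_def by (simp add: mult_ac)
qed

text \<open>The variational inequality makes all products \<open>a i * G a i\<close> nonpositive at
  its solution. If some \<open>G a i\<close> were nonzero there, the solution would lie on the
  boundary \<open>K\<close> of the cube, where the sum of these products is positive. One and the
  same \<beta> has to serve all of \<open>K\<close>, since \<open>G\<close> must be a single
  continuous map; this is why the lower bound \<open>m\<close> and the modulus of continuity are
  made uniform by compactness.\<close>

theorem equal_weight_points_on_curve:
  fixes \<Phi> :: "nat \<Rightarrow> real \<Rightarrow> real"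
  assumes L: "0 < L" and N: "0 < N"
    and cont: "\<And>i. i < n \<Longrightarrow> continuous_on {0..L} (\<Phi> i)"
    and C: "C < 2 * real N"
    and var: "\<And>a. (\<exists>i<n. a i \<noteq> 0) \<Longrightarrow> \<exists>x\<in>{0..L}. 0 < (\<Sum>i<n. a i * \<Phi> i x) \<and>
      (\<forall>s\<in>{0..L}. (\<Sum>i<n. a i * \<Phi> i s) \<le> (\<Sum>i<n. a i * \<Phi> i x)) \<and>
      variation_le (\<lambda>s. \<Sum>i<n. a i * \<Phi> i s) 0 L (C * (\<Sum>i<n. a i * \<Phi> i x))"
  shows "\<exists>p :: nat \<Rightarrow> real. (\<forall>l<N. p l \<in> {0..L}) \<and> (\<forall>k l. k < l \<longrightarrow> l < N \<longrightarrow> p k < p l) \<and>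
      (\<forall>i<n. (\<Sum>l<N. \<Phi> i (p l)) = 0)"
proof -
  define g where "g a s = (\<Sum>i<n. a i * \<Phi> i s)" for a :: "nat \<Rightarrow> real" and s
  define K where "K = {a :: nat \<Rightarrow> real. (\<forall>i. \<bar>a i\<bar> \<le> (if i < n then 1 else 0)) \<and> (\<exists>i<n. \<bar>a i\<bar> = 1)}"
  have cg: "continuous_on {0..L} (g a)" for a
    unfolding g_def by (intro continuous_intros cont) auto
  have "compact K"
  proof -
    have "closed (\<Union>i<n. {a :: nat \<Rightarrow> real. \<bar>a i\<bar> = 1})"
      by (intro closed_UN ballI closed_Collect_eq continuous_intros) auto
    then have "compact ({a :: nat \<Rightarrow> real. \<forall>i. \<bar>a i\<bar> \<le> (if i < n then 1 else 0)} \<inter> (\<Union>i<n. {a. \<bar>a i\<bar> = 1}))"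
      by (rule compact_Int_closed[OF compact_unit_cube_nat])
    also have "\<dots> = K" by (auto simp: K_def)
    finally show ?thesis .
  qed
  \<comment> \<open>A point at which \<open>g a\<close> is positive still gives more than half that
    value for all \<open>b\<close> near \<open>a\<close>, so finitely many such points serve the
    whole of \<open>K\<close>.\<close>
  have "\<exists>m>0. \<forall>a\<in>K. \<exists>s\<in>{0..L}. m \<le> g a s"
  proof -
    have "\<exists>s. s \<in> {0..L} \<and> 0 < g a s" if "a \<in> K" for a
    proof -
      obtain i where "i < n" "\<bar>a i\<bar> = 1" using \<open>a \<in> K\<close> unfolding K_def by blast
      then have "\<exists>i<n. a i \<noteq> 0" by (intro exI[of _ i]) auto
      from var[OF this] show ?thesis unfolding g_def by blast
    qed
    then obtain t where t: "\<And>a. a \<in> K \<Longrightarrow> t a \<in> {0..L}" "\<And>a. a \<in> K \<Longrightarrow> 0 < g a (t a)"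
      by metis
    define U where "U a = {b. g b (t a) > g a (t a) / 2}" for a
    have "open (U a)" for a
      unfolding U_def g_def by (intro open_Collect_less continuous_intros) auto
    moreover have "K \<subseteq> (\<Union>a\<in>K. U a)" using t(2) by (force simp: U_def)
    ultimately obtain F where F: "F \<subseteq> K" "finite F" "K \<subseteq> (\<Union>a\<in>F. U a)"
      using compactE_image[OF \<open>compact K\<close>, of K U] by metis
    define m where "m = Min (insert 1 ((\<lambda>a. g a (t a) / 2) ` F))"
    have "0 < m" unfolding m_def using F t(2) by (subst Min_gr_iff) auto
    moreover have "\<exists>s\<in>{0..L}. m \<le> g b s" if b: "b \<in> K" for b
    proof -
      obtain a where a: "a \<in> F" "b \<in> U a" using F(3) b by blast
      have "m \<le> g a (t a) / 2" unfolding m_def using F(2) a(1) by (intro Min_le) auto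
      then show ?thesis using a t(1)[of a] F(1) unfolding U_def by force
    qed
    ultimately show ?thesis by blast
  qed
  then obtain m where m: "0 < m" "\<And>a. a \<in> K \<Longrightarrow> \<exists>s\<in>{0..L}. m \<le> g a s" by blast
  \<comment> \<open>The gain exceeds half the variation by at least
    \<open>(2 N - C) m / 2 = 8 N \<eta>\<close>, while imperfect concentration costs at most
    \<open>3 N \<eta>\<close>.\<close>
  define \<eta> where "\<eta> = (2 * real N - C) * m / (16 * real N)"
  have \<eta>: "0 < \<eta>" using m C N by (simp add: \<eta>_def)
  have cg2: "continuous_on (UNIV \<times> {0..L}) (\<lambda>p. g (fst p) (snd p))"
  proof -
    have 1: "continuous_on (UNIV \<times> {0..L}) (\<lambda>p :: (nat \<Rightarrow> real) \<times> real. \<Phi> i (snd p))" if "i < n" for i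
      by (rule continuous_on_compose2[OF cont[OF that] continuous_on_snd[OF continuous_on_id]]) auto
    have 2: "continuous_on (UNIV \<times> {0..L}) (\<lambda>p :: (nat \<Rightarrow> real) \<times> real. fst p i)" for i
      by (rule continuous_on_compose2[OF continuous_on_product_coordinates
            continuous_on_fst[OF continuous_on_id]]) auto
    show ?thesis unfolding g_def by (intro continuous_intros 1 2) auto
  qed
  then have cgK: "continuous_on (K \<times> {0..L}) (\<lambda>p. g (fst p) (snd p))"
    by (rule continuous_on_subset) auto
  have cK: "compact (K \<times> {0..L})" by (intro compact_Times \<open>compact K\<close> compact_Icc)
  obtain d0 where d0: "0 < d0" "\<And>a s s'. a \<in> K \<Longrightarrow> s \<in> {0..L} \<Longrightarrow> s' \<in> {0..L} \<Longrightarrow>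
      \<bar>s' - s\<bar> < d0 \<Longrightarrow> \<bar>g a s' - g a s\<bar> < \<eta>"
  proof -
    obtain d0 where d0: "0 < d0" "\<And>p p'. p \<in> K \<times> {0..L} \<Longrightarrow> p' \<in> K \<times> {0..L} \<Longrightarrow> dist p' p < d0 \<Longrightarrow>
        dist (g (fst p') (snd p')) (g (fst p) (snd p)) < \<eta>"
      using compact_uniformly_continuous[OF cgK cK] \<eta> unfolding uniformly_continuous_on_def by metis
    show ?thesis
      by (rule that[OF d0(1)]) (use d0(2)[of "(_, _)" "(_, _)"] in \<open>simp add: dist_Pair_Pair dist_real_def\<close>)
  qed
  define d where "d = min (d0 / 2) (L / 2)"
  have d: "0 < d" "2 * d \<le> L" "d < d0" using d0(1) L by (auto simp: d_def)
  have "bounded ((\<lambda>p. g (fst p) (snd p)) ` (K \<times> {0..L}))"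
    by (intro compact_imp_bounded compact_continuous_image cgK cK)
  then obtain B0 where B0: "\<And>a s. a \<in> K \<Longrightarrow> s \<in> {0..L} \<Longrightarrow> \<bar>g a s\<bar> \<le> B0"
    unfolding bounded_iff by force
  define B where "B = 2 * \<bar>B0\<bar> + 1"
  obtain \<beta> where \<beta>: "0 < \<beta>" "B * L * exp (- \<beta> * \<eta>) / d \<le> \<eta>"
  proof -
    have "((\<lambda>x. B * L * exp (- x * \<eta>) / d) \<longlongrightarrow> B * L * 0 / d) at_top"
    proof (intro tendsto_intros)
      have "filterlim (\<lambda>x. x * \<eta>) at_top at_top"
        by (rule filterlim_at_top_mult_tendsto_pos[OF tendsto_const \<eta> filterlim_ident])
      then have "filterlim (\<lambda>x. - (x * \<eta>)) at_bot at_top"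
        by (simp add: filterlim_uminus_at_bot)
      then show "((\<lambda>x. exp (- x * \<eta>)) \<longlongrightarrow> 0) at_top"
        using filterlim_compose[OF exp_at_bot] by fastforce
    qed (use d in auto)
    then have "\<forall>\<^sub>F x in at_top. B * L * exp (- x * \<eta>) / d < \<eta>"
      using \<eta> by (intro order_tendstoD(2)) auto
    then have "\<forall>\<^sub>F x in at_top. B * L * exp (- x * \<eta>) / d < \<eta> \<and> 0 < x"
      using eventually_gt_at_top[of 0] by (rule eventually_conj)
    then obtain \<beta> where "B * L * exp (- \<beta> * \<eta>) / d < \<eta>" "0 < \<beta>"
      using eventually_happens'[OF trivial_limit_at_top_linorder] by blast
    then show ?thesis using that by simp
  qed
  define E where "E a s = exp (\<beta> * g a s)" for a s
  have cE: "continuous_on {0..L} (E a)" for a unfolding E_def by (intro continuous_intros cg)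
  have Epos: "0 < E a s" for a s by (simp add: E_def)
  have cE2: "continuous_on (UNIV \<times> {0..L}) (\<lambda>(a, s). E a s)"
    unfolding E_def case_prod_beta by (intro continuous_intros cg2)
  define c where "c l = (2 * real l + 1) / (2 * real N)" for l :: nat
  have c: "0 \<le> c l" "c l \<le> 1" if "l < N" for l
    using that N by (auto simp: c_def divide_le_eq_1)
  define P where "P a l = quantile L (E a) (c l)" for a l
  have Pm: "P a l \<in> {0..L}" if "l < N" for a l
    unfolding P_def by (rule quantile_mem[OF L cE Epos c[OF that]])
  have Pmono: "P a k < P a l" if "k < l" "l < N" for a k l
    unfolding P_def
    by (rule quantile_strict_mono[OF L cE Epos]) (use c that N in \<open>auto simp: c_def divide_strict_right_mono\<close>)
  define G where "G a i = (\<Sum>l<N. \<Phi> i (P a l))" for a i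
  have cG: "continuous_on UNIV (\<lambda>a. G a i)" if "i < n" for i
  proof -
    have cP: "continuous_on UNIV (\<lambda>a. P a l)" if "l < N" for l
      unfolding P_def by (rule continuous_on_quantile[OF L c[OF that] cE2 Epos])
    have "continuous_on UNIV (\<lambda>a. \<Phi> i (P a l))" if "l < N" for l
      by (rule continuous_on_compose2[OF cont[OF \<open>i < n\<close>] cP[OF that]]) (use Pm[OF that] in auto)
    then show ?thesis unfolding G_def by (intro continuous_on_sum) auto
  qed
  have pos: "0 < (\<Sum>i<n. a i * G a i)" if a: "a \<in> K" for a
  proof -
    obtain i where "i < n" "\<bar>a i\<bar> = 1" using \<open>a \<in> K\<close> unfolding K_def by blast
    then have "\<exists>i<n. a i \<noteq> 0" by (intro exI[of _ i]) auto
    from var[OF this] obtain x where x: "x \<in> {0..L}" "\<And>s. s \<in> {0..L} \<Longrightarrow> g a s \<le> g a x"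
      and V: "variation_le (g a) 0 L (C * g a x)"
      unfolding g_def by blast
    have mx: "m \<le> g a x" using m(2)[OF a] x by force
    define Z where "Z = integral {0..L} (E a)"
    have Z: "0 < Z" unfolding Z_def by (rule cdf_total_pos[OF L cE Epos])
    have "(g a x - 2 * \<eta> - B * L * exp (- \<beta> * \<eta>) / d) * Z \<le> integral {0..L} (\<lambda>s. g a s * E a s)"
      unfolding Z_def E_def
    proof (rule softmax_concentration[OF cg x _ d(1,2) \<beta>(1) \<eta>])
      show "g a x - g a s \<le> B" if "s \<in> {0..L}" for s
        using B0[OF a that] B0[OF a x(1)] unfolding B_def by linarith
      show "g a x - g a s \<le> \<eta>" if "s \<in> {0..L}" "\<bar>s - x\<bar> \<le> d" for s
        using d0(2)[OF a x(1) that(1)] that(2) d(3) by linarith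
    qed auto
    moreover have "(g a x - 3 * \<eta>) * Z \<le> (g a x - 2 * \<eta> - B * L * exp (- \<beta> * \<eta>) / d) * Z"
      using \<beta>(2) Z by (intro mult_right_mono) auto
    ultimately have "(g a x - 3 * \<eta>) * Z \<le> integral {0..L} (\<lambda>s. g a s * E a s)" by simp
    then have "real N * (g a x - 3 * \<eta>) \<le> real N * (integral {0..L} (\<lambda>s. g a s * E a s) / Z)"
      using Z by (intro mult_left_mono) (auto simp: field_simps)
    moreover have "real N * integral {0..L} (\<lambda>s. g a s * E a s) / Z - C * g a x / 2 \<le> (\<Sum>l<N. g a (P a l))"
      unfolding Z_def P_def c_def by (rule sum_quantiles_ge[OF L cE Epos cg N V])
    ultimately have "real N * (g a x - 3 * \<eta>) - C * g a x / 2 \<le> (\<Sum>l<N. g a (P a l))"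
      unfolding times_divide_eq_right by (meson diff_right_mono order_trans)
    moreover have "real N * (g a x - 3 * \<eta>) - C * g a x / 2 > 0"
    proof -
      have "(2 * real N - C) * m \<le> (2 * real N - C) * g a x"
        using mx C by (intro mult_left_mono) auto
      moreover have "real N * \<eta> = (2 * real N - C) * m / 16" using N by (simp add: \<eta>_def)
      moreover have "0 < (2 * real N - C) * m" using m C by simp
      ultimately show ?thesis by (simp add: algebra_simps)
    qed
    moreover have "(\<Sum>l<N. g a (P a l)) = (\<Sum>i<n. a i * G a i)"
      unfolding g_def G_def sum_distrib_left by (rule sum.swap)
    ultimately show ?thesis by simp
  qed
  obtain a where a: "\<forall>i. \<bar>a i\<bar> \<le> (if i < n then 1 else 0)"
    and aG: "\<forall>i<n. G a i = 0 \<or> (a i = 1 \<and> G a i < 0) \<or> (a i = -1 \<and> G a i > 0)"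
    using cube_variational_inequality[of n G, OF cG] by blast
  have "G a i = 0" if "i < n" for i
  proof (rule ccontr)
    assume "G a i \<noteq> 0"
    then have "\<bar>a i\<bar> = 1" using aG that by auto
    then have "a \<in> K" using a that unfolding K_def by blast
    moreover have "(\<Sum>i<n. a i * G a i) \<le> 0"
      by (rule sum_nonpos) (use aG in fastforce)
    ultimately show False using pos by fastforce
  qed
  then show ?thesis
    using Pm[of _ a] Pmono[of _ _ a] unfolding G_def by (intro exI[of _ "P a"]) auto
qed

section \<open>The snake\<close>

text \<open>A unit ramp. Sums of shifted ramps encode piecewise linear functions by one formula,
  continuous without any gluing.\<close>

definition clamp01 :: "real \<Rightarrow> real" where
  "clamp01 r = max 0 (min 1 r)"

lemma clamp01_mono: "r \<le> r' \<Longrightarrow> clamp01 r \<le> clamp01 r'"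
  by (auto simp: clamp01_def)

text \<open>The ramps before \<open>j\<close> are complete, the \<open>j\<close>-th is under way and
  the later ones have not begun.\<close>

lemma sum_clamp01_rising:
  assumes "2 * real j + c \<le> s" "s \<le> 2 * real j + c + 1" "j < m"
  shows "(\<Sum>i<m. a i * clamp01 (s - (2 * real i + c))) = (\<Sum>i<j. a i) + a j * (s - (2 * real j + c))"
proof -
  have eq: "a i * clamp01 (s - (2 * real i + c)) = (if i < j then a i else if i = j then a j * (s - (2 * real j + c)) else 0)" for i
  proof (rule linorder_cases[of i j])
    assume "i < j"
    then have "real i + 1 \<le> real j" by linarith
    then show ?thesis using assms \<open>i < j\<close> by (simp add: clamp01_def)
  next
    assume "j < i"
    then have "real j + 1 \<le> real i" by linarith
    then show ?thesis using assms \<open>j < i\<close> by (simp add: clamp01_def)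
  qed (use assms in \<open>simp add: clamp01_def\<close>)
  have "(\<Sum>i<m. a i * clamp01 (s - (2 * real i + c)))
      = (\<Sum>i\<in>{..<m}. if i < j then a i else if i = j then a j * (s - (2 * real j + c)) else 0)"
    unfolding eq ..
  also have "\<dots> = (\<Sum>i\<in>{..<m}. (if i \<in> {..<j} then a i else 0) + (if i = j then a j * (s - (2 * real j + c)) else 0))"
    by (rule sum.cong) auto
  also have "\<dots> = (\<Sum>i<j. a i) + a j * (s - (2 * real j + c))"
    unfolding sum.distrib using assms(3)
    by (subst sum.inter_restrict[symmetric]) (auto intro!: sum.cong)
  finally show ?thesis .
qed

lemma sum_clamp01_flat:
  assumes "2 * real j + c - 1 \<le> s" "s \<le> 2 * real j + c" "j \<le> m"
  shows "(\<Sum>i<m. a i * clamp01 (s - (2 * real i + c))) = (\<Sum>i<j. a i)"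
proof -
  have eq: "a i * clamp01 (s - (2 * real i + c)) = (if i \<in> {..<j} then a i else 0)" for i
  proof (cases "i < j")
    case True
    then have "real i + 1 \<le> real j" by linarith
    then show ?thesis using assms True by (simp add: clamp01_def)
  next
    case False
    then have "real j \<le> real i" by simp
    then show ?thesis using assms False by (simp add: clamp01_def)
  qed
  show ?thesis
    unfolding eq using assms(3) by (subst sum.inter_restrict[symmetric]) (auto intro!: sum.cong)
qed

lemma sum_alternating: "(\<Sum>i<j. (-1) ^ i) = (if even j then 0 else 1 :: real)"
  by (induction j) auto

definition sph :: "real \<Rightarrow> real \<Rightarrow> real ^ 3" where
  "sph \<theta> \<phi> = vector [sin \<theta> * cos \<phi>, sin \<theta> * sin \<phi>, cos \<theta>]"

lemma inner_sph: "sph \<theta> \<phi> \<bullet> sph \<theta>' \<phi>' = cos \<theta> * cos \<theta>' + sin \<theta> * sin \<theta>' * cos (\<phi> - \<phi>')"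
  by (simp add: sph_def inner_vec_def sum_3 cos_diff algebra_simps)

lemma norm_sph: "norm (sph \<theta> \<phi>) = 1"
proof -
  have "sph \<theta> \<phi> \<bullet> sph \<theta> \<phi> = 1"
    unfolding inner_sph using sin_cos_squared_add2[of \<theta>] by (simp add: power2_eq_square)
  then show ?thesis by (simp add: norm_eq_sqrt_inner)
qed

text \<open>The snake runs through the \<open>M\<close> parallels at the Fejer colatitudes, alternately forwards (on
  \<open>[2 j, 2 j + 1]\<close>, \<open>j\<close> even) and backwards, leaving out the last \<open>M\<close>-th part of each parallel so as to
  be injective; on \<open>[2 j + 1, 2 j + 2]\<close> it follows a meridian to the next parallel.\<close>

definition snake_colat :: "nat \<Rightarrow> real \<Rightarrow> real" where
  "snake_colat M s = pi / (2 * real M) + pi / real M * (\<Sum>i<M - 1. 1 * clamp01 (s - (2 * real i + 1)))"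

text \<open>The largest of the \<open>M\<close> equidistant node azimuths: stopping there keeps all
  quadrature nodes on the snake, yet the parallel does not close up.\<close>

abbreviation az_max :: "nat \<Rightarrow> real" where
  "az_max M \<equiv> 2 * pi * (real M - 1) / real M"

definition snake_az :: "nat \<Rightarrow> real \<Rightarrow> real" where
  "snake_az M s = az_max M * (\<Sum>i<M. (-1) ^ i * clamp01 (s - (2 * real i + 0)))"

definition snake :: "nat \<Rightarrow> real \<Rightarrow> real ^ 3" where
  "snake M s = sph (snake_colat M s) (snake_az M s)"

lemma continuous_on_snake: "continuous_on A (snake M)"
proof -
  have c: "continuous_on A (snake_colat M)" "continuous_on A (snake_az M)"
    unfolding snake_colat_def snake_az_def clamp01_def by (intro continuous_intros)+
  have "snake M = (\<lambda>s. \<chi> i. if i = 1 then sin (snake_colat M s) * cos (snake_az M s)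
      else if i = 2 then sin (snake_colat M s) * sin (snake_az M s) else cos (snake_colat M s))"
    by (auto simp: snake_def sph_def fun_eq_iff vec_eq_iff forall_3)
  moreover have "continuous_on A (\<lambda>s. if i = (1 :: 3) then sin (snake_colat M s) * cos (snake_az M s)
      else if i = 2 then sin (snake_colat M s) * sin (snake_az M s) else cos (snake_colat M s))" for i
    using c by (cases "i = 1"; cases "i = 2") (auto intro!: continuous_intros)
  ultimately show ?thesis by (simp only: continuous_on_vec_lambda)
qed

lemma norm_snake: "norm (snake M s) = 1"
  by (simp add: snake_def norm_sph)

context
  fixes M :: nat
  assumes M: "2 \<le> M"
begin

private lemma M0: "0 < real M" using M by simp

lemma snake_colat_circle:
  assumes "j < M" "2 * real j \<le> s" "s \<le> 2 * real j + 1"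
  shows "snake_colat M s = fejer_node M j"
proof -
  have "(\<Sum>i<M - 1. 1 * clamp01 (s - (2 * real i + 1))) = (\<Sum>i<j. 1)"
    by (rule sum_clamp01_flat) (use assms in auto)
  then show ?thesis using M0 by (simp add: snake_colat_def fejer_node_def field_simps)
qed

lemma snake_colat_meridian:
  assumes "j < M - 1" "2 * real j + 1 \<le> s" "s \<le> 2 * real j + 2"
  shows "snake_colat M s = fejer_node M j + pi / real M * (s - (2 * real j + 1))"
proof -
  have "(\<Sum>i<M - 1. 1 * clamp01 (s - (2 * real i + 1))) = (\<Sum>i<j. 1) + 1 * (s - (2 * real j + 1))"
    by (rule sum_clamp01_rising) (use assms in auto)
  then show ?thesis using M0 unfolding snake_colat_def by (simp only:) (simp add: fejer_node_def field_simps)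
qed

lemma snake_az_circle:
  assumes "j < M" "2 * real j \<le> s" "s \<le> 2 * real j + 1"
  shows "snake_az M s = az_max M * (if even j then s - 2 * real j else 1 - (s - 2 * real j))"
proof -
  have "(\<Sum>i<M. (-1) ^ i * clamp01 (s - (2 * real i + 0))) = (\<Sum>i<j. (-1) ^ i) + (-1) ^ j * (s - (2 * real j + 0))"
    by (rule sum_clamp01_rising) (use assms in auto)
  then show ?thesis by (simp add: snake_az_def sum_alternating)
qed

lemma snake_az_meridian:
  assumes "j < M - 1" "2 * real j + 1 \<le> s" "s \<le> 2 * real j + 2"
  shows "snake_az M s = az_max M * (if even j then 1 else 0)"
proof -
  have "(\<Sum>i<M. (-1) ^ i * clamp01 (s - (2 * real i + 0))) = (\<Sum>i<Suc j. (-1) ^ i)"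
    by (rule sum_clamp01_flat) (use assms in auto)
  then show ?thesis by (simp add: snake_az_def sum_alternating del: sum.lessThan_Suc)
qed

lemma azimuth_bounds: "0 < az_max M" "az_max M < 2 * pi"
  using M by (auto simp: field_simps)

lemma snake_on_grid:
  assumes "j < M" "k < M"
  shows "\<exists>s\<in>{0..2 * real M - 1}. snake M s = sph (fejer_node M j) (2 * pi * real k / real M)"
proof -
  \<comment> \<open>The arc ends at node \<open>M - 1\<close>, so node \<open>k\<close> sits at this
    fraction of it, counted from the other end on odd parallels.\<close>
  define r where "r = real k / (real M - 1)"
  have r: "0 \<le> r" "r \<le> 1" using assms M by (auto simp: r_def divide_le_eq_1)
  have j: "real j + 1 \<le> real M" using assms(1) by linarith
  define s where "s = 2 * real j + (if even j then r else 1 - r)"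
  have s: "2 * real j \<le> s" "s \<le> 2 * real j + 1" using r by (auto simp: s_def)
  have "snake_az M s = az_max M * r"
    using snake_az_circle[OF assms(1) s] by (simp add: s_def)
  also have "\<dots> = 2 * pi * real k / real M" using M by (simp add: r_def field_simps)
  finally show ?thesis
    using snake_colat_circle[OF assms(1) s] s j by (intro bexI[of _ s]) (auto simp: snake_def)
qed

lemma snake_segment:
  assumes "0 \<le> s" "s \<le> 2 * real M - 1"
  obtains j where "j < M" "2 * real j \<le> s" "s \<le> 2 * real j + 1"
    | j where "j < M - 1" "2 * real j + 1 < s" "s < 2 * real j + 2"
proof -
  define j where "j = nat \<lfloor>s / 2\<rfloor>"
  have j: "2 * real j \<le> s" "s < 2 * real j + 2"
    using assms(1) unfolding j_def by linarith+
  show ?thesis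
  proof (cases "s \<le> 2 * real j + 1")
    case True
    have "2 * real j < 2 * real M" using j assms by linarith
    then show ?thesis using that(1)[of j] True j by simp
  next
    case False
    have "real j + 1 < real M" using False assms by linarith
    then show ?thesis using that(2)[of j] False j M by simp
  qed
qed

lemma snake_colat_mono: "s \<le> s' \<Longrightarrow> snake_colat M s \<le> snake_colat M s'"
  unfolding snake_colat_def by (intro add_left_mono mult_left_mono sum_mono clamp01_mono) auto

lemma snake_colat_range:
  assumes "0 \<le> s" "s \<le> 2 * real M - 1"
  shows "0 < snake_colat M s" "snake_colat M s < pi"
proof -
  have "0 < fejer_node M 0" "fejer_node M (M - 1) < pi" using fejer_node_bounds[of 0 M] fejer_node_bounds[of "M - 1" M] M by auto
  moreover have "snake_colat M 0 = fejer_node M 0" by (rule snake_colat_circle) (use M in auto)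
  moreover have "snake_colat M (2 * real M - 1) = fejer_node M (M - 1)"
    by (rule snake_colat_circle) (use M in auto)
  ultimately show "0 < snake_colat M s" "snake_colat M s < pi"
    using snake_colat_mono[OF assms(1)] snake_colat_mono[OF assms(2)] by auto
qed

lemma snake_az_range:
  assumes "0 \<le> s" "s \<le> 2 * real M - 1"
  shows "0 \<le> snake_az M s \<and> snake_az M s < 2 * pi"
proof -
  have *: ?thesis if eq: "snake_az M s = az_max M * r" and r: "0 \<le> r" "r \<le> 1" for r
  proof -
    have "az_max M * r \<le> az_max M * 1"
      using azimuth_bounds(1) r by (intro mult_left_mono) auto
    moreover have "0 \<le> az_max M * r" using azimuth_bounds(1) r by (intro mult_nonneg_nonneg) auto
    ultimately show ?thesis using eq azimuth_bounds(2) by linarith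
  qed
  from assms show ?thesis
  proof (cases rule: snake_segment)
    case (1 j)
    then show ?thesis by (intro *[OF snake_az_circle[of j]]) auto
  next
    case (2 j)
    then show ?thesis by (intro *[OF snake_az_meridian[of j]]) auto
  qed
qed

lemma sph_inj:
  assumes eq: "sph \<theta> \<phi> = sph \<theta>' \<phi>'" and \<theta>: "0 < \<theta>" "\<theta> < pi" "0 < \<theta>'" "\<theta>' < pi"
    and \<phi>: "0 \<le> \<phi>" "\<phi> < 2 * pi" "0 \<le> \<phi>'" "\<phi>' < 2 * pi"
  shows "\<theta> = \<theta>' \<and> \<phi> = \<phi>'"
proof -
  have "cos \<theta> = cos \<theta>'" using arg_cong[OF eq, of "\<lambda>x. x $ 3"] by (simp add: sph_def)
  then have 1: "\<theta> = \<theta>'" using \<theta> by (metis cos_inj_pi less_imp_le)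
  have "sin \<theta> \<noteq> 0" using \<theta> sin_gt_zero[of \<theta>] by simp
  then have "cos \<phi> = cos \<phi>'" "sin \<phi> = sin \<phi>'"
    using arg_cong[OF eq, of "\<lambda>x. x $ 1"] arg_cong[OF eq, of "\<lambda>x. x $ 2"] 1 by (auto simp: sph_def)
  then have "cos (\<phi> - \<phi>') = 1" using sin_cos_squared_add2[of \<phi>] by (simp add: cos_diff power2_eq_square)
  then obtain i :: int where i: "\<phi> - \<phi>' = of_int i * 2 * pi" using cos_one_2pi_int by blast
  have "i = 0"
  proof (rule ccontr)
    assume "i \<noteq> 0"
    then have "1 \<le> \<bar>real_of_int i\<bar>" by linarith
    then have "1 * (2 * pi) \<le> \<bar>real_of_int i\<bar> * (2 * pi)" by (intro mult_right_mono) auto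
    also have "\<dots> = \<bar>\<phi> - \<phi>'\<bar>" by (simp add: i abs_mult)
    finally show False using \<phi> by (auto simp: abs_le_iff)
  qed
  then show ?thesis using 1 i by simp
qed

text \<open>The colatitude never decreases and grows strictly along the meridian pieces, so two
  parameters with equal colatitude belong to the same parallel. There the azimuth is strictly
  monotone and covers less than a full turn.\<close>

lemma snake_inj: "inj_on (snake M) {0..2 * real M - 1}"
proof (rule linorder_inj_onI')
  fix s s' assume s: "s \<in> {0..2 * real M - 1}" "s' \<in> {0..2 * real M - 1}" "s < s'"
  show "snake M s \<noteq> snake M s'"
  proof
    assume "snake M s = snake M s'"
    then have eq: "snake_colat M s = snake_colat M s'" "snake_az M s = snake_az M s'"
      using sph_inj snake_colat_range[of s] snake_colat_range[of s'] snake_az_range[of s] snake_az_range[of s'] s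
      unfolding snake_def by (metis atLeastAtMost_iff)+
    have s0: "0 \<le> s" "s \<le> 2 * real M - 1" using s by auto
    then show False
    proof (cases rule: snake_segment)
      case (1 j)
      show False
      proof (cases "s' \<le> 2 * real j + 1")
        case True
        then have "(if even j then s - 2 * real j else 1 - (s - 2 * real j)) = (if even j then s' - 2 * real j else 1 - (s' - 2 * real j))"
          using snake_az_circle[of j s] snake_az_circle[of j s'] 1 s eq(2) azimuth_bounds(1) M by auto
        then show False using \<open>s < s'\<close> by (auto split: if_splits)
      next
        case False
        \<comment> \<open>A parameter on the meridian piece after parallel \<open>j\<close> and not
          beyond \<open>s'\<close>; the colatitude has already grown there.\<close>
        define x where "x = min s' (2 * real j + 2)"
        have "real j + 1 < real M" using False s by auto
        then have j: "j < M - 1" by simp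
        have "snake_colat M x = fejer_node M j + pi / real M * (x - (2 * real j + 1))"
          by (rule snake_colat_meridian[OF j]) (use False in \<open>auto simp: x_def\<close>)
        moreover have "0 < pi / real M * (x - (2 * real j + 1))"
          using False M0 by (intro mult_pos_pos) (auto simp: x_def)
        moreover have "snake_colat M x \<le> snake_colat M s'" by (rule snake_colat_mono) (simp add: x_def)
        ultimately show False using snake_colat_circle[of j s] 1 eq(1) by simp
      qed
    next
      case (2 j)
      define x where "x = min s' (2 * real j + 2)"
      have x: "s < x" "x \<le> 2 * real j + 2" using 2 \<open>s < s'\<close> by (auto simp: x_def)
      have "snake_colat M s < snake_colat M x"
        using snake_colat_meridian[of j s] snake_colat_meridian[of j x] 2 x M0 by (simp add: divide_strict_right_mono mult_strict_left_mono)
      also have "\<dots> \<le> snake_colat M s'" by (rule snake_colat_mono) (simp add: x_def)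
      finally show False using eq(1) by simp
    qed
  qed
qed

text \<open>All meridian pieces lie on just two meridians, at the azimuths 0 and
  \<open>az_max M\<close>, and do not overlap. Together they cost at most two whole meridians, that
  is 4 unweighted integrals however large \<open>M\<close> is. The parallels, through
  \<open>sum_circles_le\<close>, contribute 2 further unweighted integrals and the term with the
  weighted one.\<close>

lemma snake_variation:
  fixes p :: "real poly"
  assumes \<theta>': "0 \<le> \<theta>'" "\<theta>' \<le> pi" and \<phi>': "0 \<le> \<phi>'" "\<phi>' \<le> 2 * pi"
  shows "variation_le (\<lambda>s. poly p ((1 - snake M s \<bullet> sph \<theta>' \<phi>') / 2)) 0 (2 * real M - 1)
    (6 * variation_integral p
     + 4 * real M * weighted_variation_integral p)"
proof -
  define G where "G x = integral {0..x} (\<lambda>x. \<bar>poly (pderiv p) x\<bar>)" for x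
  have kG: "\<bar>poly p y - poly p x\<bar> \<le> G y - G x" if "0 \<le> x" "x \<le> y" "y \<le> 1" for x y
  proof -
    have int: "(\<lambda>x. \<bar>poly (pderiv p) x\<bar>) integrable_on {a..b}" for a b
      by (intro integrable_continuous_real continuous_intros)
    have int': "poly (pderiv p) integrable_on {x..y}"
      by (intro integrable_continuous_real continuous_intros)
    have "(poly (pderiv p) has_integral (poly p y - poly p x)) {x..y}"
      by (rule fundamental_theorem_of_calculus)
         (use that in \<open>auto simp: has_real_derivative_iff_has_vector_derivative[symmetric] intro: poly_DERIV DERIV_subset\<close>)
    then have "poly p y - poly p x = integral {x..y} (poly (pderiv p))" by (simp add: integral_unique)
    also have "\<bar>\<dots>\<bar> \<le> integral {x..y} (\<lambda>x. \<bar>poly (pderiv p) x\<bar>)"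
      using integral_norm_bound_integral[of "poly (pderiv p)" "{x..y}" "\<lambda>x. \<bar>poly (pderiv p) x\<bar>"] int int'
      by auto
    also have "\<dots> = G y - G x"
      unfolding G_def
      using Henstock_Kurzweil_Integration.integral_combine[OF that(1,2) int] by simp
    finally show ?thesis .
  qed
  let ?g = "\<lambda>\<theta> \<phi>. poly p ((1 - sph \<theta> \<phi> \<bullet> sph \<theta>' \<phi>') / 2)"
  let ?\<Phi> = "az_max M"
  define a b where "a j = (1 - cos (fejer_node M j - \<theta>')) / 2" and "b j = (1 - cos (fejer_node M j + \<theta>')) / 2" for j
  have mer: "variation_le (\<lambda>\<theta>. ?g \<theta> \<phi>) 0 pi (2 * (G 1 - G 0))" for \<phi>
  proof -
    have eq: "cos \<theta>' * cos \<theta> + (sin \<theta>' * cos (\<phi> - \<phi>')) * sin \<theta> = sph \<theta> \<phi> \<bullet> sph \<theta>' \<phi>'" for \<theta>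
      by (simp add: inner_sph mult_ac)
    have "\<bar>sph \<theta> \<phi> \<bullet> sph \<theta>' \<phi>'\<bar> \<le> 1" for \<theta>
      using Cauchy_Schwarz_ineq2[of "sph \<theta> \<phi>" "sph \<theta>' \<phi>'"] by (simp add: norm_sph)
    then show ?thesis
      using variation_le_meridian[where k = "poly p" and G = G and A = "cos \<theta>'" and B = "sin \<theta>' * cos (\<phi> - \<phi>')", OF kG] unfolding eq by blast
  qed
  obtain V where V: "\<And>\<phi> x y. 0 \<le> x \<Longrightarrow> x \<le> y \<Longrightarrow> y \<le> pi \<Longrightarrow> \<bar>?g y \<phi> - ?g x \<phi>\<bar> \<le> V \<phi> y - V \<phi> x"
    "\<And>\<phi>. V \<phi> pi - V \<phi> 0 \<le> 2 * (G 1 - G 0)"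
    using mer unfolding variation_le_def by metis
  have Vmono: "V \<phi> x \<le> V \<phi> y" if "0 \<le> x" "x \<le> y" "y \<le> pi" for \<phi> x y
    using order_trans[OF abs_ge_zero V(1)[OF that, of \<phi>]] by simp
  \<comment> \<open>Adding the majorants of both meridians gives one majorant for all links, whose
    increments telescope over the successive parallels.\<close>
  define U where "U \<theta> = V 0 \<theta> + V ?\<Phi> \<theta>" for \<theta>
  define v where "v i = (if even i then 2 * (G (b (i div 2)) - G (a (i div 2)))
    else U (fejer_node M (Suc (i div 2))) - U (fejer_node M (i div 2)))" for i
  have circ: "variation_le (\<lambda>\<phi>. ?g (fejer_node M j) \<phi>) 0 (2 * pi) (2 * (G (b j) - G (a j)))" if j: "j < M" for j
  proof -
    let ?\<theta> = "fejer_node M j"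
    define A B where "A = (1 - cos ?\<theta> * cos \<theta>') / 2" and "B = sin ?\<theta> * sin \<theta>' / 2"
    have "0 \<le> sin ?\<theta> * sin \<theta>'"
      using fejer_node_bounds[OF j] \<theta>' by (intro mult_nonneg_nonneg sin_ge_zero) auto
    then have "0 \<le> B" by (simp add: B_def)
    moreover have AB: "A - B = a j" "A + B = b j"
      by (simp_all add: A_def B_def a_def b_def cos_add cos_diff field_simps)
    moreover have "0 \<le> a j" "b j \<le> 1" by (simp_all add: a_def b_def)
    ultimately have "variation_le (\<lambda>\<phi>. poly p (A - B * cos (\<phi> - \<phi>'))) 0 (2 * pi) (2 * (G (b j) - G (a j)))"
      using variation_le_circle[where k = "poly p" and G = G and B = B and A = A and \<phi>' = \<phi>', OF kG] \<phi>' by simp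
    moreover have "(1 - sph ?\<theta> \<phi> \<bullet> sph \<theta>' \<phi>') / 2 = A - B * cos (\<phi> - \<phi>')" for \<phi>
      by (simp add: inner_sph A_def B_def field_simps)
    ultimately show ?thesis by (simp only:)
  qed
  have pieces: "variation_le (\<lambda>s. poly p ((1 - snake M s \<bullet> sph \<theta>' \<phi>') / 2)) (real i) (real (Suc i)) (v i)"
    if i: "i < 2 * M - 1" for i
  proof (cases "even i")
    case True
    define j where "j = i div 2"
    have j: "j < M" and ij: "real i = 2 * real j" using True i by (auto simp: j_def)
    have az: "snake_az M s = ?\<Phi> * (if even j then s - 2 * real j else 1 - (s - 2 * real j))"
      if "real i \<le> s" "s \<le> real (Suc i)" for s
      by (rule snake_az_circle[OF j]) (use that ij in auto)
    have "variation_le (\<lambda>s. ?g (fejer_node M j) (snake_az M s)) (real i) (real (Suc i)) (2 * (G (b j) - G (a j)))"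
    proof (cases "even j")
      case True
      show ?thesis
      proof (rule variation_le_comp_mono[OF circ[OF j]])
        show "snake_az M x \<le> snake_az M y" if "real i \<le> x" "x \<le> y" "y \<le> real (Suc i)" for x y
        proof -
          have "?\<Phi> * (x - 2 * real j) \<le> ?\<Phi> * (y - 2 * real j)"
            by (rule mult_left_mono) (use that azimuth_bounds(1) in auto)
          then show ?thesis using az[of x] az[of y] that True by auto
        qed
      qed (use az[of "real i"] az[of "real (Suc i)"] ij True azimuth_bounds in auto)
    next
      case False
      show ?thesis
      proof (rule variation_le_comp_antimono[OF circ[OF j]])
        show "snake_az M y \<le> snake_az M x" if "real i \<le> x" "x \<le> y" "y \<le> real (Suc i)" for x y
        proof -
          have "?\<Phi> * (1 - (y - 2 * real j)) \<le> ?\<Phi> * (1 - (x - 2 * real j))"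
            by (rule mult_left_mono) (use that azimuth_bounds(1) in auto)
          then show ?thesis using az[of x] az[of y] that False by auto
        qed
      qed (use az[of "real i"] az[of "real (Suc i)"] ij False azimuth_bounds in auto)
    qed
    moreover have "v i = 2 * (G (b j) - G (a j))" using True by (simp add: v_def j_def)
    ultimately have "variation_le (\<lambda>s. ?g (fejer_node M j) (snake_az M s)) (real i) (real (Suc i)) (v i)" by simp
    then show ?thesis
      by (rule variation_le_cong) (use snake_colat_circle[OF j] ij in \<open>auto simp: snake_def\<close>)
  next
    case False
    define j where "j = i div 2"
    have "i = 2 * j + 1" using False by (simp add: j_def)
    then have j: "j < M - 1" and ij: "real i = 2 * real j + 1" using i by auto
    define \<phi> where "\<phi> = (if even j then ?\<Phi> else 0)"
    have az: "snake_az M s = \<phi>" if "real i \<le> s" "s \<le> real (Suc i)" for s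
      using snake_az_meridian[OF j, of s] that ij by (auto simp: \<phi>_def)
    have ends: "snake_colat M (real i) = fejer_node M j" "snake_colat M (real (Suc i)) = fejer_node M (Suc j)"
      using snake_colat_circle[of j "real i"] snake_colat_circle[of "Suc j" "real (Suc i)"] j ij by auto
    have rng: "0 \<le> snake_colat M s" "snake_colat M s \<le> pi" if "real i \<le> s" "s \<le> real (Suc i)" for s
    proof -
      have "real (Suc i) \<le> 2 * real M - 1" using i by linarith
      moreover have "0 \<le> s" using that(1) by (meson of_nat_0_le_iff order_trans)
      ultimately show "0 \<le> snake_colat M s" "snake_colat M s \<le> pi"
        using snake_colat_range[of s] that by auto
    qed
    have "variation_le (\<lambda>s. ?g (snake_colat M s) \<phi>) (real i) (real (Suc i)) (v i)"
    proof (rule variation_leI[of _ _ _ "\<lambda>s. U (snake_colat M s)"])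
      fix x y assume xy: "real i \<le> x" "x \<le> y" "y \<le> real (Suc i)"
      have c: "0 \<le> snake_colat M x" "snake_colat M x \<le> snake_colat M y" "snake_colat M y \<le> pi"
        using rng[of x] rng[of y] xy snake_colat_mono[of x y] by auto
      have "\<bar>?g (snake_colat M y) \<phi> - ?g (snake_colat M x) \<phi>\<bar> \<le> V \<phi> (snake_colat M y) - V \<phi> (snake_colat M x)"
        by (rule V(1)[OF c])
      also have "\<dots> \<le> U (snake_colat M y) - U (snake_colat M x)"
        using Vmono[OF c, of 0] Vmono[OF c, of ?\<Phi>] by (auto simp: U_def \<phi>_def)
      finally show "\<bar>?g (snake_colat M y) \<phi> - ?g (snake_colat M x) \<phi>\<bar> \<le> U (snake_colat M y) - U (snake_colat M x)" .
    next
      show "U (snake_colat M (real (Suc i))) - U (snake_colat M (real i)) \<le> v i"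
        using False ends by (simp add: v_def j_def)
    qed
    then show ?thesis
      by (rule variation_le_cong) (simp add: snake_def az)
  qed
  have "variation_le (\<lambda>s. poly p ((1 - snake M s \<bullet> sph \<theta>' \<phi>') / 2)) 0 (real (2 * M - 1)) (\<Sum>i<2 * M - 1. v i)"
    by (rule variation_le_pieces[OF pieces])
  \<comment> \<open>Even pieces are the \<open>M\<close> parallels, odd ones the
    \<open>M - 1\<close> links between them.\<close>
  moreover have "(\<Sum>i<2 * m + 1. v i) = (\<Sum>j<Suc m. v (2 * j)) + (\<Sum>j<m. v (2 * j + 1))" for m
    by (induction m) simp_all
  from this[of "M - 1"] have "(\<Sum>i<2 * M - 1. v i) = (\<Sum>j<M. v (2 * j)) + (\<Sum>j<M - 1. v (2 * j + 1))"
    using M by (simp add: numeral_2_eq_2 Suc_diff_Suc)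
  moreover have "(\<Sum>j<M. v (2 * j)) \<le> 2 * (variation_integral p
     + 2 * real M * weighted_variation_integral p)"
  proof -
    have "(\<Sum>j<M. v (2 * j)) = 2 * (\<Sum>j<M. G (b j) - G (a j))"
      by (simp add: v_def sum_distrib_left)
    also have "\<dots> \<le> 2 * (variation_integral p
     + 2 * real M * weighted_variation_integral p)"
      unfolding G_def a_def b_def
      by (intro mult_left_mono sum_circles_le) (use M \<theta>' in \<open>auto intro!: continuous_intros\<close>)
    finally show ?thesis .
  qed
  moreover have "(\<Sum>j<M - 1. v (2 * j + 1)) \<le> 4 * variation_integral p"
  proof -
    have "(\<Sum>j<M - 1. v (2 * j + 1)) = (\<Sum>j<M - 1. U (fejer_node M (Suc j)) - U (fejer_node M j))"
      by (simp add: v_def)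
    also have "\<dots> = U (fejer_node M (M - 1)) - U (fejer_node M 0)"
      by (rule sum_lessThan_telescope)
    also have "\<dots> \<le> U pi - U 0"
    proof -
      have "U (fejer_node M (M - 1)) \<le> U pi" "U 0 \<le> U (fejer_node M 0)"
        unfolding U_def using fejer_node_bounds[of 0 M] fejer_node_bounds[of "M - 1" M] M by (intro add_mono Vmono; simp)+
      then show ?thesis by simp
    qed
    also have "\<dots> \<le> 4 * (G 1 - G 0)" using V(2)[of 0] V(2)[of ?\<Phi>] by (simp add: U_def)
    finally show ?thesis by (simp add: G_def)
  qed
  ultimately have "variation_le (\<lambda>s. poly p ((1 - snake M s \<bullet> sph \<theta>' \<phi>') / 2)) 0 (real (2 * M - 1))
    (6 * variation_integral p
     + 4 * real M * weighted_variation_integral p)"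
    by (elim variation_le_mono) simp
  moreover have "real (2 * M - 1) = 2 * real M - 1" using M by (simp add: of_nat_diff)
  ultimately show ?thesis by simp
qed

end

section \<open>Polynomials on the sphere\<close>

definition sphere_coord :: "real ^ 3 \<Rightarrow> complex" where
  "sphere_coord x = Complex (x $ 1) (x $ 2)"

text \<open>Polynomials are spanned by monomials in \<open>x1 + i x2\<close>, its conjugate and
  \<open>x3\<close>, because rotations about the third axis multiply each of these by a character.
  Real polynomials enter as complex-valued functions and are recovered by \<open>Re\<close>.\<close>

inductive polyfun :: "nat \<Rightarrow> (real ^ 3 \<Rightarrow> complex) \<Rightarrow> bool" where
  monomial: "a + b + k \<le> d \<Longrightarrow> polyfun d (\<lambda>x. c * sphere_coord x ^ a * cnj (sphere_coord x) ^ b * of_real (x $ 3) ^ k)"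
| add: "polyfun d f \<Longrightarrow> polyfun d g \<Longrightarrow> polyfun d (\<lambda>x. f x + g x)"

lemma polyfun_mono: "polyfun d f \<Longrightarrow> d \<le> e \<Longrightarrow> polyfun e f"
  by (induction rule: polyfun.induct) (auto intro: polyfun.intros)

lemma polyfun_const: "polyfun d (\<lambda>x. c)"
  using polyfun.monomial[of 0 0 0 d c] by simp

lemma polyfun_mult:
  assumes "polyfun d f" "polyfun e g"
  shows "polyfun (d + e) (\<lambda>x. f x * g x)"
  using assms(1)
proof (induction rule: polyfun.induct)
  case (monomial a b k d c)
  note abk = monomial
  from assms(2) show ?case
  proof (induction rule: polyfun.induct)
    case (monomial a' b' k' e c')
    have "polyfun (d + e) (\<lambda>x. (c * c') * sphere_coord x ^ (a + a') * cnj (sphere_coord x) ^ (b + b') * of_real (x $ 3) ^ (k + k'))"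
      by (rule polyfun.monomial) (use abk monomial in simp)
    then show ?case by (simp add: power_add mult_ac)
  next
    case (add e f g)
    then show ?case using polyfun.add by (fastforce simp: distrib_left)
  qed
next
  case (add d f g)
  then show ?case using polyfun.add by (fastforce simp: distrib_right)
qed

lemma polyfun_power: "polyfun d f \<Longrightarrow> polyfun (k * d) (\<lambda>x. f x ^ k)"
proof (induction k)
  case 0 show ?case by (simp add: polyfun_const)
next
  case (Suc k) then show ?case using polyfun_mult[of d f "k * d" "\<lambda>x. f x ^ k"] by simp
qed

lemma polyfun_cmult: "polyfun d f \<Longrightarrow> polyfun d (\<lambda>x. c * f x)"
  using polyfun_mult[OF polyfun_const[of 0]] by simp

lemma polyfun_sum:
  assumes "\<And>i. i \<in> A \<Longrightarrow> polyfun d (f i)"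
  shows "polyfun d (\<lambda>x. \<Sum>i\<in>A. f i x)"
  using assms by (induction A rule: infinite_finite_induct) (auto intro: polyfun_const polyfun.add)

lemma polyfun_coords:
  "polyfun 1 (\<lambda>x. of_real (x $ 1))" "polyfun 1 (\<lambda>x. of_real (x $ 2))" "polyfun 1 (\<lambda>x. of_real (x $ 3))"
proof -
  have "polyfun 1 (\<lambda>x. (1/2) * sphere_coord x ^ 1 * cnj (sphere_coord x) ^ 0 * of_real (x $ 3) ^ 0
      + (1/2) * sphere_coord x ^ 0 * cnj (sphere_coord x) ^ 1 * of_real (x $ 3) ^ 0)"
    by (intro polyfun.intros) auto
  moreover have "(\<lambda>x. (1/2) * sphere_coord x ^ 1 * cnj (sphere_coord x) ^ 0 * of_real (x $ 3) ^ 0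
      + (1/2) * sphere_coord x ^ 0 * cnj (sphere_coord x) ^ 1 * of_real (x $ 3) ^ 0) = (\<lambda>x. of_real (x $ 1))"
    by (auto simp: sphere_coord_def complex_eq_iff fun_eq_iff)
  ultimately show "polyfun 1 (\<lambda>x. of_real (x $ 1))" by simp
  have "polyfun 1 (\<lambda>x. (-\<i>/2) * sphere_coord x ^ 1 * cnj (sphere_coord x) ^ 0 * of_real (x $ 3) ^ 0
      + (\<i>/2) * sphere_coord x ^ 0 * cnj (sphere_coord x) ^ 1 * of_real (x $ 3) ^ 0)"
    by (intro polyfun.intros) auto
  moreover have "(\<lambda>x. (-\<i>/2) * sphere_coord x ^ 1 * cnj (sphere_coord x) ^ 0 * of_real (x $ 3) ^ 0
      + (\<i>/2) * sphere_coord x ^ 0 * cnj (sphere_coord x) ^ 1 * of_real (x $ 3) ^ 0) = (\<lambda>x. of_real (x $ 2))"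
    by (auto simp: sphere_coord_def complex_eq_iff fun_eq_iff)
  ultimately show "polyfun 1 (\<lambda>x. of_real (x $ 2))" by simp
  show "polyfun 1 (\<lambda>x. of_real (x $ 3))"
    using polyfun.monomial[of 0 0 1 1 1] by simp
qed

lemma polyfun_inner: "polyfun 1 (\<lambda>x. of_real (v \<bullet> x))"
proof -
  have "polyfun 1 (\<lambda>x. of_real (v $ 1) * of_real (x $ 1) + of_real (v $ 2) * of_real (x $ 2) + of_real (v $ 3) * of_real (x $ 3))"
    by (intro polyfun.add polyfun_cmult polyfun_coords)
  then show ?thesis by (simp add: inner_vec_def sum_3)
qed

text \<open>Through the adjoint, the coordinates of \<open>T x\<close> are inner products with fixed
  vectors, so the substitution does not raise the degree.\<close>

lemma polyfun_orthogonal: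
  assumes "polyfun d f" "orthogonal_transformation T"
  shows "polyfun d (\<lambda>x. f (T x))"
  using assms(1)
proof (induction rule: polyfun.induct)
  case (monomial a b k d c)
  have lin: "polyfun 1 (\<lambda>x. of_real (T x $ i))" for i
  proof -
    have "T x $ i = adjoint T (axis i 1) \<bullet> x" for x
      using adjoint_works[OF orthogonal_transformation_linear[OF assms(2)], of x "axis i 1"]
      by (simp add: inner_axis inner_commute[of x])
    then show ?thesis using polyfun_inner by simp
  qed
  have "sphere_coord (T x) = of_real (T x $ 1) + \<i> * of_real (T x $ 2)" for x
    by (simp add: sphere_coord_def complex_eq_iff)
  moreover have "cnj (sphere_coord (T x)) = of_real (T x $ 1) + (-\<i>) * of_real (T x $ 2)" for x
    by (simp add: sphere_coord_def complex_eq_iff)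
  moreover have "polyfun (0 + a * 1 + b * 1 + k * 1) (\<lambda>x. c * (of_real (T x $ 1) + \<i> * of_real (T x $ 2)) ^ a
      * (of_real (T x $ 1) + (-\<i>) * of_real (T x $ 2)) ^ b * of_real (T x $ 3) ^ k)"
    by (intro polyfun_mult polyfun_power polyfun_const polyfun.add polyfun_cmult lin)
  ultimately show ?case using monomial by (simp add: polyfun_mono)
next
  case (add d f g)
  then show ?case by (intro polyfun.add)
qed

lemma continuous_polyfun: "polyfun d f \<Longrightarrow> continuous_on UNIV f"
  by (induction rule: polyfun.induct) (auto simp: sphere_coord_def Complex_eq intro!: continuous_intros)

lemma polyfun_poly:
  fixes p :: "real poly"
  assumes f: "polyfun 1 (\<lambda>x. of_real (f x))"
  shows "polyfun (degree p) (\<lambda>x. of_real (poly p (f x)))"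
proof -
  have "polyfun (degree p) (\<lambda>x. of_real (coeff p i) * of_real (f x) ^ i)" if "i \<le> degree p" for i
    using polyfun_mono[OF polyfun_cmult[OF polyfun_power[OF f, of i]], of "degree p"] that by simp
  then have "polyfun (degree p) (\<lambda>x. \<Sum>i\<le>degree p. of_real (coeff p i) * of_real (f x) ^ i)"
    by (intro polyfun_sum) auto
  then show ?thesis by (simp add: poly_altdef)
qed

section \<open>Integration against the normalized surface measure\<close>

lemma integrable_sphere_measure:
  fixes f :: "real ^ 3 \<Rightarrow> real"
  assumes cont: "continuous_on UNIV f"
  shows "integrable sphere_measure f"
proof -
  have m: "f \<in> borel_measurable sphere_measure"
    using cont by (simp add: borel_measurable_continuous_onI cong: measurable_cong_sets)
  have "bounded (f ` sphere 0 1)"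
    by (intro compact_imp_bounded compact_continuous_image continuous_on_subset[OF cont]) auto
  then obtain B where "\<And>x. x \<in> sphere 0 1 \<Longrightarrow> norm (f x) \<le> B"
    unfolding bounded_iff by blast
  then have "AE x in sphere_measure. norm (f x) \<le> B"
    using AE_sphere_measure by (auto elim!: eventually_mono)
  then show ?thesis
    using finite_measure.integrable_const_bound[OF finite_measure_sphere_measure _ m] by blast
qed

lemma integral_sphere_cong:
  fixes f g :: "real ^ 3 \<Rightarrow> real"
  assumes "continuous_on UNIV f" "continuous_on UNIV g"
    and "\<And>x. norm x = 1 \<Longrightarrow> f x = g x"
  shows "(\<integral>x. f x \<partial>sphere_measure) = (\<integral>x. g x \<partial>sphere_measure)"
proof (rule integral_cong_AE)
  show "f \<in> borel_measurable sphere_measure" "g \<in> borel_measurable sphere_measure"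
    using assms by (simp_all add: borel_measurable_continuous_onI cong: measurable_cong_sets)
  show "AE x in sphere_measure. f x = g x"
    using AE_sphere_measure by eventually_elim (use assms(3) in auto)
qed

lemma measure_sphere_measure_UNIV [simp]: "measure sphere_measure UNIV = 1"
  using emeasure_sphere_measure_UNIV by (simp add: measure_def)

lemma integral_sphere_orthogonal:
  fixes f :: "real ^ 3 \<Rightarrow> real"
  assumes T: "orthogonal_transformation T" and f: "continuous_on UNIV f"
  shows "(\<integral>x. f (T x) \<partial>sphere_measure) = (\<integral>x. f x \<partial>sphere_measure)"
proof -
  have "T \<in> borel_measurable borel"
    using orthogonal_transformation_linear[OF T]
    by (intro borel_measurable_continuous_onI linear_continuous_on linear_conv_bounded_linear[THEN iffD1])
  then have "(\<integral>x. f x \<partial>distr sphere_measure borel T) = (\<integral>x. f (T x) \<partial>sphere_measure)"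
    using borel_measurable_continuous_onI[OF f]
    by (intro integral_distr) (auto cong: measurable_cong_sets)
  then show ?thesis using sphere_measure_orthogonal[OF T] by simp
qed

section \<open>Averages over rotations about the third axis\<close>

definition rotz :: "real \<Rightarrow> real ^ 3 \<Rightarrow> real ^ 3" where
  "rotz \<alpha> x = vector [cos \<alpha> * x $ 1 - sin \<alpha> * x $ 2, sin \<alpha> * x $ 1 + cos \<alpha> * x $ 2, x $ 3]"

lemma rotz_coords [simp]:
  "rotz \<alpha> x $ 1 = cos \<alpha> * x $ 1 - sin \<alpha> * x $ 2"
  "rotz \<alpha> x $ 2 = sin \<alpha> * x $ 1 + cos \<alpha> * x $ 2"
  "rotz \<alpha> x $ 3 = x $ 3"
  by (simp_all add: rotz_def)

lemma norm_vec3_sq: "(norm (x :: real ^ 3))\<^sup>2 = (x $ 1)\<^sup>2 + (x $ 2)\<^sup>2 + (x $ 3)\<^sup>2"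
  unfolding power2_norm_eq_inner inner_vec_def sum_3 by (simp add: power2_eq_square)

lemma sphere_coord_rotz: "sphere_coord (rotz \<alpha> x) = cis \<alpha> * sphere_coord x"
  by (simp add: sphere_coord_def complex_eq_iff algebra_simps)

lemma orthogonal_transformation_rotz: "orthogonal_transformation (rotz \<alpha>)"
  unfolding orthogonal_transformation
proof (intro conjI allI)
  show "linear (rotz \<alpha>)"
    by (rule linearI) (simp_all add: vec_eq_iff forall_3 algebra_simps)
  fix v
  have "(norm (rotz \<alpha> v))\<^sup>2 = ((cos \<alpha>)\<^sup>2 + (sin \<alpha>)\<^sup>2) * ((v $ 1)\<^sup>2 + (v $ 2)\<^sup>2) + (v $ 3)\<^sup>2"
    by (simp only: norm_vec3_sq rotz_coords) algebra
  also have "\<dots> = (norm v)\<^sup>2"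
    by (simp add: norm_vec3_sq)
  finally show "norm (rotz \<alpha> v) = norm v" by simp
qed

lemma sum_cis_eq_0:
  fixes j :: int
  assumes j: "j \<noteq> 0" "\<bar>j\<bar> < int m"
  shows "(\<Sum>k<m. cis (2 * pi * real k / real m * of_int j)) = 0"
proof -
  define \<omega> where "\<omega> = cis (2 * pi * of_int j / real m)"
  have m: "0 < m" using j by linarith
  have "\<omega> \<noteq> 1"
  proof
    assume "\<omega> = 1"
    then have "cos (2 * pi * of_int j / real m) = 1" by (auto simp: \<omega>_def complex_eq_iff)
    then obtain i :: int where "2 * pi * of_int j / real m = of_int i * 2 * pi"
      using cos_one_2pi_int by blast
    then have "real_of_int j = of_int i * real m" using m by (simp add: field_simps)
    then have "j = i * int m" by (metis of_int_eq_iff of_int_mult of_int_of_nat_eq)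
    then have "\<bar>j\<bar> = \<bar>i\<bar> * int m" by (simp add: abs_mult)
    moreover have "1 \<le> \<bar>i\<bar>" using \<open>j = i * int m\<close> j by auto
    ultimately show False using j m mult_right_mono[of 1 "\<bar>i\<bar>" "int m"] by simp
  qed
  have "\<omega> ^ m = cis (2 * pi * of_int j)" using m by (simp add: \<omega>_def Complex.DeMoivre)
  also have "\<dots> = 1" by (rule cis_multiple_2pi) simp
  finally have "\<omega> ^ m = 1" .
  have "(\<Sum>k<m. cis (2 * pi * real k / real m * of_int j)) = (\<Sum>k<m. \<omega> ^ k)"
    by (simp add: \<omega>_def Complex.DeMoivre mult_ac)
  also have "\<dots> = 0" using geometric_sum[OF \<open>\<omega> \<noteq> 1\<close>, of m] \<open>\<omega> ^ m = 1\<close> by simp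
  finally show ?thesis .
qed

abbreviation zonal_mean :: "nat \<Rightarrow> (real ^ 3 \<Rightarrow> complex) \<Rightarrow> real ^ 3 \<Rightarrow> real" where
  "zonal_mean m f x \<equiv> (\<Sum>k<m. Re (f (rotz (2 * pi * real k / real m) x))) / real m"

text \<open>A monomial with exponents \<open>a\<close> and \<open>b\<close> is multiplied by the
  character of frequency \<open>a - b\<close>. As \<open>\<bar>a - b\<bar> \<le> d < m\<close>, the
  \<open>m\<close> rotations annihilate it unless \<open>a = b\<close>, and then its horizontal part
  is a power of \<open>1 - (x $ 3)\<^sup>2\<close> on the sphere.\<close>

lemma zonal_average:
  assumes "polyfun d f" "d < m"
  shows "\<exists>p :: real poly. degree p \<le> d \<and>
    (\<forall>x. norm x = 1 \<longrightarrow> zonal_mean m f x = poly p (x $ 3))"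
  using assms
proof (induction rule: polyfun.induct)
  case (monomial a b k d c)
  let ?\<phi> = "\<lambda>l. 2 * pi * real l / real m"
  have m: "0 < m" using monomial by simp
  have eq: "sphere_coord (rotz (?\<phi> l) x) ^ a * cnj (sphere_coord (rotz (?\<phi> l) x)) ^ b
      = cis (?\<phi> l * of_int (int a - int b)) * (sphere_coord x ^ a * cnj (sphere_coord x) ^ b)" for l x
  proof -
    have "cis (?\<phi> l) ^ a * cis (- ?\<phi> l) ^ b = cis (real a * ?\<phi> l + real b * (- ?\<phi> l))"
      by (simp only: Complex.DeMoivre cis_mult)
    also have "real a * ?\<phi> l + real b * (- ?\<phi> l) = ?\<phi> l * of_int (int a - int b)"
      by (simp add: algebra_simps diff_divide_distrib)
    finally show ?thesis
      by (simp add: sphere_coord_rotz power_mult_distrib cis_cnj mult_ac)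
  qed
  have sum: "(\<Sum>l<m. Re (c * sphere_coord (rotz (?\<phi> l) x) ^ a * cnj (sphere_coord (rotz (?\<phi> l) x)) ^ b
        * of_real (rotz (?\<phi> l) x $ 3) ^ k))
      = Re (c * (\<Sum>l<m. cis (?\<phi> l * of_int (int a - int b))) * (sphere_coord x ^ a * cnj (sphere_coord x) ^ b)
        * of_real (x $ 3) ^ k)" for x
  proof -
    have "c * sphere_coord (rotz (?\<phi> l) x) ^ a * cnj (sphere_coord (rotz (?\<phi> l) x)) ^ b * of_real (rotz (?\<phi> l) x $ 3) ^ k
      = c * cis (?\<phi> l * of_int (int a - int b)) * (sphere_coord x ^ a * cnj (sphere_coord x) ^ b) * of_real (x $ 3) ^ k" for l
      using eq[of l x] by (simp add: mult.assoc)
    then show ?thesis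
      by (simp only: sum_distrib_left sum_distrib_right Re_sum)
  qed
  show ?case
  proof (cases "a = b")
    case False
    then have "(\<Sum>l<m. cis (?\<phi> l * of_int (int a - int b))) = 0"
      by (intro sum_cis_eq_0) (use monomial in auto)
    then show ?thesis by (intro exI[of _ 0]) (simp only: sum, simp)
  next
    case True
    define p where "p = smult (Re c) ([:1, 0, -1:] ^ a * [:0, 1:] ^ k)"
    have "degree p \<le> d"
    proof -
      have "degree p \<le> degree ([:1, 0, -1 :: real:] ^ a) + degree ([:0, 1 :: real:] ^ k)"
        unfolding p_def by (rule order.trans[OF degree_smult_le degree_mult_le])
      also have "\<dots> \<le> 2 * a + 1 * k"
        by (intro add_mono order.trans[OF degree_power_le]) simp_all
      finally show ?thesis using monomial True by simp
    qed
    moreover have "(\<Sum>l<m. Re (c * sphere_coord (rotz (?\<phi> l) x) ^ a * cnj (sphere_coord (rotz (?\<phi> l) x)) ^ b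
        * of_real (rotz (?\<phi> l) x $ 3) ^ k)) / real m = poly p (x $ 3)" if "norm x = 1" for x
    proof -
      have "sphere_coord x * cnj (sphere_coord x) = of_real ((x $ 1)\<^sup>2 + (x $ 2)\<^sup>2)"
        by (simp add: sphere_coord_def complex_eq_iff power2_eq_square)
      also have "(x $ 1)\<^sup>2 + (x $ 2)\<^sup>2 = 1 - (x $ 3)\<^sup>2"
        using norm_vec3_sq[of x] that by simp
      finally have "sphere_coord x ^ a * cnj (sphere_coord x) ^ a = of_real ((1 - (x $ 3)\<^sup>2) ^ a)"
        by (simp add: power_mult_distrib[symmetric])
      then show ?thesis
        using m unfolding sum
        by (simp add: True p_def power2_eq_square mult_ac flip: of_real_power of_real_mult)
    qed
    ultimately show ?thesis by blast
  qed
next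
  case (add d f g)
  then obtain p q :: "real poly" where
    "degree p \<le> d" "degree q \<le> d"
    "\<And>x. norm x = 1 \<Longrightarrow> zonal_mean m f x = poly p (x $ 3)"
    "\<And>x. norm x = 1 \<Longrightarrow> (\<Sum>k<m. Re (g (rotz (2 * pi * real k / real m) x))) / real m = poly q (x $ 3)"
    by blast
  then show ?case
    by (intro exI[of _ "p + q"]) (auto simp: degree_add_le sum.distrib add_divide_distrib)
qed

lemma exists_orthogonal_pole:
  fixes v :: "real ^ 3"
  assumes "norm v = 1"
  obtains T :: "real ^ 3 \<Rightarrow> real ^ 3"
  where "orthogonal_transformation T" "T (axis 3 1) = v" "\<And>x. v \<bullet> T x = x $ 3"
proof -
  obtain T :: "real ^ 3 \<Rightarrow> real ^ 3" where T: "orthogonal_transformation T" "T (axis 3 1) = v"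
    using orthogonal_transformation_exists_1[of "axis 3 1" v] assms by (auto simp: norm_axis_1)
  have "v \<bullet> T x = axis 3 1 \<bullet> x" for x
    using T unfolding orthogonal_transformation_def by metis
  then show ?thesis using that[OF T] by (simp add: inner_axis')
qed

section \<open>Moments of the third coordinate\<close>

lemma moment_unit:
  fixes v :: "real ^ 3"
  assumes "norm v = 1"
  shows "(\<integral>x. (v \<bullet> x) ^ k \<partial>sphere_measure) = (\<integral>x. (x $ 3) ^ k \<partial>sphere_measure)"
proof -
  obtain T :: "real ^ 3 \<Rightarrow> real ^ 3" where T: "orthogonal_transformation T" "\<And>x. v \<bullet> T x = x $ 3"
    using exists_orthogonal_pole[OF assms] by metis
  have "(\<integral>x. (v \<bullet> T x) ^ k \<partial>sphere_measure) = (\<integral>x. (v \<bullet> x) ^ k \<partial>sphere_measure)"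
    by (rule integral_sphere_orthogonal[OF T(1)]) (intro continuous_intros)
  then show ?thesis by (simp add: T)
qed

text \<open>By rotation invariance, the integral of
  \<open>(\<tau> * x $ i + x $ 3) ^ (2 * Suc p)\<close> is
  \<open>(\<tau>\<^sup>2 + 1) ^ Suc p\<close> times the pure moment. Both sides are polynomials in
  \<tau>; \<open>A\<close> and \<open>B\<close> are these polynomials, and the claim compares their
  coefficients of degree 2.\<close>

lemma moment_sq:
  assumes i: "i = 1 \<or> i = (2 :: 3)"
  shows "real (2 * Suc p - 1) * (\<integral>x. (x $ i)\<^sup>2 * (x $ 3) ^ (2 * p) \<partial>sphere_measure)
      = (\<integral>x. (x $ 3) ^ (2 * Suc p) \<partial>sphere_measure)"
proof -
  let ?I = "\<lambda>f. \<integral>x. f x \<partial>sphere_measure" and ?n = "2 * Suc p"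
  define A where "A = (\<Sum>j\<le>?n. monom (real (?n choose j) * ?I (\<lambda>x. (x $ i) ^ j * (x $ 3) ^ (?n - j))) j)"
  define B where "B = (\<Sum>j\<le>Suc p. monom (real (Suc p choose j) * ?I (\<lambda>x. (x $ 3) ^ ?n)) (2 * j))"
  have "poly A \<tau> = poly B \<tau>" for \<tau>
  proof -
    define w where "w = \<tau> *\<^sub>R axis i 1 + axis 3 (1 :: real)"
    have wx: "w \<bullet> x = \<tau> * x $ i + x $ 3" for x
      by (simp add: w_def inner_add_left inner_axis')
    have nw: "(norm w)\<^sup>2 = 1 + \<tau>\<^sup>2"
      using i by (auto simp: w_def norm_vec3_sq axis_def)
    then have w0: "norm w \<noteq> 0" by (metis power_zero_numeral sum_power2_eq_zero_iff zero_neq_one power_one)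
    have "poly A \<tau> = (\<Sum>j\<le>?n. ?I (\<lambda>x. real (?n choose j) * (\<tau> * x $ i) ^ j * (x $ 3) ^ (?n - j)))"
    proof -
      have "?I (\<lambda>x. real (?n choose j) * (\<tau> * x $ i) ^ j * (x $ 3) ^ (?n - j))
          = real (?n choose j) * ?I (\<lambda>x. (x $ i) ^ j * (x $ 3) ^ (?n - j)) * \<tau> ^ j" for j
        by (simp only: power_mult_distrib mult.assoc Bochner_Integration.integral_mult_right_zero) (simp only: mult_ac)
      then show ?thesis unfolding A_def poly_sum poly_monom by simp
    qed
    also have "\<dots> = ?I (\<lambda>x. \<Sum>j\<le>?n. real (?n choose j) * (\<tau> * x $ i) ^ j * (x $ 3) ^ (?n - j))"
      by (intro Bochner_Integration.integral_sum[symmetric] integrable_sphere_measure continuous_intros)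
    also have "\<dots> = ?I (\<lambda>x. (w \<bullet> x) ^ ?n)"
      by (simp only: wx binomial_ring)
    also have "\<dots> = ?I (\<lambda>x. (norm w) ^ ?n * ((w /\<^sub>R norm w) \<bullet> x) ^ ?n)"
    proof -
      have "w \<bullet> x = norm w * ((w /\<^sub>R norm w) \<bullet> x)" for x using w0 by simp
      then show ?thesis by (metis power_mult_distrib)
    qed
    also have "\<dots> = (norm w) ^ ?n * ?I (\<lambda>x. (x $ 3) ^ ?n)"
      using w0 by (subst moment_unit[symmetric, of "w /\<^sub>R norm w"]) simp_all
    also have "(norm w) ^ ?n = (\<tau>\<^sup>2 + 1) ^ Suc p"
      using nw by (simp only: power_mult add.commute)
    also have "\<dots> = (\<Sum>j\<le>Suc p. real (Suc p choose j) * \<tau> ^ (2 * j))"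
      by (simp only: binomial_ring power_one mult_1_right power_mult)
    finally show ?thesis
      unfolding B_def poly_sum poly_monom sum_distrib_right by (simp only: mult_ac)
  qed
  then have "A = B" by (metis poly_eq_poly_eq_iff ext)
  moreover have "coeff A 2 = real (?n choose 2) * ?I (\<lambda>x. (x $ i)\<^sup>2 * (x $ 3) ^ (2 * p))"
    unfolding A_def coeff_sum coeff_monom by (subst sum.delta) simp_all
  moreover have "coeff B 2 = real (Suc p) * ?I (\<lambda>x. (x $ 3) ^ ?n)"
  proof -
    have "coeff B 2 = (\<Sum>j\<le>Suc p. if j = 1 then real (Suc p choose j) * ?I (\<lambda>x. (x $ 3) ^ ?n) else 0)"
      unfolding B_def coeff_sum coeff_monom by (intro sum.cong) auto
    then show ?thesis by (subst (asm) sum.delta) simp_all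
  qed
  ultimately have "real (?n choose 2) * ?I (\<lambda>x. (x $ i)\<^sup>2 * (x $ 3) ^ (2 * p)) = real (Suc p) * ?I (\<lambda>x. (x $ 3) ^ ?n)"
    by metis
  moreover have "?n choose 2 = Suc p * (?n - 1)"
    by (simp add: choose_two)
  ultimately have "real (Suc p) * (real (?n - 1) * ?I (\<lambda>x. (x $ i)\<^sup>2 * (x $ 3) ^ (2 * p)))
      = real (Suc p) * ?I (\<lambda>x. (x $ 3) ^ ?n)"
    by (simp only: of_nat_mult mult.assoc)
  then show ?thesis by (simp del: of_nat_Suc)
qed

text \<open>Multiplying the moment's integrand by the sum of the three squares, which is 1 on the
  sphere, and using \<open>moment_sq\<close> for the mixed terms yields the ratio
  \<open>(2 p + 1) / (2 p + 3)\<close> of consecutive moments.\<close>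

lemma moment_even: "(\<integral>x. (x $ 3) ^ (2 * p) \<partial>sphere_measure) = 1 / real (2 * p + 1)"
proof (induction p)
  case (Suc p)
  let ?I = "\<lambda>f. \<integral>x. f x \<partial>sphere_measure"
  have "?I (\<lambda>x. (x $ 3) ^ (2 * p))
      = ?I (\<lambda>x. (x $ 1)\<^sup>2 * (x $ 3) ^ (2 * p) + (x $ 2)\<^sup>2 * (x $ 3) ^ (2 * p) + (x $ 3) ^ (2 * Suc p))"
  proof (rule integral_sphere_cong)
    fix x :: "real ^ 3" assume "norm x = 1"
    then have "1 = (x $ 1)\<^sup>2 + (x $ 2)\<^sup>2 + (x $ 3)\<^sup>2" using norm_vec3_sq[of x] by simp
    then have "(x $ 3) ^ (2 * p) = ((x $ 1)\<^sup>2 + (x $ 2)\<^sup>2 + (x $ 3)\<^sup>2) * (x $ 3) ^ (2 * p)" by simp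
    then show "(x $ 3) ^ (2 * p) = (x $ 1)\<^sup>2 * (x $ 3) ^ (2 * p) + (x $ 2)\<^sup>2 * (x $ 3) ^ (2 * p) + (x $ 3) ^ (2 * Suc p)"
      by (simp add: algebra_simps power2_eq_square)
  qed (intro continuous_intros)+
  also have "\<dots> = ?I (\<lambda>x. (x $ 1)\<^sup>2 * (x $ 3) ^ (2 * p)) + ?I (\<lambda>x. (x $ 2)\<^sup>2 * (x $ 3) ^ (2 * p)) + ?I (\<lambda>x. (x $ 3) ^ (2 * Suc p))"
    by (subst Bochner_Integration.integral_add Bochner_Integration.integral_add,
        (intro integrable_sphere_measure continuous_intros)+)+ simp
  finally have "real (2 * p + 1) * ?I (\<lambda>x. (x $ 3) ^ (2 * p)) = real (2 * p + 3) * ?I (\<lambda>x. (x $ 3) ^ (2 * Suc p))"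
    using moment_sq[of 1 p] moment_sq[of 2 p] by (simp add: algebra_simps)
  then show ?case using Suc by (simp add: field_simps)
qed (use emeasure_sphere_measure_UNIV in \<open>simp add: measure_def\<close>)

lemma moment_odd: "odd k \<Longrightarrow> (\<integral>x. (x $ 3) ^ k \<partial>sphere_measure) = 0"
proof -
  assume "odd k"
  have "orthogonal_transformation (\<lambda>x :: real ^ 3. - x)"
    by (simp add: orthogonal_transformation_neg)
  from integral_sphere_orthogonal[OF this, of "\<lambda>x. (x $ 3) ^ k"] show ?thesis
    using \<open>odd k\<close> by (simp add: continuous_intros)
qed

text \<open>Archimedes' hat-box theorem for polynomials: the third coordinate is uniformly
  distributed on \<open>[-1, 1]\<close>. Comparing moments takes the place of a change of variables
  in the cone measure.\<close>

lemma integral_zonal: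
  fixes p :: "real poly"
  shows "(\<integral>x. poly p (x $ 3) \<partial>sphere_measure) = integral {-1..1} (poly p) / 2"
proof -
  have mom: "(\<integral>x. (x $ 3) ^ k \<partial>sphere_measure) = integral {-1..1} (\<lambda>z. z ^ k) / 2" for k
  proof -
    have "integral {-1..1} (\<lambda>z :: real. z ^ k) / 2 = (if even k then 1 / real (Suc k) else 0)"
      unfolding integral_power_symmetric by simp
    moreover have "(\<integral>x. (x $ 3) ^ k \<partial>sphere_measure) = (if even k then 1 / real (Suc k) else 0)"
      using moment_even[of "k div 2"] moment_odd[of k] by (cases "even k") auto
    ultimately show ?thesis by simp
  qed
  have "(\<integral>x. poly p (x $ 3) \<partial>sphere_measure) = (\<Sum>i\<le>degree p. coeff p i * (\<integral>x. (x $ 3) ^ i \<partial>sphere_measure))"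
    unfolding poly_altdef
    by (subst Bochner_Integration.integral_sum) (auto intro!: integrable_sphere_measure continuous_intros)
  also have "\<dots> = integral {-1..1} (poly p) / 2"
    unfolding poly_altdef[of p, abs_def] mom
    by (subst integral_sum) (auto intro!: integrable_continuous_real continuous_intros simp: sum_divide_distrib)
  finally show ?thesis .
qed

text \<open>The factor \<open>h (x $ 3)\<close> and the measure are invariant under
  \<open>rotz\<close>, so the other factor may be replaced by its average over the \<open>m\<close>
  rotations.\<close>

lemma integral_zonal_average:
  assumes f: "polyfun d f" and m: "d < m" and h: "continuous_on UNIV h"
  obtains p :: "real poly" where "degree p \<le> d"
    "\<And>x. norm x = 1 \<Longrightarrow> zonal_mean m f x = poly p (x $ 3)"
    "(\<integral>x. h (x $ 3) * Re (f x) \<partial>sphere_measure) = (\<integral>x. h (x $ 3) * poly p (x $ 3) \<partial>sphere_measure)"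
proof -
  obtain p :: "real poly" where p: "degree p \<le> d"
    "\<And>x. norm x = 1 \<Longrightarrow> zonal_mean m f x = poly p (x $ 3)"
    using zonal_average[OF f m] by blast
  have m0: "0 < m" using m by simp
  note cf = continuous_on_Re[OF continuous_polyfun[OF f]]
  have ch: "continuous_on UNIV (\<lambda>x :: real ^ 3. h (x $ 3))"
    by (rule continuous_on_compose2[OF h]) (auto intro: continuous_intros)
  have cr: "continuous_on UNIV (rotz \<alpha>)" for \<alpha>
    using orthogonal_transformation_linear[OF orthogonal_transformation_rotz]
    by (intro linear_continuous_on linear_conv_bounded_linear[THEN iffD1])
  have cfr: "continuous_on UNIV (\<lambda>x. Re (f (rotz \<alpha> x)))" for \<alpha>
    by (rule continuous_on_compose2[OF cf cr]) auto
  have "(\<integral>x. h (x $ 3) * Re (f x) \<partial>sphere_measure)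
      = (\<Sum>k<m. (\<integral>x. h (x $ 3) * Re (f (rotz (2 * pi * real k / real m) x)) \<partial>sphere_measure)) / real m"
  proof -
    have "(\<integral>x. h (x $ 3) * Re (f (rotz \<alpha> x)) \<partial>sphere_measure) = (\<integral>x. h (x $ 3) * Re (f x) \<partial>sphere_measure)" for \<alpha>
      using integral_sphere_orthogonal[OF orthogonal_transformation_rotz, of "\<lambda>x. h (x $ 3) * Re (f x)" \<alpha>]
      by (simp add: continuous_on_mult ch cf)
    then show ?thesis using m0 by simp
  qed
  also have "\<dots> = (\<integral>x. (\<Sum>k<m. h (x $ 3) * Re (f (rotz (2 * pi * real k / real m) x))) / real m \<partial>sphere_measure)"
    by (subst integral_divide_zero, subst Bochner_Integration.integral_sum)
       (auto intro!: integrable_sphere_measure continuous_on_mult ch cfr)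
  also have "\<dots> = (\<integral>x. h (x $ 3) * poly p (x $ 3) \<partial>sphere_measure)"
  proof (rule integral_sphere_cong)
    show "continuous_on UNIV (\<lambda>x. (\<Sum>k<m. h (x $ 3) * Re (f (rotz (2 * pi * real k / real m) x))) / real m)"
      by (intro continuous_on_divide continuous_on_sum continuous_on_mult ch cfr continuous_on_const) (use m0 in auto)
    show "continuous_on UNIV (\<lambda>x :: real ^ 3. h (x $ 3) * poly p (x $ 3))"
      by (intro continuous_on_mult ch continuous_intros)
    fix x :: "real ^ 3" assume "norm x = 1"
    from p(2)[OF this] have "h (x $ 3) * poly p (x $ 3)
        = h (x $ 3) * (zonal_mean m f x)" by simp
    then show "(\<Sum>k<m. h (x $ 3) * Re (f (rotz (2 * pi * real k / real m) x))) / real m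
        = h (x $ 3) * poly p (x $ 3)"
      by (simp add: sum_distrib_left)
  qed
  finally show ?thesis using that[OF p] by blast
qed

text \<open>An orthogonal map moves the pole to \<open>x\<close>, and averaging turns
  \<open>f\<close> into a polynomial \<open>p\<close> in the third coordinate. The pole is fixed by
  every \<open>rotz\<close>, so \<open>poly p 1\<close> is still the value of \<open>f\<close> at
  \<open>x\<close>.\<close>

lemma sphere_reproducing_kernel:
  fixes K :: "real poly"
  assumes K: "\<And>p :: real poly. degree p \<le> t \<Longrightarrow> integral {-1..1} (poly (K * p)) / 2 = poly p 1"
    and f: "polyfun t f" and x: "norm x = 1"
  shows "(\<integral>y. poly K (x \<bullet> y) * Re (f y) \<partial>sphere_measure) = Re (f x)"
proof -
  obtain T :: "real ^ 3 \<Rightarrow> real ^ 3" where T: "orthogonal_transformation T" "T (axis 3 1) = x" "\<And>y. x \<bullet> T y = y $ 3"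
    using exists_orthogonal_pole[OF x] by metis
  have fT: "polyfun t (\<lambda>y. f (T y))" by (rule polyfun_orthogonal[OF f T(1)])
  obtain p :: "real poly" where p: "degree p \<le> t"
    "\<And>y. norm y = 1 \<Longrightarrow> zonal_mean (Suc t) (\<lambda>y. f (T y)) y = poly p (y $ 3)"
    "(\<integral>y. poly K (y $ 3) * Re (f (T y)) \<partial>sphere_measure) = (\<integral>y. poly K (y $ 3) * poly p (y $ 3) \<partial>sphere_measure)"
    by (rule integral_zonal_average[OF fT lessI, of "poly K"]) (auto intro: continuous_intros)
  have "(\<integral>y. poly K (x \<bullet> y) * Re (f y) \<partial>sphere_measure) = (\<integral>y. poly K (x \<bullet> T y) * Re (f (T y)) \<partial>sphere_measure)"
    by (rule integral_sphere_orthogonal[OF T(1), symmetric])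
       (intro continuous_intros continuous_polyfun[OF f])
  also have "\<dots> = (\<integral>y. poly (K * p) (y $ 3) \<partial>sphere_measure)"
    by (simp add: T(3) p(3))
  also have "\<dots> = poly p 1"
    by (simp only: integral_zonal K[OF p(1)])
  also have "\<dots> = Re (f x)"
  proof -
    have "rotz \<alpha> (axis 3 1) = axis 3 1" for \<alpha>
      by (simp add: vec_eq_iff forall_3 axis_def)
    moreover have "axis 3 1 $ (3 :: 3) = (1 :: real)" by (simp add: axis_def)
    ultimately show ?thesis using p(2)[of "axis 3 1"] T(2) by (simp add: norm_axis_1 del: of_nat_Suc)
  qed
  finally show ?thesis .
qed

text \<open>The \<open>m\<close> equidistant azimuths perform the zonal average exactly, which
  leaves a one-dimensional integral for the rule in the colatitude.\<close>

lemma sphere_product_quadrature: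
  fixes w \<theta> :: "nat \<Rightarrow> real"
  assumes w: "\<And>p :: real poly. degree p \<le> d \<Longrightarrow> (\<Sum>j<n. w j * poly p (cos (\<theta> j))) = integral {-1..1} (poly p) / 2"
    and f: "polyfun d f" and m: "d < m"
  shows "(\<integral>x. Re (f x) \<partial>sphere_measure)
    = (\<Sum>j<n. \<Sum>k<m. w j / real m * Re (f (rotz (2 * pi * real k / real m) (vector [sin (\<theta> j), 0, cos (\<theta> j)]))))"
proof -
  obtain p :: "real poly" where p: "degree p \<le> d"
    "\<And>y. norm y = 1 \<Longrightarrow> zonal_mean m f y = poly p (y $ 3)"
    "(\<integral>y. 1 * Re (f y) \<partial>sphere_measure) = (\<integral>y. 1 * poly p (y $ 3) \<partial>sphere_measure)"
    by (rule integral_zonal_average[OF f m, of "\<lambda>_. 1"]) (auto intro: continuous_intros)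
  have "norm (vector [sin (\<theta> j), 0, cos (\<theta> j)] :: real ^ 3) = 1" for j
  proof -
    have "(norm (vector [sin (\<theta> j), 0, cos (\<theta> j)] :: real ^ 3))\<^sup>2 = 1" by (simp add: norm_vec3_sq)
    then show ?thesis by (simp add: power2_eq_1_iff) (smt (verit) norm_ge_zero)
  qed
  from p(2)[OF this] have "(\<Sum>k<m. Re (f (rotz (2 * pi * real k / real m) (vector [sin (\<theta> j), 0, cos (\<theta> j)])))) / real m
      = poly p (cos (\<theta> j))" for j by simp
  note avg = this
  have "(\<Sum>k<m. w j / real m * Re (f (rotz (2 * pi * real k / real m) (vector [sin (\<theta> j), 0, cos (\<theta> j)]))))
      = w j * poly p (cos (\<theta> j))" for j
    unfolding sum_distrib_left[symmetric] avg[symmetric] by simp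
  then have "(\<Sum>j<n. \<Sum>k<m. w j / real m * Re (f (rotz (2 * pi * real k / real m) (vector [sin (\<theta> j), 0, cos (\<theta> j)]))))
      = (\<Sum>j<n. w j * poly p (cos (\<theta> j)))"
    by simp
  then show ?thesis using p(3) w[OF p(1)] integral_zonal[of p] by simp
qed

section \<open>The zonal kernel\<close>

lemma poly_ext: "(\<And>x. poly p x = poly q x) \<Longrightarrow> p = q" for p q :: "real poly"
  by (rule poly_eq_poly_eq_iff[THEN iffD1], rule ext)

lemmas pderiv_simps = pderiv_mult pderiv_pCons pderiv_add pderiv_diff pderiv_minus pderiv_smult pderiv_monom

text \<open>\<open>evaluator n\<close> is the polynomial of degree \<open>n\<close> representing evaluation at \<open>0\<close> in \<open>L\<^sup>2[0, 1]\<close>; it is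
  a multiple of the hypergeometric polynomial \<open>F(-n, n + 2; 2; x)\<close>, a shifted Jacobi polynomial.\<close>

fun jacobi_coeff :: "nat \<Rightarrow> nat \<Rightarrow> real" where
  "jacobi_coeff n 0 = (real n + 1)\<^sup>2"
| "jacobi_coeff n (Suc k) = - (real n - real k) * (real n + real k + 2) / ((real k + 1) * (real k + 2)) * jacobi_coeff n k"

definition evaluator :: "nat \<Rightarrow> real poly" where
  "evaluator n = (\<Sum>k\<le>n. monom (jacobi_coeff n k) k)"

lemma jacobi_coeff_eq_0: "n < k \<Longrightarrow> jacobi_coeff n k = 0"
proof (induction k)
  case (Suc k)
  then show ?case by (cases "n = k") auto
qed simp

lemma coeff_evaluator: "coeff (evaluator n) k = jacobi_coeff n k"
  by (simp add: evaluator_def coeff_sum coeff_monom jacobi_coeff_eq_0)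

lemma degree_evaluator: "degree (evaluator n) \<le> n"
  by (rule degree_le) (simp add: coeff_evaluator jacobi_coeff_eq_0)

lemma poly_evaluator_0: "poly (evaluator n) 0 = (real n + 1)\<^sup>2"
  by (simp add: poly_0_coeff_0 coeff_evaluator)

text \<open>This is the hypergeometric equation with parameters \<open>-n\<close>,
  \<open>n + 2\<close> and \<open>2\<close>; comparing coefficients gives back the recursion of
  \<open>jacobi_coeff\<close>.\<close>

lemma evaluator_ode:
  fixes n
  defines "R \<equiv> evaluator n"
  shows "[:0, 1, -1:] * pderiv (pderiv R) + [:2, -3:] * pderiv R + smult (real n * (real n + 2)) R = 0"
proof (rule poly_eqI)
  fix k
  have c: "(real j + 1) * (real j + 2) * coeff R (Suc j) = - (real n - real j) * (real n + real j + 2) * coeff R j" for j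
    by (simp add: R_def coeff_evaluator)
  have e1: "[:0, 1, -1:] * p = pCons 0 p - pCons 0 (pCons 0 p)" for p :: "real poly"
    by simp
  have e2: "[:2, -3:] * p = smult 2 p - pCons 0 (smult 3 p)" for p :: "real poly"
    by simp
  show "coeff ([:0, 1, -1:] * pderiv (pderiv R) + [:2, -3:] * pderiv R + smult (real n * (real n + 2)) R) k
      = coeff 0 k"
  proof (cases k)
    case 0
    then show ?thesis using c[of 0] unfolding e1 e2 by (simp add: coeff_pderiv algebra_simps)
  next
    case (Suc j)
    show ?thesis
    proof (cases j)
      case 0
      then show ?thesis using c[of 1] Suc unfolding e1 e2 by (simp add: coeff_pderiv numeral_2_eq_2 algebra_simps)
    next
      case (Suc i)
      then show ?thesis using c[of "Suc (Suc i)"] \<open>k = Suc j\<close> unfolding e1 e2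
        by (simp add: coeff_pderiv algebra_simps)
    qed
  qed
qed

section \<open>Integral identities for the evaluator\<close>

definition I01 :: "real poly \<Rightarrow> real" where
  "I01 p = integral {0..1} (poly p)"

lemma I01_add: "I01 (p + q) = I01 p + I01 q"
  unfolding I01_def poly_add
  by (rule integral_add) (auto intro!: integrable_continuous_real continuous_intros)

lemma I01_diff: "I01 (p - q) = I01 p - I01 q"
  unfolding I01_def poly_diff
  by (rule integral_diff) (auto intro!: integrable_continuous_real continuous_intros)

lemma I01_smult: "I01 (smult c p) = c * I01 p"
  unfolding I01_def poly_smult by simp

lemma I01_pderiv: "I01 (pderiv p) = poly p 1 - poly p 0"
proof -
  have "(poly (pderiv p) has_integral (poly p 1 - poly p 0)) {0..1}"
    by (rule fundamental_theorem_of_calculus)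
       (auto simp: has_real_derivative_iff_has_vector_derivative[symmetric] intro: poly_DERIV DERIV_subset)
  then show ?thesis by (simp add: I01_def integral_unique)
qed

context
  fixes n :: nat and R N lam
  assumes R: "R = evaluator n" and N: "N = real n + 1" and lam: "lam = real n * (real n + 2)"
begin

lemma lam_N: "lam = N\<^sup>2 - 1"
  by (simp add: N lam power2_eq_square algebra_simps)

lemma ode_at: "x * (1 - x) * poly (pderiv (pderiv R)) x = - (2 - 3 * x) * poly (pderiv R) x - lam * poly R x"
  using arg_cong[OF evaluator_ode[of n], of "\<lambda>p. poly p x"] unfolding R lam by (simp add: algebra_simps)

lemma R_0: "poly R 0 = N\<^sup>2" by (simp add: R N poly_evaluator_0)

text \<open>The differential equation makes \<open>N\<^sup>2 * R\<close> an exact derivative, up to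
  sign; the only surviving boundary value is \<open>R 0 = N\<^sup>2\<close>.\<close>

lemma I01_evaluator: "I01 R = 1"
proof -
  have "pderiv ([:0, 1, -1:] * pderiv R - [:-1, 1:] * R) = - smult (N\<^sup>2) R"
    by (rule poly_ext)
       (use ode_at in \<open>simp add: pderiv_simps lam_N algebra_simps\<close>)
  from arg_cong[OF this, of I01] have "- poly R 0 = - (N\<^sup>2 * I01 R)"
    by (simp add: I01_pderiv I01_smult flip: smult_minus_left)
  then show ?thesis using R_0 by (simp add: N)
qed

text \<open>In self-adjoint form the equation reads
  \<open>(x\<^sup>2 (1 - x) R')' = - lam x R\<close>. Multiplied by powers of \<open>x\<close> and
  integrated, it gives a two-term recursion for the moments whose factor
  \<open>i (i + 2) - n (n + 2)\<close> is nonzero for \<open>i < n\<close>, so vanishing propagates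
  from the first moment.\<close>

lemma I01_evaluator_monom:
  "j < n \<Longrightarrow> I01 (monom 1 (Suc j) * R) = 0"
proof (induction j)
  case 0
  have "pderiv ([:0, 0, 1, -1:] * pderiv R) = - smult lam (monom 1 (Suc 0) * R)" (is "?p = ?q")
  proof (rule poly_ext)
    show "poly ?p x = poly ?q x" for x
      using arg_cong[OF ode_at[of x], of "\<lambda>y. x * y"]
      by (simp add: pderiv_simps poly_monom algebra_simps)
  qed
  from arg_cong[OF this, of I01] have "lam * I01 (monom 1 (Suc 0) * R) = 0"
    by (simp add: I01_pderiv I01_smult flip: smult_minus_left)
  then show ?case using 0 by (simp add: lam)
next
  case (Suc j)
  let ?c = "\<lambda>i. I01 (monom 1 i * R)" and ?j = "real j + 1"
  have "pderiv (monom 1 (Suc j) * [:0, 0, 1, -1:] * pderiv R - smult ?j (monom 1 (Suc (Suc j)) * [:1, -1:] * R))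
      = smult (?j * (?j + 2) - lam) (monom 1 (Suc (Suc j)) * R) - smult (?j * (?j + 1)) (monom 1 (Suc j) * R)" (is "?p = ?q")
  proof (rule poly_ext)
    show "poly ?p x = poly ?q x" for x
      using arg_cong[OF ode_at[of x], of "\<lambda>y. x ^ (Suc (Suc j)) * y"]
      by (simp add: pderiv_simps poly_monom algebra_simps)
  qed
  from arg_cong[OF this, of I01] have "(?j * (?j + 2) - lam) * ?c (Suc (Suc j)) = ?j * (?j + 1) * ?c (Suc j)"
    by (simp add: I01_pderiv I01_smult I01_diff poly_monom)
  moreover have "?j * (?j + 2) - lam \<noteq> 0"
  proof -
    have "?j * (?j + 2) < lam" unfolding lam using Suc.prems by (intro mult_strict_mono) auto
    then show ?thesis by simp
  qed
  ultimately show ?case using Suc by simp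
qed

lemma evaluator_reproducing:
  assumes "degree p \<le> n"
  shows "I01 (p * R) = poly p 0"
proof -
  have c: "I01 (monom a i * R) = (if i = 0 then a else 0)" if "i \<le> n" for a i
  proof -
    have "monom a i * R = smult a (monom 1 i * R)" by (simp add: smult_monom flip: mult_smult_left)
    then show ?thesis
      using I01_evaluator I01_evaluator_monom[of "i - 1"] that by (cases i) (auto simp: I01_smult monom_0)
  qed
  have "I01 (\<Sum>i\<le>m. monom (coeff p i) i * R) = coeff p 0" if "m \<le> n" for m
    using that by (induction m) (auto simp: I01_add c)
  from this[OF assms] show ?thesis
    by (simp add: sum_distrib_right[symmetric] poly_as_sum_of_monoms poly_0_coeff_0)
qed

lemma I01_evaluator_sq: "I01 (R * R) = N\<^sup>2"
  using evaluator_reproducing[of R] degree_evaluator[of n] R_0 R by simp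

text \<open>The difference of \<open>R\<^sup>2\<close> at 1 and 0 is twice the integral of
  \<open>R' R\<close>. The reproducing property evaluates that integral as \<open>R'(0)\<close>, and
  the equation at 0 gives \<open>2 R'(0) = - lam N\<^sup>2\<close>.\<close>

lemma evaluator_1_sq: "(poly R 1)\<^sup>2 = N\<^sup>2"
proof -
  have "degree (pderiv R) \<le> n"
    using degree_pderiv[of R] degree_evaluator[of n] R by simp
  from evaluator_reproducing[OF this] have 1: "I01 (pderiv R * R) = poly (pderiv R) 0" .
  have "pderiv (R * R) = smult 2 (pderiv R * R)"
    by (rule poly_ext) (simp add: pderiv_simps)
  from arg_cong[OF this, of I01] have "poly R 1 * poly R 1 - poly R 0 * poly R 0 = 2 * poly (pderiv R) 0"
    by (simp add: I01_pderiv I01_smult 1)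
  moreover have "2 * poly (pderiv R) 0 = - lam * N\<^sup>2"
    using ode_at[of 0] R_0 by simp
  ultimately show ?thesis
    by (simp add: R_0 lam_N power2_eq_square algebra_simps)
qed

text \<open>Testing the equation with \<open>R\<close> and integrating by parts leaves only boundary
  values and the known integral of \<open>R\<^sup>2\<close>.\<close>

lemma I01_weighted_deriv_sq: "I01 ([:0, 1, -1:] * (pderiv R * pderiv R)) = lam * N\<^sup>2 / 2"
proof -
  have "pderiv ([:0, 1, -1:] * (R * pderiv R) + smult (1/2) ([:1, -1:] * (R * R)))
      = [:0, 1, -1:] * (pderiv R * pderiv R) - smult (lam + 1/2) (R * R)" (is "?p = ?q")
  proof (rule poly_ext)
    show "poly ?p x = poly ?q x" for x
      using arg_cong[OF ode_at[of x], of "\<lambda>y. poly R x * y"]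
      by (simp add: pderiv_simps algebra_simps)
  qed
  from arg_cong[OF this, of I01] show ?thesis
    by (simp add: I01_pderiv I01_smult I01_diff I01_evaluator_sq R_0 lam_N power2_eq_square algebra_simps)
qed

text \<open>Testing the equation with \<open>R'\<close> and with \<open>x R'\<close> gives two
  linear equations for the integrals \<open>a\<close> of \<open>R'\<^sup>2\<close> and
  \<open>b\<close> of \<open>x R'\<^sup>2\<close>. Their right-hand sides need \<open>R\<close> at
  both end points, hence \<open>evaluator_1_sq\<close>.\<close>

lemma I01_deriv_sq: "I01 (pderiv R * pderiv R) = lam * (N^4 + 5 * N\<^sup>2) / 3"
proof -
  let ?Q = "pderiv R * pderiv R"
  have 1: "pderiv ([:0, 1, -1:] * ?Q + smult lam (R * R)) = - ([:3, -4:] * ?Q)" (is "?p = ?q")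
  proof (rule poly_ext)
    show "poly ?p x = poly ?q x" for x
      using arg_cong[OF ode_at[of x], of "\<lambda>y. poly (pderiv R) x * y"]
      by (simp add: pderiv_simps algebra_simps)
  qed
  have 2: "pderiv ([:0, 0, 1, -1:] * ?Q + smult lam ([:0, 1:] * (R * R)))
      = smult lam (R * R) - ([:0, 2, -3:] * ?Q)" (is "?p = ?q")
  proof (rule poly_ext)
    show "poly ?p x = poly ?q x" for x
      using arg_cong[OF ode_at[of x], of "\<lambda>y. x * poly (pderiv R) x * y"]
      by (simp add: pderiv_simps algebra_simps)
  qed
  define a b where "a = I01 ?Q" and "b = I01 ([:0, 1:] * ?Q)"
  have "- ([:3, -4:] * ?Q) = smult (-3) ?Q + smult 4 ([:0, 1:] * ?Q)" by (simp add: algebra_simps)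
  then have "I01 (- ([:3, -4:] * ?Q)) = - 3 * a + 4 * b"
    by (simp only: I01_add I01_smult a_def b_def)
  with arg_cong[OF 1, of I01] have e1: "lam * (N\<^sup>2 - N^4) = - 3 * a + 4 * b"
    using evaluator_1_sq by (simp add: I01_pderiv R_0 power2_eq_square power4_eq_xxxx right_diff_distrib mult_ac)
  \<comment> \<open>\<open>2 x - 3 x\<^sup>2 = 3 x (1 - x) - x\<close> reduces this to the weighted
    integral already computed and \<open>b\<close>.\<close>
  have "smult lam (R * R) - ([:0, 2, -3:] * ?Q)
      = smult lam (R * R) + ([:0, 1:] * ?Q - smult 3 ([:0, 1, -1:] * ?Q))"
    by (rule poly_ext) (simp add: algebra_simps)
  then have "I01 (smult lam (R * R) - ([:0, 2, -3:] * ?Q)) = lam * N\<^sup>2 + (b - 3 * (lam * N\<^sup>2 / 2))"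
    by (simp only: I01_add I01_diff I01_smult b_def I01_evaluator_sq I01_weighted_deriv_sq)
  with arg_cong[OF 2, of I01] have e2: "lam * N\<^sup>2 = lam * N\<^sup>2 + b - 3 * (lam * N\<^sup>2 / 2)"
    using evaluator_1_sq by (simp add: I01_pderiv power2_eq_square del: mult_pCons_left) (simp add: algebra_simps)
  from e1 e2 have "a = lam * (N^4 + 5 * N\<^sup>2) / 3" by (simp add: field_simps)
  then show ?thesis by (simp add: a_def)
qed

end

text \<open>Cauchy-Schwarz stated for upper bounds of the norms, via the weighted inequality between
  arithmetic and geometric mean; no square roots of integrals appear.\<close>

lemma integral_abs_mult_le:
  fixes f g :: "real \<Rightarrow> real"
  assumes cont: "continuous_on {0..1} f" "continuous_on {0..1} g"
    and f: "integral {0..1} (\<lambda>x. (f x)\<^sup>2) \<le> a\<^sup>2" and g: "integral {0..1} (\<lambda>x. (g x)\<^sup>2) \<le> b\<^sup>2"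
    and ab: "0 < a" "0 < b"
  shows "integral {0..1} (\<lambda>x. \<bar>f x * g x\<bar>) \<le> a * b"
proof -
  have "integral {0..1} (\<lambda>x. \<bar>f x * g x\<bar>)
      \<le> integral {0..1} (\<lambda>x. b / (2 * a) * (f x)\<^sup>2 + a / (2 * b) * (g x)\<^sup>2)"
  proof (rule integral_le)
    show "\<bar>f x * g x\<bar> \<le> b / (2 * a) * (f x)\<^sup>2 + a / (2 * b) * (g x)\<^sup>2" for x
    proof -
      have "0 \<le> (b * \<bar>f x\<bar> - a * \<bar>g x\<bar>)\<^sup>2 / (2 * a * b)" using ab by simp
      also have "\<dots> = b / (2 * a) * (f x)\<^sup>2 + a / (2 * b) * (g x)\<^sup>2 - \<bar>f x * g x\<bar>"
        using ab by (simp add: power2_diff power_mult_distrib abs_mult field_simps power2_eq_square)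
      finally show ?thesis by simp
    qed
  qed (use ab in \<open>auto intro!: integrable_continuous_real continuous_intros cont\<close>)
  also have "\<dots> = b / (2 * a) * integral {0..1} (\<lambda>x. (f x)\<^sup>2) + a / (2 * b) * integral {0..1} (\<lambda>x. (g x)\<^sup>2)"
    by (subst integral_add) (use ab in \<open>auto intro!: integrable_continuous_real continuous_intros cont\<close>)
  also have "\<dots> \<le> b / (2 * a) * a\<^sup>2 + a / (2 * b) * b\<^sup>2"
    by (intro add_mono mult_left_mono f g) (use ab in auto)
  also have "\<dots> = a * b" using ab by (simp add: power2_eq_square)
  finally show ?thesis .
qed

text \<open>Multiplying the evaluator by a second one localises it near \<open>0\<close>, at the price of reproducing
  only the polynomials of degree at most \<open>t\<close>.\<close>

definition zonal_kernel :: "nat \<Rightarrow> nat \<Rightarrow> real poly" where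
  "zonal_kernel s t = smult (1 / (real s + 1)\<^sup>2) (evaluator s * evaluator (t + s))"

lemma degree_kernel: "degree (zonal_kernel s t) \<le> t + 2 * s"
proof -
  have "degree (zonal_kernel s t) \<le> degree (evaluator s) + degree (evaluator (t + s))"
    unfolding zonal_kernel_def by (rule order.trans[OF degree_smult_le degree_mult_le])
  then show ?thesis using degree_evaluator[of s] degree_evaluator[of "t + s"] by simp
qed

lemma kernel_reproducing:
  assumes "degree p \<le> t"
  shows "I01 (zonal_kernel s t * p) = poly p 0"
proof -
  have "degree (evaluator s * p) \<le> t + s"
    using degree_mult_le[of "evaluator s" p] degree_evaluator[of s] assms by simp
  from evaluator_reproducing[OF refl refl refl this]
  have "I01 (evaluator s * p * evaluator (t + s)) = (real s + 1)\<^sup>2 * poly p 0"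
    by (simp add: poly_evaluator_0)
  moreover have "zonal_kernel s t * p = smult (1 / (real s + 1)\<^sup>2) (evaluator s * p * evaluator (t + s))"
    by (simp add: zonal_kernel_def mult_ac)
  moreover have "(real s + 1)\<^sup>2 \<noteq> 0" by simp
  ultimately show ?thesis by (simp add: I01_smult)
qed

lemma I01_conv: "integral {0..1} (\<lambda>x. poly p x * poly q x) = I01 (p * q)"
  by (simp add: I01_def poly_mult[abs_def])

context
  fixes s t :: nat and S N :: real
  assumes S: "S = real s + 1" and N: "N = real t + real s + 1"
begin

private lemma SN: "0 < S" "0 < N"
  using S N by simp_all

private lemma N': "N = real (t + s) + 1" using N by simp

text \<open>The decimal fractions are upper approximations of \<open>1 / sqrt 3\<close> and \<open>1 / sqrt 2\<close>.\<close>

lemma evaluator_norms: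
  "I01 (evaluator s * evaluator s) = S\<^sup>2"
  "I01 (evaluator (t + s) * evaluator (t + s)) = N\<^sup>2"
  "I01 (pderiv (evaluator s) * pderiv (evaluator s)) \<le> (57736 / 100000 * (S\<^sup>2 * (S + 1)))\<^sup>2"
  "I01 (pderiv (evaluator (t + s)) * pderiv (evaluator (t + s))) \<le> (57736 / 100000 * (N ^ 3 + 2 * N))\<^sup>2"
  "I01 ([:0, 1, -1:] * (pderiv (evaluator s) * pderiv (evaluator s))) \<le> (70711 / 100000 * S\<^sup>2)\<^sup>2"
  "I01 ([:0, 1, -1:] * (pderiv (evaluator (t + s)) * pderiv (evaluator (t + s)))) \<le> (70711 / 100000 * N\<^sup>2)\<^sup>2"
proof -
  show "I01 (evaluator s * evaluator s) = S\<^sup>2" by (rule I01_evaluator_sq[OF refl S refl])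
  show "I01 (evaluator (t + s) * evaluator (t + s)) = N\<^sup>2" by (rule I01_evaluator_sq[OF refl N' refl])
  have "I01 (pderiv (evaluator s) * pderiv (evaluator s)) = S\<^sup>2 * ((S\<^sup>2 - 1) * (S\<^sup>2 + 5)) / 3"
    unfolding I01_deriv_sq[OF refl S refl] lam_N[OF refl S refl] by (simp add: algebra_simps power2_eq_square power4_eq_xxxx)
  also have "\<dots> \<le> S\<^sup>2 * (S * (S + 1))\<^sup>2 * (57736 / 100000)\<^sup>2"
  proof -
    have "0 \<le> S * (S - 1)\<^sup>2 + (S * (S - 1)\<^sup>2 + (S - 1)\<^sup>2)" using SN by simp
    then have "(S\<^sup>2 - 1) * (S\<^sup>2 + 5) \<le> (S * (S + 1))\<^sup>2"
      by (simp add: algebra_simps power2_eq_square)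
    then have "S\<^sup>2 * ((S\<^sup>2 - 1) * (S\<^sup>2 + 5)) * (1 / 3) \<le> S\<^sup>2 * (S * (S + 1))\<^sup>2 * (57736 / 100000)\<^sup>2"
      by (intro mult_mono mult_left_mono) (auto simp: power2_eq_square)
    then show ?thesis by simp
  qed
  also have "\<dots> = (57736 / 100000 * (S\<^sup>2 * (S + 1)))\<^sup>2"
    by (simp add: algebra_simps power2_eq_square)
  finally show "I01 (pderiv (evaluator s) * pderiv (evaluator s)) \<le> (57736 / 100000 * (S\<^sup>2 * (S + 1)))\<^sup>2" .
  have "I01 (pderiv (evaluator (t + s)) * pderiv (evaluator (t + s))) = (N\<^sup>2 - 1) * (N ^ 4 + 5 * N\<^sup>2) / 3"
    unfolding I01_deriv_sq[OF refl N' refl] lam_N[OF refl N' refl] ..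
  also have "\<dots> \<le> (N ^ 3 + 2 * N)\<^sup>2 * (57736 / 100000)\<^sup>2"
  proof -
    have "0 \<le> 9 * N\<^sup>2" by simp
    then have "(N\<^sup>2 - 1) * (N ^ 4 + 5 * N\<^sup>2) \<le> (N ^ 3 + 2 * N)\<^sup>2"
      by (simp add: algebra_simps power2_eq_square power3_eq_cube power4_eq_xxxx)
    then have "(N\<^sup>2 - 1) * (N ^ 4 + 5 * N\<^sup>2) * (1 / 3) \<le> (N ^ 3 + 2 * N)\<^sup>2 * (57736 / 100000)\<^sup>2"
      by (intro mult_mono) (auto simp: power2_eq_square)
    then show ?thesis by simp
  qed
  also have "\<dots> = (57736 / 100000 * (N ^ 3 + 2 * N))\<^sup>2" by (simp only: power_mult_distrib mult.commute)
  finally show "I01 (pderiv (evaluator (t + s)) * pderiv (evaluator (t + s))) \<le> (57736 / 100000 * (N ^ 3 + 2 * N))\<^sup>2" .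
  have w: "(X\<^sup>2 - 1) * X\<^sup>2 / 2 \<le> (70711 / 100000 * X\<^sup>2)\<^sup>2" for X :: real
  proof -
    have "0 \<le> X\<^sup>2 * X\<^sup>2" "0 \<le> X\<^sup>2" by simp_all
    then show ?thesis unfolding power2_eq_square[of "70711 / 100000 * X\<^sup>2"] by argo
  qed
  show "I01 ([:0, 1, -1:] * (pderiv (evaluator s) * pderiv (evaluator s))) \<le> (70711 / 100000 * S\<^sup>2)\<^sup>2"
    unfolding I01_weighted_deriv_sq[OF refl S refl] lam_N[OF refl S refl] by (rule w)
  show "I01 ([:0, 1, -1:] * (pderiv (evaluator (t + s)) * pderiv (evaluator (t + s)))) \<le> (70711 / 100000 * N\<^sup>2)\<^sup>2"
    unfolding I01_weighted_deriv_sq[OF refl N' refl] lam_N[OF refl N' refl] by (rule w)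
qed

text \<open>Product rule, then Cauchy-Schwarz on each of the two terms, with the weight attached to
  the differentiated factor. The two uses are \<open>w = 1\<close> and
  \<open>w = sqrt (x * (1 - x))\<close>.\<close>

lemma kernel_weighted_product:
  assumes w: "continuous_on {0..1} w" "\<And>x. x \<in> {0..1} \<Longrightarrow> 0 \<le> w x"
    and a: "integral {0..1} (\<lambda>x. (w x * poly (pderiv (evaluator s)) x)\<^sup>2) \<le> a\<^sup>2" "0 < a"
    and b: "integral {0..1} (\<lambda>x. (w x * poly (pderiv (evaluator (t + s))) x)\<^sup>2) \<le> b\<^sup>2" "0 < b"
  shows "integral {0..1} (\<lambda>x. w x * \<bar>poly (pderiv (zonal_kernel s t)) x\<bar>) \<le> (a * N + S * b) / S\<^sup>2"
proof -
  let ?f = "\<lambda>x. (w x * poly (pderiv (evaluator s)) x) * poly (evaluator (t + s)) x"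
  let ?g = "\<lambda>x. poly (evaluator s) x * (w x * poly (pderiv (evaluator (t + s))) x)"
  have "integral {0..1} (\<lambda>x. w x * \<bar>poly (pderiv (zonal_kernel s t)) x\<bar>)
      \<le> integral {0..1} (\<lambda>x. (\<bar>?f x\<bar> + \<bar>?g x\<bar>) / S\<^sup>2)"
  proof (rule integral_le)
    fix x :: real assume x: "x \<in> {0..1}"
    have "w x * \<bar>poly (pderiv (zonal_kernel s t)) x\<bar> = \<bar>w x * poly (pderiv (zonal_kernel s t)) x\<bar>"
      using w(2)[OF x] by (simp add: abs_mult)
    also have "w x * poly (pderiv (zonal_kernel s t)) x = (?f x + ?g x) / S\<^sup>2"
      by (simp add: zonal_kernel_def pderiv_smult pderiv_mult S algebra_simps add_divide_distrib)
    also have "\<bar>\<dots>\<bar> \<le> (\<bar>?f x\<bar> + \<bar>?g x\<bar>) / S\<^sup>2"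
      by (simp only: abs_divide) (simp add: divide_right_mono abs_triangle_ineq)
    finally show "w x * \<bar>poly (pderiv (zonal_kernel s t)) x\<bar> \<le> (\<bar>?f x\<bar> + \<bar>?g x\<bar>) / S\<^sup>2" .
  qed (use SN in \<open>auto intro!: integrable_continuous_real continuous_intros w(1)\<close>)
  also have "\<dots> = (integral {0..1} (\<lambda>x. \<bar>?f x\<bar>) + integral {0..1} (\<lambda>x. \<bar>?g x\<bar>)) / S\<^sup>2"
    by (subst integral_add[symmetric]) (auto intro!: integrable_continuous_real continuous_intros w(1))
  also have "\<dots> \<le> (a * N + S * b) / S\<^sup>2"
  proof (intro divide_right_mono add_mono integral_abs_mult_le)
    show "integral {0..1} (\<lambda>x. (poly (evaluator s) x)\<^sup>2) \<le> S\<^sup>2"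
      "integral {0..1} (\<lambda>x. (poly (evaluator (t + s)) x)\<^sup>2) \<le> N\<^sup>2"
      using evaluator_norms(1,2) by (simp_all add: I01_conv power2_eq_square)
  qed (use a b SN in \<open>auto intro!: continuous_intros w(1)\<close>)
  finally show ?thesis .
qed

lemma kernel_variation:
  "variation_integral (zonal_kernel s t) \<le> 57736 / 100000 * ((S + 1) * N + (N ^ 3 + 2 * N) / S)"
proof -
  have "integral {0..1} (\<lambda>x. 1 * \<bar>poly (pderiv (zonal_kernel s t)) x\<bar>)
      \<le> ((57736 / 100000 * (S\<^sup>2 * (S + 1))) * N + S * (57736 / 100000 * (N ^ 3 + 2 * N))) / S\<^sup>2"
    using evaluator_norms(3,4) SN
    by (intro kernel_weighted_product) (auto simp: I01_conv power2_eq_square[of "poly _ _"] intro!: mult_pos_pos add_pos_pos)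
  also have "\<dots> = 57736 / 100000 * ((S + 1) * N + (N ^ 3 + 2 * N) / S)"
    using SN by (simp add: field_simps power2_eq_square)
  finally show ?thesis by simp
qed

lemma kernel_weighted_variation:
  "weighted_variation_integral (zonal_kernel s t) \<le> 70711 / 100000 * (N + N\<^sup>2 / S)"
proof -
  let ?w = "\<lambda>x :: real. sqrt (x * (1 - x))"
  have sq: "integral {0..1} (\<lambda>x. (?w x * poly p x)\<^sup>2) = I01 ([:0, 1, -1:] * (p * p))" for p
    unfolding I01_def
  proof (rule integral_cong)
    fix x :: real assume "x \<in> {0..1}"
    then have "(?w x)\<^sup>2 = x * (1 - x)" by (intro real_sqrt_pow2) simp
    then show "(?w x * poly p x)\<^sup>2 = poly ([:0, 1, -1:] * (p * p)) x"
      by (simp only: power_mult_distrib) (simp add: power2_eq_square algebra_simps)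
  qed
  have "integral {0..1} (\<lambda>x. ?w x * \<bar>poly (pderiv (zonal_kernel s t)) x\<bar>)
      \<le> ((70711 / 100000 * S\<^sup>2) * N + S * (70711 / 100000 * N\<^sup>2)) / S\<^sup>2"
  proof (rule kernel_weighted_product)
    show "0 \<le> ?w x" if "x \<in> {0..1}" for x using that by simp
  qed (use evaluator_norms(5,6) SN in \<open>auto intro!: continuous_intros simp: sq simp del: mult_pCons_left\<close>)
  also have "\<dots> = 70711 / 100000 * (N + N\<^sup>2 / S)"
    using SN by (simp add: field_simps power2_eq_square)
  finally show ?thesis .
qed

end

text \<open>By the parity of \<open>t\<close>, either \<open>N = 3 S\<close> or
  \<open>N = 3 S - 1\<close>. With \<open>S = u + 1\<close>, the difference of the two sides,
  multiplied by \<open>S\<close> in the odd case, is a polynomial in \<open>u \<ge> 0\<close> with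
  positive coefficients. At \<open>t = 1\<close> only its constant term remains, a margin of about
  1.66.\<close>

lemma variation_constant_bound:
  fixes t :: nat
  assumes t: "1 \<le> t" and s: "s = (t - 1) div 2"
  defines "S \<equiv> real s + 1" and "N \<equiv> real t + real s + 1"
  shows "6 * (57736 / 100000 * ((S + 1) * N + (N ^ 3 + 2 * N) / S))
    + 4 * (2 * N - 1) * (70711 / 100000 * (N + N\<^sup>2 / S)) < 108 * (real t)\<^sup>2"
proof -
  define u where "u = real s"
  have u: "0 \<le> u" by (simp add: u_def)
  have "t = 2 * s + 2 \<or> t = 2 * s + 1" using t s by presburger
  then show ?thesis
  proof
    assume "t = 2 * s + 2"
    then have tu: "real t = 2 * S" "N = 3 * S" by (simp_all add: S_def N_def)
    have "S \<noteq> 0" by (simp add: S_def)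
    have "6 * (57736 / 100000 * ((S + 1) * N + (N ^ 3 + 2 * N) / S)) + 4 * (2 * N - 1) * (70711 / 100000 * (N + N\<^sup>2 / S))
      = 346416 / 100000 * (30 * S\<^sup>2 + 3 * S + 6) + 282844 / 100000 * (72 * S\<^sup>2 - 12 * S)"
      using \<open>S \<noteq> 0\<close> unfolding tu by (simp add: field_simps power2_eq_square power3_eq_cube)
    also have "\<dots> < 108 * (2 * S)\<^sup>2"
    proof -
      have "108 * (2 * (u + 1))\<^sup>2 - (346416 / 100000 * (30 * (u + 1)\<^sup>2 + 3 * (u + 1) + 6) + 282844 / 100000 * (72 * (u + 1)\<^sup>2 - 12 * (u + 1)))
        = 12719136 / 100000 + 27240384 / 100000 * u + 12442752 / 100000 * (u * u)"
        by (simp add: power2_eq_square field_simps)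
      moreover have "0 \<le> u * u" by simp
      ultimately show ?thesis unfolding S_def u_def[symmetric] using u by linarith
    qed
    finally show ?thesis unfolding tu .
  next
    assume "t = 2 * s + 1"
    then have tu: "real t = 2 * S - 1" "N = 3 * S - 1" by (simp_all add: S_def N_def)
    have S0: "0 < S" by (simp add: S_def)
    have "(6 * (57736 / 100000 * ((S + 1) * N + (N ^ 3 + 2 * N) / S)) + 4 * (2 * N - 1) * (70711 / 100000 * (N + N\<^sup>2 / S))) * S
      = 346416 / 100000 * (30 * S ^ 3 - 25 * S\<^sup>2 + 14 * S - 3) + 282844 / 100000 * (72 * S ^ 3 - 78 * S\<^sup>2 + 27 * S - 3)"
      using S0 unfolding tu by (simp add: field_simps power2_eq_square power3_eq_cube)
    also have "\<dots> < 108 * (2 * S - 1)\<^sup>2 * S"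
    proof -
      have "108 * (2 * (u + 1) - 1)\<^sup>2 * (u + 1) - (346416 / 100000 * (30 * (u + 1) ^ 3 - 25 * (u + 1)\<^sup>2 + 14 * (u + 1) - 3)
          + 282844 / 100000 * (72 * (u + 1) ^ 3 - 78 * (u + 1)\<^sup>2 + 27 * (u + 1) - 3))
        = 166152 / 100000 + 10686108 / 100000 * u + 24850488 / 100000 * (u * u) + 12442752 / 100000 * (u * (u * u))"
        by (simp add: power2_eq_square power3_eq_cube field_simps)
      moreover have "0 \<le> u * u" "0 \<le> u * (u * u)" using u by simp_all
      ultimately show ?thesis unfolding S_def u_def[symmetric] using u by linarith
    qed
    finally show ?thesis unfolding tu using S0 by (simp only: mult_less_cancel_right_pos)
  qed
qed

text \<open>The substitution \<open>x = (1 - u) / 2\<close> carries \<open>[-1, 1]\<close> to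
  \<open>[0, 1]\<close> and \<open>u = 1\<close> to 0; its Jacobian accounts for the division by
  2.\<close>

lemma kernel_sphere_reproducing:
  fixes p :: "real poly"
  assumes "degree p \<le> t"
  shows "integral {-1..1} (poly (pcompose (zonal_kernel s t) [:1/2, -1/2:] * p)) / 2 = poly p 1"
proof -
  let ?f = "poly (pcompose (zonal_kernel s t) [:1/2, -1/2:] * p)"
  have "degree (pcompose p [:1, -2:]) \<le> t" using assms by (simp add: degree_pcompose)
  from kernel_reproducing[OF this, of s]
  have rep: "integral {0..1} (\<lambda>x. poly (zonal_kernel s t) x * poly p (1 - 2 * x)) = poly p 1"
    by (simp add: I01_def poly_mult[abs_def] poly_pcompose mult.commute)
  have aff: "((\<lambda>x. ?f ((-2) *\<^sub>R x + 1)) has_integral (1 / \<bar>-2\<bar> ^ DIM(real)) *\<^sub>R integral {-1..1} ?f)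
      ((\<lambda>x. (1 / (-2)) *\<^sub>R x + - ((1 / (-2)) *\<^sub>R 1)) ` cbox (-1) 1)"
    by (rule has_integral_affinity, unfold box_real, rule integrable_integral,
        rule integrable_continuous_real, intro continuous_intros, simp)
  have img: "(\<lambda>x::real. (1 / (-2)) *\<^sub>R x + - ((1 / (-2)) *\<^sub>R 1)) ` cbox (-1) 1 = {0..1}"
  proof -
    have "x \<in> (\<lambda>x::real. - (x / 2) + 1 / 2) ` {-1..1}" if "0 \<le> x" "x \<le> 1" for x
      by (rule image_eqI[of _ _ "1 - 2 * x"]) (use that in \<open>auto simp: field_simps\<close>)
    then show ?thesis by auto
  qed
  have eq: "?f ((-2) *\<^sub>R x + 1) = poly (zonal_kernel s t) x * poly p (1 - 2 * x)" for x
    by (simp add: poly_pcompose algebra_simps)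
  have "((\<lambda>x. poly (zonal_kernel s t) x * poly p (1 - 2 * x)) has_integral integral {-1..1} ?f / 2) {0..1}"
    using aff unfolding eq img by simp
  with rep show ?thesis by (simp only: integral_unique)
qed

section \<open>Existence of designs\<close>

lemma rotz_sph: "rotz \<phi> (vector [sin \<theta>, 0, cos \<theta>]) = sph \<theta> \<phi>"
  by (simp add: rotz_def sph_def vec_eq_iff forall_3 mult.commute)

text \<open>The maximum is taken over the snake only, so \<open>h\<close> may be negative elsewhere
  on the sphere. What enters as coefficients are its values at the quadrature nodes, and these lie
  on the snake.\<close>

lemma snake_variation_bound:
  assumes t: "1 \<le> t" and s: "s = (t - 1) div 2"
    and F: "polyfun t F" and mean: "(\<integral>x. Re (F x) \<partial>sphere_measure) = 0"
    and nz: "norm z = 1" "Re (F z) \<noteq> 0"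
  defines "M \<equiv> 2 * (t + s) + 1"
  defines "C \<equiv> 6 * variation_integral (zonal_kernel s t)
     + 4 * real M * weighted_variation_integral (zonal_kernel s t)"
  shows "\<exists>x\<in>{0..2 * real M - 1}. 0 < Re (F (snake M x)) \<and>
    (\<forall>s\<in>{0..2 * real M - 1}. Re (F (snake M s)) \<le> Re (F (snake M x))) \<and>
    variation_le (\<lambda>s. Re (F (snake M s))) 0 (2 * real M - 1) (C * Re (F (snake M x)))"
proof -
  let ?L = "2 * real M - 1"
  have M2: "2 \<le> M" and L: "0 \<le> ?L" using t by (auto simp: M_def)
  have "continuous_on {0..?L} (\<lambda>s. Re (F (snake M s)))"
    by (intro continuous_intros continuous_on_compose2[OF continuous_polyfun[OF F] continuous_on_snake]) auto
  then obtain x where x: "x \<in> {0..?L}" "\<And>s. s \<in> {0..?L} \<Longrightarrow> Re (F (snake M s)) \<le> Re (F (snake M x))"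
    using continuous_attains_sup[of "{0..?L}" "\<lambda>s. Re (F (snake M s))"] L by auto
  define m where "m = Re (F (snake M x))"
  define h where "h y = m - Re (F y)" for y
  define y where "y j k = sph (fejer_node M j) (2 * pi * real k / real M)" for j k :: nat
  define c where "c j = fejer_weight (t + s) j / real M" for j
  have c: "0 < c j" for j using fejer_weight_pos[of "t + s" j] by (simp add: c_def M_def)
  have H: "polyfun t (\<lambda>y. of_real m + (-1) * F y)"
    by (intro polyfun.add polyfun_const polyfun_cmult F)
  have hH: "h y = Re (of_real m + (-1) * F y)" for y by (simp add: h_def)
  have quad: "(\<integral>x. Re (f x) \<partial>sphere_measure) = (\<Sum>j<M. \<Sum>k<M. c j * Re (f (y j k)))"
    if "polyfun (2 * (t + s)) f" for f
  proof -
    have w: "(\<Sum>j<M. fejer_weight (t + s) j * poly p (cos (fejer_node M j))) = integral {-1..1} (poly p) / 2"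
      if "degree p \<le> 2 * (t + s)" for p
      using fejer_quadrature[OF that] unfolding M_def .
    have "2 * (t + s) < M" by (simp add: M_def)
    from sphere_product_quadrature[OF w that this] show ?thesis
      unfolding y_def c_def rotz_sph .
  qed
  define K where "K = pcompose (zonal_kernel s t) [:1/2, -1/2:]"
  have K: "poly K u = poly (zonal_kernel s t) ((1 - u) / 2)" for u
    by (simp add: K_def poly_pcompose diff_divide_distrib)
  have rep: "h z = (\<Sum>j<M. \<Sum>k<M. c j * h (y j k) * poly (zonal_kernel s t) ((1 - z \<bullet> y j k) / 2))"
    if z: "norm z = 1" for z
  proof -
    have dK: "degree K \<le> t + 2 * s"
      unfolding K_def using degree_kernel[of s t] by (simp add: degree_pcompose)
    \<comment> \<open>Kernel and \<open>h\<close> together have degree at most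
      \<open>(t + 2 s) + t = 2 (t + s)\<close>, exactly the degree up to which
      \<open>M = 2 (t + s) + 1\<close> nodes in each direction are exact.\<close>
    have "polyfun (degree K + t) (\<lambda>y. of_real (poly K (z \<bullet> y)) * (of_real m + (-1) * F y))"
      by (intro polyfun_mult polyfun_poly polyfun_inner H)
    then have "polyfun (2 * (t + s)) (\<lambda>y. of_real (poly K (z \<bullet> y)) * (of_real m + (-1) * F y))"
      by (rule polyfun_mono) (use dK in simp)
    from quad[OF this] have "(\<integral>y. poly K (z \<bullet> y) * h y \<partial>sphere_measure)
        = (\<Sum>j<M. \<Sum>k<M. c j * (poly K (z \<bullet> y j k) * h (y j k)))"
      by (simp add: hH)
    moreover have "(\<integral>y. poly K (z \<bullet> y) * h y \<partial>sphere_measure) = h z"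
      unfolding hH by (rule sphere_reproducing_kernel[OF _ H z]) (simp only: K_def kernel_sphere_reproducing)
    ultimately have "h z = (\<Sum>j<M. \<Sum>k<M. c j * (poly K (z \<bullet> y j k) * h (y j k)))" by simp
    then show ?thesis by (simp add: K mult_ac)
  qed
  have total: "(\<Sum>j<M. \<Sum>k<M. c j * h (y j k)) = m"
  proof -
    have "(\<integral>y. h y \<partial>sphere_measure) = m"
    proof -
      have "continuous_on UNIV (\<lambda>y. Re (F y))" by (intro continuous_intros continuous_polyfun[OF F])
      then show ?thesis
        unfolding h_def using mean
        by (subst Bochner_Integration.integral_diff) (auto intro!: integrable_sphere_measure continuous_intros)
    qed
    then show ?thesis using quad[OF polyfun_mono[OF H]] unfolding hH by simp
  qed
  have h0: "0 \<le> h (y j k)" if jk: "j < M" "k < M" for j k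
  proof -
    obtain s where "s \<in> {0..?L}" "snake M s = y j k"
      using snake_on_grid[OF M2 jk] unfolding y_def by blast
    then show ?thesis using x(2)[of s] by (simp add: h_def m_def)
  qed
  have m0: "0 \<le> m"
    unfolding total[symmetric] using h0 c by (intro sum_nonneg mult_nonneg_nonneg) (auto intro: less_imp_le)
  \<comment> \<open>If \<open>m\<close> were 0, the nonnegative terms \<open>c j * h (y j k)\<close>
    would sum to 0 and so all vanish; the reproducing formula would then give
    \<open>h z = 0\<close>, that is \<open>Re (F z) = 0\<close>.\<close>
  have "m \<noteq> 0"
  proof
    assume m: "m = 0"
    have "\<forall>j\<in>{..<M}. (\<Sum>k<M. c j * h (y j k)) = 0"
      by (subst sum_nonneg_eq_0_iff[symmetric])
         (use total m h0 c in \<open>auto intro!: sum_nonneg mult_nonneg_nonneg intro: less_imp_le\<close>)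
    then have "\<forall>k\<in>{..<M}. c j * h (y j k) = 0" if "j < M" for j
      by (subst sum_nonneg_eq_0_iff[symmetric])
         (use that h0 c in \<open>auto intro!: mult_nonneg_nonneg intro: less_imp_le\<close>)
    then have zero: "c j * h (y j k) = 0" if "j < M" "k < M" for j k using that by blast
    have "h z = 0"
      unfolding rep[OF nz(1)]
      by (intro sum.neutral ballI) (simp only: zero lessThan_iff mult_zero_left)
    then show False using nz(2) m by (simp add: h_def)
  qed
  then have mpos: "0 < m" using m0 by simp
  have "variation_le (\<lambda>r. \<Sum>jk\<in>{..<M} \<times> {..<M}. (c (fst jk) * h (y (fst jk) (snd jk))) *
      poly (zonal_kernel s t) ((1 - snake M r \<bullet> y (fst jk) (snd jk)) / 2)) 0 ?L
      (\<Sum>jk\<in>{..<M} \<times> {..<M}. (c (fst jk) * h (y (fst jk) (snd jk))) * C)"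
  proof (rule variation_le_sum)
    fix jk assume "jk \<in> {..<M} \<times> {..<M}"
    then have jk: "fst jk < M" "snd jk < M" by auto
    show "0 \<le> c (fst jk) * h (y (fst jk) (snd jk))"
      using h0[OF jk] c[of "fst jk"] by simp
    have "real (snd jk) \<le> real M" using jk by simp
    then have "2 * pi * real (snd jk) \<le> 2 * pi * real M" by (intro mult_left_mono) auto
    then have "2 * pi * real (snd jk) / real M \<le> 2 * pi" using M2 by (simp add: field_simps)
    then show "variation_le (\<lambda>r. poly (zonal_kernel s t) ((1 - snake M r \<bullet> y (fst jk) (snd jk)) / 2)) 0 ?L C"
      unfolding y_def C_def
      by (intro snake_variation[OF M2]) (use fejer_node_bounds[OF jk(1)] in auto)
  qed simp
  moreover have "(\<Sum>jk\<in>{..<M} \<times> {..<M}. (c (fst jk) * h (y (fst jk) (snd jk))) * C) = C * m"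
    unfolding total[symmetric] sum_distrib_left sum.cartesian_product case_prod_beta
    by (simp only: mult.commute)
  moreover have "(\<Sum>jk\<in>{..<M} \<times> {..<M}. (c (fst jk) * h (y (fst jk) (snd jk))) *
      poly (zonal_kernel s t) ((1 - snake M r \<bullet> y (fst jk) (snd jk)) / 2)) = h (snake M r)" for r
    unfolding rep[OF norm_snake] sum.cartesian_product case_prod_beta ..
  ultimately have "variation_le (\<lambda>r. h (snake M r)) 0 ?L (C * m)" by (simp only:)
  then have "variation_le (\<lambda>r. m - h (snake M r)) 0 ?L (C * m)" by (rule variation_le_minus)
  then have "variation_le (\<lambda>r. Re (F (snake M r))) 0 ?L (C * m)" by (simp add: h_def)
  then show ?thesis using x mpos unfolding m_def by blast
qed

text \<open>Monomials are linearly dependent on the sphere because the squares of the coordinates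
  sum to 1, whereas the curve theorem needs every nonzero coefficient vector to give a nonzero
  function. A maximal independent subfamily resolves this and still spans.\<close>

lemma exists_independent_spanning:
  fixes \<psi> :: "'e \<Rightarrow> 'a \<Rightarrow> real"
  assumes "finite E"
  obtains n and e :: "nat \<Rightarrow> 'e" where "\<And>i. i < n \<Longrightarrow> e i \<in> E"
    and "\<And>a. (\<And>x. x \<in> X \<Longrightarrow> (\<Sum>i<n. a i * \<psi> (e i) x) = 0) \<Longrightarrow> \<forall>i<n. a i = 0"
    and "\<And>d. d \<in> E \<Longrightarrow> \<exists>a. \<forall>x\<in>X. \<psi> d x = (\<Sum>i<n. a i * \<psi> (e i) x)"
proof -
  \<comment> \<open>Independence refers to indices rather than functions, so two indices with the
    same function on \<open>X\<close> count as dependent.\<close>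
  define ind where "ind B \<longleftrightarrow> (\<forall>a. (\<forall>x\<in>X. (\<Sum>b\<in>B. a b * \<psi> b x) = 0) \<longrightarrow> (\<forall>b\<in>B. a b = 0))" for B
  define S where "S = {B. B \<subseteq> E \<and> ind B}"
  have "finite S" "{} \<in> S" using assms by (auto simp: S_def ind_def)
  then obtain B where B: "B \<in> S" "\<And>B'. B' \<in> S \<Longrightarrow> B \<subseteq> B' \<Longrightarrow> B = B'"
    using finite_has_maximal[of S] by blast
  have BE: "B \<subseteq> E" "ind B" "finite B" using B(1) assms finite_subset by (auto simp: S_def)
  have span: "\<exists>a. \<forall>x\<in>X. \<psi> d x = (\<Sum>b\<in>B. a b * \<psi> b x)" if d: "d \<in> E" for d
  proof (cases "d \<in> B")
    case True
    have "(\<Sum>b\<in>B. (if b = d then 1 else 0) * \<psi> b x) = \<psi> d x" for x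
      using True BE(3) by (simp add: if_distrib[of "\<lambda>c. c * _"] cong: if_cong)
    then show ?thesis by metis
  next
    case False
    then have "insert d B \<notin> S" using B(2)[of "insert d B"] by blast
    then have "\<not> ind (insert d B)" using BE d by (simp add: S_def)
    then obtain a where a: "\<And>x. x \<in> X \<Longrightarrow> (\<Sum>b\<in>insert d B. a b * \<psi> b x) = 0" "\<exists>b\<in>insert d B. a b \<noteq> 0"
      unfolding ind_def by blast
    have a': "a d * \<psi> d x + (\<Sum>b\<in>B. a b * \<psi> b x) = 0" if "x \<in> X" for x
      using a(1)[OF that] BE(3) False by simp
    have ad: "a d \<noteq> 0"
    proof
      assume "a d = 0"
      then have "\<forall>x\<in>X. (\<Sum>b\<in>B. a b * \<psi> b x) = 0" using a' by simp
      then have "\<forall>b\<in>B. a b = 0" using BE(2) unfolding ind_def by blast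
      then show False using a(2) \<open>a d = 0\<close> by auto
    qed
    have "\<psi> d x = (\<Sum>b\<in>B. (- a b / a d) * \<psi> b x)" if "x \<in> X" for x
    proof -
      have "(\<Sum>b\<in>B. (- a b / a d) * \<psi> b x) = - (\<Sum>b\<in>B. a b * \<psi> b x) / a d"
        by (simp add: sum_negf[symmetric] sum_divide_distrib)
      also have "\<dots> = \<psi> d x" using a'[OF that] ad by (simp add: field_simps eq_neg_iff_add_eq_0 add.commute)
      finally show ?thesis ..
    qed
    then show ?thesis by (intro exI[of _ "\<lambda>b. - a b / a d"]) blast
  qed
  obtain e where e: "bij_betw e {0..<card B} B" using ex_bij_betw_nat_finite[OF BE(3)] by blast
  then have e': "bij_betw e {..<card B} B" by (simp add: lessThan_atLeast0)
  have reindex: "(\<Sum>i<card B. a (e i) * \<psi> (e i) x) = (\<Sum>b\<in>B. a b * \<psi> b x)" for a x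
    using sum.reindex_bij_betw[OF e', of "\<lambda>b. a b * \<psi> b x"] .
  show ?thesis
  proof (rule that[of "card B" e])
    show "e i \<in> E" if "i < card B" for i
      using bij_betwE[OF e'] BE(1) that by auto
    show "\<forall>i<card B. a i = 0" if a: "\<And>x. x \<in> X \<Longrightarrow> (\<Sum>i<card B. a i * \<psi> (e i) x) = 0" for a
    proof -
      define b where "b = (\<lambda>d. a (the_inv_into {..<card B} e d))"
      have be: "b (e i) = a i" if "i < card B" for i
        using the_inv_into_f_f[OF bij_betw_imp_inj_on[OF e'], of i] that by (simp add: b_def)
      have "(\<Sum>d\<in>B. b d * \<psi> d x) = 0" if "x \<in> X" for x
        using a[OF that] be by (simp flip: reindex)
      then have "\<forall>d\<in>B. b d = 0" using BE(2) unfolding ind_def by blast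
      then show ?thesis using be bij_betwE[OF e'] by auto
    qed
    show "\<exists>a. \<forall>x\<in>X. \<psi> d x = (\<Sum>i<card B. a i * \<psi> (e i) x)" if d: "d \<in> E" for d
    proof -
      obtain a where "\<forall>x\<in>X. \<psi> d x = (\<Sum>b\<in>B. a b * \<psi> b x)" using span[OF d] by blast
      then show ?thesis by (intro exI[of _ "\<lambda>i. a (e i)"]) (simp add: reindex)
    qed
  qed
qed

text \<open>The parameters increase strictly and the snake is injective, so there are exactly
  \<open>N\<close> distinct points. Vanishing sums for the independent family extend by linearity to
  all monomials of degree at most \<open>t\<close>.\<close>

theorem spherical_design_of_size:
  assumes t: "1 \<le> t" and N: "54 * t\<^sup>2 \<le> N"
  shows "\<exists>X. spherical_design t X \<and> card X = N"
proof -
  define s where "s = (t - 1) div 2"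
  define M where "M = 2 * (t + s) + 1"
  define C where "C = 6 * variation_integral (zonal_kernel s t)
     + 4 * real M * weighted_variation_integral (zonal_kernel s t)"
  let ?L = "2 * real M - 1"
  have M2: "2 \<le> M" using t by (simp add: M_def)
  have "C < 108 * (real t)\<^sup>2"
  proof -
    let ?S = "real s + 1" and ?N = "real t + real s + 1"
    have "C \<le> 6 * (57736 / 100000 * ((?S + 1) * ?N + (?N ^ 3 + 2 * ?N) / ?S))
      + 4 * real M * (70711 / 100000 * (?N + ?N\<^sup>2 / ?S))"
      unfolding C_def
      by (intro add_mono mult_left_mono kernel_variation kernel_weighted_variation) auto
    also have "real M = 2 * ?N - 1" by (simp add: M_def)
    finally show ?thesis using variation_constant_bound[OF t s_def] by linarith
  qed
  moreover have "real (54 * t\<^sup>2) \<le> real N" using N by (simp only: of_nat_le_iff)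
  ultimately have CN: "C < 2 * real N" by simp
  have "0 < 54 * t\<^sup>2" using t by simp
  then have N0: "0 < N" using N by linarith
  define E where "E = {(i, j, k :: nat). i + j + k \<le> t}"
  define mon where "mon e x = (case e of (i, j, k) \<Rightarrow> (x $ 1) ^ i * (x $ 2) ^ j * (x $ 3) ^ k)"
    for e :: "nat \<times> nat \<times> nat" and x :: "real ^ 3"
  \<comment> \<open>With the mean removed, exactness of the equal weight rule is the vanishing of a
    sum. The constant monomial becomes 0 and cannot belong to an independent family.\<close>
  define \<psi> where "\<psi> e x = mon e x - (\<integral>y. mon e y \<partial>sphere_measure)" for e x
  have finE: "finite E" unfolding E_def by (rule finite_poly3_exponents)
  have cmon: "continuous_on A (mon e)" for e A
    unfolding mon_def by (cases e) (auto intro!: continuous_intros)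
  have pmon: "polyfun t (\<lambda>x. of_real (mon e x))" if "e \<in> E" for e
  proof -
    obtain i j k where e: "e = (i, j, k)" "i + j + k \<le> t" using \<open>e \<in> E\<close> by (auto simp: E_def)
    have "polyfun (i * 1 + j * 1 + k * 1) (\<lambda>x. of_real (x $ 1) ^ i * of_real (x $ 2) ^ j * of_real (x $ 3) ^ k)"
      by (intro polyfun_mult polyfun_power polyfun_coords)
    then show ?thesis using e polyfun_mono by (simp add: mon_def)
  qed
  obtain n and e :: "nat \<Rightarrow> nat \<times> nat \<times> nat" where e: "\<And>i. i < n \<Longrightarrow> e i \<in> E"
    and ind: "\<And>a. (\<And>x. x \<in> sphere 0 1 \<Longrightarrow> (\<Sum>i<n. a i * \<psi> (e i) x) = 0) \<Longrightarrow> \<forall>i<n. a i = 0"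
    and span: "\<And>d. d \<in> E \<Longrightarrow> \<exists>a. \<forall>x\<in>sphere 0 1. \<psi> d x = (\<Sum>i<n. a i * \<psi> (e i) x)"
    using exists_independent_spanning[OF finE, of "sphere 0 1" \<psi>] by blast
  have "\<exists>p :: nat \<Rightarrow> real. (\<forall>l<N. p l \<in> {0..?L}) \<and> (\<forall>k l. k < l \<longrightarrow> l < N \<longrightarrow> p k < p l) \<and>
      (\<forall>i<n. (\<Sum>l<N. \<psi> (e i) (snake M (p l))) = 0)"
  proof (rule equal_weight_points_on_curve[OF _ N0 _ CN])
    show "0 < ?L" using M2 by simp
    show "continuous_on {0..?L} (\<lambda>s. \<psi> (e i) (snake M s))" for i
      unfolding \<psi>_def by (intro continuous_intros continuous_on_compose2[OF cmon continuous_on_snake]) auto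
    fix a :: "nat \<Rightarrow> real" assume a: "\<exists>i<n. a i \<noteq> 0"
    define F :: "real ^ 3 \<Rightarrow> complex" where "F x = (\<Sum>i<n. of_real (a i) * (of_real (mon (e i) x) + of_real (- (\<integral>y. mon (e i) y \<partial>sphere_measure))))"
      for x
    have F: "polyfun t F"
      unfolding F_def by (intro polyfun_sum polyfun_cmult polyfun.add pmon polyfun_const e) auto
    have ReF: "Re (F x) = (\<Sum>i<n. a i * \<psi> (e i) x)" for x
      by (simp add: F_def \<psi>_def)
    have "(\<integral>x. Re (F x) \<partial>sphere_measure) = 0"
    proof -
      have "(\<integral>x. \<psi> d x \<partial>sphere_measure) = 0" for d
        unfolding \<psi>_def
        by (subst Bochner_Integration.integral_diff) (auto intro!: integrable_sphere_measure cmon)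
      then show ?thesis
        unfolding ReF
        by (subst Bochner_Integration.integral_sum) (auto intro!: integrable_sphere_measure continuous_intros cmon simp: \<psi>_def)
    qed
    moreover obtain z where "norm z = 1" "Re (F z) \<noteq> 0"
      using ind[of a] a unfolding ReF by (metis mem_sphere_0)
    ultimately obtain x where x: "x \<in> {0..?L}" "0 < Re (F (snake M x))"
      "\<And>s. s \<in> {0..?L} \<Longrightarrow> Re (F (snake M s)) \<le> Re (F (snake M x))"
      "variation_le (\<lambda>s. Re (F (snake M s))) 0 ?L (C * Re (F (snake M x)))"
      using snake_variation_bound[OF t s_def F] unfolding M_def[symmetric] C_def[symmetric] by blast
    then show "\<exists>x\<in>{0..?L}. 0 < (\<Sum>i<n. a i * \<psi> (e i) (snake M x)) \<and>
      (\<forall>s\<in>{0..?L}. (\<Sum>i<n. a i * \<psi> (e i) (snake M s)) \<le> (\<Sum>i<n. a i * \<psi> (e i) (snake M x))) \<and>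
      variation_le (\<lambda>s. \<Sum>i<n. a i * \<psi> (e i) (snake M s)) 0 ?L (C * (\<Sum>i<n. a i * \<psi> (e i) (snake M x)))"
      unfolding ReF by blast
  qed
  then obtain p :: "nat \<Rightarrow> real" where p: "\<And>l. l < N \<Longrightarrow> p l \<in> {0..?L}"
    "\<And>k l. k < l \<Longrightarrow> l < N \<Longrightarrow> p k < p l"
    "\<And>i. i < n \<Longrightarrow> (\<Sum>l<N. \<psi> (e i) (snake M (p l))) = 0" by blast
  define q where "q l = snake M (p l)" for l
  have "inj_on p {..<N}"
    by (rule linorder_inj_onI') (use p(2) in force)
  moreover have "inj_on (snake M) (p ` {..<N})"
    by (rule inj_on_subset[OF snake_inj[OF M2]]) (use p(1) in blast)
  moreover have "q = snake M \<circ> p" by (simp add: fun_eq_iff q_def)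
  ultimately have inj: "inj_on q {..<N}" by (simp only: comp_inj_on)
  have zero: "(\<Sum>l<N. \<psi> d (q l)) = 0" if d: "d \<in> E" for d
  proof -
    obtain a where a: "\<And>x. x \<in> sphere 0 1 \<Longrightarrow> \<psi> d x = (\<Sum>i<n. a i * \<psi> (e i) x)"
      using span[OF d] by blast
    have "(\<Sum>l<N. \<psi> d (q l)) = (\<Sum>l<N. \<Sum>i<n. a i * \<psi> (e i) (q l))"
      by (rule sum.cong[OF refl a]) (simp add: q_def norm_snake)
    also have "\<dots> = (\<Sum>i<n. a i * (\<Sum>l<N. \<psi> (e i) (q l)))"
      unfolding sum_distrib_left by (rule sum.swap)
    also have "\<dots> = 0" using p(3) by (simp add: q_def)
    finally show ?thesis .
  qed
  have moment: "(\<Sum>l<N. mon d (q l)) = real N * (\<integral>y. mon d y \<partial>sphere_measure)" if "d \<in> E" for d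
    using zero[OF that] by (simp add: \<psi>_def sum_subtractf)
  have cardX: "card (q ` {..<N}) = N" using card_image[OF inj] by simp
  have "spherical_design t (q ` {..<N})"
    unfolding spherical_design_def
  proof (intro conjI allI)
    fix c
    have poly3: "poly3 t c x = (\<Sum>d\<in>E. (case d of (i, j, k) \<Rightarrow> c i j k) * mon d x)" for x
      unfolding poly3_def E_def by (rule sum.cong) (auto simp: mon_def)
    have "(\<Sum>x\<in>q ` {..<N}. poly3 t c x) = (\<Sum>l<N. poly3 t c (q l))"
      by (simp add: sum.reindex[OF inj])
    also have "\<dots> = (\<Sum>d\<in>E. (case d of (i, j, k) \<Rightarrow> c i j k) * (\<Sum>l<N. mon d (q l)))"
      unfolding poly3 sum_distrib_left by (rule sum.swap)
    also have "\<dots> = (\<Sum>d\<in>E. (case d of (i, j, k) \<Rightarrow> c i j k) * (real N * (\<integral>y. mon d y \<partial>sphere_measure)))"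
      by (rule sum.cong) (simp_all add: moment)
    also have "\<dots> = real N * (\<Sum>d\<in>E. (case d of (i, j, k) \<Rightarrow> c i j k) * (\<integral>y. mon d y \<partial>sphere_measure))"
      by (simp add: sum_distrib_left mult.left_commute)
    also have "(\<Sum>d\<in>E. (case d of (i, j, k) \<Rightarrow> c i j k) * (\<integral>y. mon d y \<partial>sphere_measure)) = (\<integral>x. poly3 t c x \<partial>sphere_measure)"
      unfolding poly3
      by (subst Bochner_Integration.integral_sum) (auto intro!: integrable_sphere_measure continuous_intros cmon)
    finally show "1 / real (card (q ` {..<N})) * (\<Sum>x\<in>q ` {..<N}. poly3 t c x) = (\<integral>x. poly3 t c x \<partial>sphere_measure)"
      using N0 by (simp add: cardX)
  qed (auto simp: q_def norm_snake)
  with cardX show ?thesis by blast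
qed

theorem theorem1p1:
  shows "(\<forall>t q :: nat. 1 \<le> t \<and> 3 * t \<le> q \<longrightarrow> (\<exists>X. spherical_design t X \<and> card X = 6 * q\<^sup>2)) \<and>
         (\<forall>t :: nat. 1 \<le> t \<longrightarrow> (\<exists>X. spherical_design t X \<and> card X = 54 * t\<^sup>2))"
proof (intro conjI allI impI)
  fix t q :: nat assume tq: "1 \<le> t \<and> 3 * t \<le> q"
  then have "(3 * t)\<^sup>2 \<le> q\<^sup>2" by (intro power_mono) auto
  then have "54 * t\<^sup>2 \<le> 6 * q\<^sup>2" by (simp add: power_mult_distrib)
  with tq show "\<exists>X. spherical_design t X \<and> card X = 6 * q\<^sup>2"
    by (intro spherical_design_of_size) auto
qed (intro spherical_design_of_size; simp)

end
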